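(* Let $\mathcal A$ be a session automaton over $\Sigma$ and $D$. Let $k$ be the least number such that $\mathit{snf}(L(\mathcal A))\subseteq(\Sigma\times\Gamma_k)^*$, and let $N$ be the number of states of the minimal (complete) deterministic finite automaton over $\Sigma\times\Gamma_k$ recognizing $\mathit{snf}(L(\mathcal A))$ (the canonical session automaton of $\mathcal A$). There is a learning algorithm which, interacting with a teacher for $L(\mathcal A)$ that answers membership queries (given a data word $w$, whether $w\in L(\mathcal A)$) and equivalence queries (given a hypothesis session automaton $\mathcal H$, either "yes" if $L(\mathcal H)=L(\mathcal A)$, or a data word in the symmetric difference of $L(\mathcal H)$ and $L(\mathcal A)$), terminates and outputs a session automaton recognizing $L(\mathcal A)$ (namely the canonical session automaton), using at most $O(k|\Sigma|N^2+N\log M)$ membership queries and $O(N)$ equivalence queries, where $M$ is the length of the longest counterexample returned by an equivalence query.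
   Context: $\Sigma$ is a non-empty finite alphabet, $D$ an infinite set of data values; data words are elements of $(\Sigma\times D)^*$. A session automaton $(S,\mathcal R,\iota,F,\Delta)$ with $\mathcal R=\{1,\dots,k\}$ has finite non-empty state set $S$, initial state $\iota$, final states $F$, and finitely many transitions $(s,(a,\pi),s')$ with $a\in\Sigma$, $\pi\in\Gamma_k=\{r^\circledast,r^\uparrow:r\in\{1,\dots,k\}\}$; configurations $(s,\tau,U)$ with $\tau:\mathcal R\rightharpoonup D$ partial, $U\subseteq D$; reading $(a,d)$ on register $r$ requires $d=\tau(r)$ for $r^\uparrow$ and $d\notin U$ for $r^\circledast$, then sets $\tau(r):=d$, $U:=U\cup\{d\}$; runs start in $(\iota,\emptyset,\emptyset)$ and $L(\mathcal A)$ is the set of data words with a run ending in $F$. A session automaton can equally be read as a finite automaton over the finite alphabet $\Sigma\times\Gamma_k$. Let $\Gamma=\{r^\circledast,r^\uparrow:r\in\mathbb N_{>0}\}$, $\mathrm{reg}(r^\circledast)=\mathrm{reg}(r^\uparrow)=r$. For $w=(a_1,d_1)\cdots(a_n,d_n)$, with $\mathrm{first}_w(d),\mathrm{last}_w(d)$ the first and last positions carrying $d$, the symbolic normal form $\mathit{snf}(w)=(a_1,\pi_1)\cdots(a_n,\pi_n)\in(\Sigma\times\Gamma)^*$ is defined with $\mathit{Free}(0)=\mathbb N_{>0}$; $\pi_i=(\min\mathit{Free}(i-1))^\circledast$ if $i=\mathrm{first}_w(d_i)$, else $\pi_i=(\mathrm{reg}(\pi_{\mathrm{first}_w(d_i)}))^\uparrow$;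 $\mathit{Free}(i)=\mathit{Free}(i-1)\setminus\{\min\mathit{Free}(i-1)\}$ if $i=\mathrm{first}_w(d_i)\ne\mathrm{last}_w(d_i)$, $\mathit{Free}(i-1)\cup\{\mathrm{reg}(\pi_i)\}$ if $i=\mathrm{last}_w(d_i)$, $\mathit{Free}(i-1)$ otherwise. $\mathit{snf}(L)=\{\mathit{snf}(w)\mid w\in L\}$; for a session automaton with $k$ registers, $\mathit{snf}(L(\mathcal A))$ is a regular language over $\Sigma\times\Gamma_k$. *)

theory Defs
  imports Complex_Main
begin

section \<open>Session automata\<close>

text \<open>
  \<open>Fresh r\<close> is the operation written $r^\circledast$, \<open>Reuse r\<close> the one written $r^\uparrow$.
\<close>

datatype reg_op = Fresh (reg: nat) | Reuse (reg: nat)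

definition Gam :: "nat \<Rightarrow> reg_op set" where
  "Gam k = {\<pi>. 1 \<le> reg \<pi> \<and> reg \<pi> \<le> k}"

record ('s, 'a) session_automaton =
  states :: "'s set"
  registers :: nat
  initial :: 's
  finals :: "'s set"
  transitions :: "('s \<times> ('a \<times> reg_op) \<times> 's) set"

definition session_automaton :: "'a set \<Rightarrow> ('s, 'a) session_automaton \<Rightarrow> bool" where
  "session_automaton \<Sigma> A \<longleftrightarrow>
     finite (states A) \<and> initial A \<in> states A \<and> finals A \<subseteq> states A \<and>
     finite (transitions A) \<and>
     transitions A \<subseteq> states A \<times> (\<Sigma> \<times> Gam (registers A)) \<times> states A"

type_synonym ('s, 'd) config = "'s \<times> (nat \<rightharpoonup> 'd) \<times> 'd set"

inductive step ::
  "('s, 'a) session_automaton \<Rightarrow> ('s, 'd) config \<Rightarrow> 'a \<times> 'd \<Rightarrow> ('s, 'd) config \<Rightarrow> bool"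
  for A where
  fresh: "(s, (a, Fresh r), s') \<in> transitions A \<Longrightarrow> d \<notin> U \<Longrightarrow>
     step A (s, \<tau>, U) (a, d) (s', \<tau>(r \<mapsto> d), insert d U)"
| reuse: "(s, (a, Reuse r), s') \<in> transitions A \<Longrightarrow> \<tau> r = Some d \<Longrightarrow>
     step A (s, \<tau>, U) (a, d) (s', \<tau>(r \<mapsto> d), insert d U)"

fun run ::
  "('s, 'a) session_automaton \<Rightarrow> ('s, 'd) config \<Rightarrow> ('a \<times> 'd) list \<Rightarrow> ('s, 'd) config \<Rightarrow> bool"
where
  "run A c [] c' \<longleftrightarrow> c = c'"
| "run A c (x # w) c' \<longleftrightarrow> (\<exists>c''. step A c x c'' \<and> run A c'' w c')"

definition data_lang ::
  "'a set \<Rightarrow> 'd set \<Rightarrow> ('s, 'a) session_automaton \<Rightarrow> ('a \<times> 'd) list set" where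
  "data_lang \<Sigma> D A =
     {w \<in> lists (\<Sigma> \<times> D). \<exists>s \<tau> U. run A (initial A, Map.empty, {}) w (s, \<tau>, U) \<and> s \<in> finals A}"

text \<open>A session automaton read as a finite automaton over the alphabet \<open>\<Sigma> \<times> Gam k\<close>.\<close>

fun sym_path ::
  "('s, 'a) session_automaton \<Rightarrow> 's \<Rightarrow> ('a \<times> reg_op) list \<Rightarrow> 's \<Rightarrow> bool" where
  "sym_path A s [] t \<longleftrightarrow> s = t"
| "sym_path A s (x # u) t \<longleftrightarrow> (\<exists>s'. (s, x, s') \<in> transitions A \<and> sym_path A s' u t)"

definition sym_lang :: "('s, 'a) session_automaton \<Rightarrow> ('a \<times> reg_op) list set" where
  "sym_lang A = {u. \<exists>t \<in> finals A. sym_path A (initial A) u t}"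

definition complete_dfa :: "'a set \<Rightarrow> nat \<Rightarrow> ('s, 'a) session_automaton \<Rightarrow> bool" where
  "complete_dfa \<Sigma> k A \<longleftrightarrow>
     session_automaton \<Sigma> A \<and> registers A = k \<and>
     (\<forall>s \<in> states A. \<forall>x \<in> \<Sigma> \<times> Gam k. \<exists>!s'. (s, x, s') \<in> transitions A)"


section \<open>Symbolic normal form\<close>

text \<open>Positions are counted from 0.\<close>

definition first_pos :: "('a \<times> 'd) list \<Rightarrow> 'd \<Rightarrow> nat" where
  "first_pos w d = (LEAST i. i < length w \<and> snd (w ! i) = d)"

definition last_pos :: "('a \<times> 'd) list \<Rightarrow> 'd \<Rightarrow> nat" where
  "last_pos w d = (GREATEST i. i < length w \<and> snd (w ! i) = d)"

text \<open>
  \<open>snf_upto w i\<close> is the set of registers that are free after the first \<open>i\<close> letters, together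
  with the operations chosen for these letters.
\<close>

primrec snf_upto :: "('a \<times> 'd) list \<Rightarrow> nat \<Rightarrow> nat set \<times> reg_op list" where
  "snf_upto w 0 = ({1..}, [])"
| "snf_upto w (Suc i) =
     (let (free, \<pi>s) = snf_upto w i;
          d = snd (w ! i);
          m = (LEAST r. r \<in> free);
          \<pi> = (if i = first_pos w d then Fresh m else Reuse (reg (\<pi>s ! first_pos w d)));
          free' = (if i = first_pos w d \<and> i \<noteq> last_pos w d then free - {m}
                   else if i = last_pos w d then free \<union> {reg \<pi>}
                   else free)
      in (free', \<pi>s @ [\<pi>]))"

definition snf :: "('a \<times> 'd) list \<Rightarrow> ('a \<times> reg_op) list" where
  "snf w = zip (map fst w) (snd (snf_upto w (length w)))"


section \<open>The canonical session automaton\<close>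

definition snf_registers :: "'a set \<Rightarrow> ('a \<times> 'd) list set \<Rightarrow> nat" where
  "snf_registers \<Sigma> L = (LEAST k. snf ` L \<subseteq> lists (\<Sigma> \<times> Gam k))"

text \<open>Every finite automaton has a copy whose states are natural numbers.\<close>

definition min_dfa_size :: "'a set \<Rightarrow> nat \<Rightarrow> ('a \<times> reg_op) list set \<Rightarrow> nat" where
  "min_dfa_size \<Sigma> k K =
     (LEAST n. \<exists>B :: (nat, 'a) session_automaton.
        complete_dfa \<Sigma> k B \<and> sym_lang B = K \<and> card (states B) = n)"

definition canonical_size :: "'a set \<Rightarrow> ('a \<times> 'd) list set \<Rightarrow> nat" where
  "canonical_size \<Sigma> L = min_dfa_size \<Sigma> (snf_registers \<Sigma> L) (snf ` L)"

text \<open>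
  The minimal automaton is unique up to renaming of states, and so is the canonical session
  automaton.
\<close>

definition canonical ::
  "'a set \<Rightarrow> ('a \<times> 'd) list set \<Rightarrow> ('s, 'a) session_automaton \<Rightarrow> bool" where
  "canonical \<Sigma> L B \<longleftrightarrow>
     complete_dfa \<Sigma> (snf_registers \<Sigma> L) B \<and> sym_lang B = snf ` L \<and>
     card (states B) = canonical_size \<Sigma> L"


section \<open>Learners and teachers\<close>

datatype ('a, 'd) action =
    Member "('a \<times> 'd) list"
  | Equiv "(nat, 'a) session_automaton"
  | Output "(nat, 'a) session_automaton"

datatype ('a, 'd) answer =
    Truth bool
  | Yes
  | Counterexample "('a \<times> 'd) list"

text \<open>
  A learner chooses its next action from the answers received so far. Its own earlier queries are
  determined by these answers.
\<close>

type_synonym ('a, 'd) learner = "('a, 'd) answer list \<Rightarrow> ('a, 'd) action"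

text \<open>
  \<open>dialogue \<Sigma> D L \<Lambda> h\<close>: the list \<open>h\<close> of answers can arise, in this order, in an interaction of the
  learner \<open>\<Lambda>\<close> with some teacher for \<open>L\<close>. The choice of counterexamples is unrestricted and may depend
  on the whole interaction.
\<close>

inductive dialogue ::
  "'a set \<Rightarrow> 'd set \<Rightarrow> ('a \<times> 'd) list set \<Rightarrow> ('a, 'd) learner \<Rightarrow> ('a, 'd) answer list \<Rightarrow> bool"
  for \<Sigma> D L \<Lambda> where
  start: "dialogue \<Sigma> D L \<Lambda> []"
| member: "dialogue \<Sigma> D L \<Lambda> h \<Longrightarrow> \<Lambda> h = Member w \<Longrightarrow>
     dialogue \<Sigma> D L \<Lambda> (h @ [Truth (w \<in> L)])"
| equiv_yes: "dialogue \<Sigma> D L \<Lambda> h \<Longrightarrow> \<Lambda> h = Equiv H \<Longrightarrow> data_lang \<Sigma> D H = L \<Longrightarrow>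
     dialogue \<Sigma> D L \<Lambda> (h @ [Yes])"
| equiv_no: "dialogue \<Sigma> D L \<Lambda> h \<Longrightarrow> \<Lambda> h = Equiv H \<Longrightarrow>
     w \<in> (data_lang \<Sigma> D H - L) \<union> (L - data_lang \<Sigma> D H) \<Longrightarrow>
     dialogue \<Sigma> D L \<Lambda> (h @ [Counterexample w])"

fun admissible :: "'a set \<Rightarrow> 'd set \<Rightarrow> ('a, 'd) action \<Rightarrow> bool" where
  "admissible \<Sigma> D (Member w) \<longleftrightarrow> w \<in> lists (\<Sigma> \<times> D)"
| "admissible \<Sigma> D (Equiv H) \<longleftrightarrow> session_automaton \<Sigma> H"
| "admissible \<Sigma> D (Output H) \<longleftrightarrow> session_automaton \<Sigma> H"

definition member_queries :: "('a, 'd) answer list \<Rightarrow> nat" where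
  "member_queries h = length (filter (\<lambda>x. \<exists>b. x = Truth b) h)"

definition equiv_queries :: "('a, 'd) answer list \<Rightarrow> nat" where
  "equiv_queries h = length (filter (\<lambda>x. x = Yes \<or> (\<exists>w. x = Counterexample w)) h)"

text \<open>The length of the longest counterexample in \<open>h\<close>, or 0 if there is none.\<close>

definition max_counterexample :: "('a, 'd) answer list \<Rightarrow> nat" where
  "max_counterexample h = Max (insert 0 {length w | w. Counterexample w \<in> set h})"


section \<open>Effective learners\<close>

text \<open>
  The total computable functions on binary trees, in the style of the WHILE language: tests for
  equality, and loops that are required to terminate on every input.
\<close>

datatype sexp = Atom | Cell sexp sexp

fun car :: "sexp \<Rightarrow> sexp" where
  "car Atom = Atom"
| "car (Cell x y) = x"

fun cdr :: "sexp \<Rightarrow> sexp" where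
  "cdr Atom = Atom"
| "cdr (Cell x y) = y"

inductive computable :: "(sexp \<Rightarrow> sexp) \<Rightarrow> bool" where
  "computable (\<lambda>x. x)"
| "computable (\<lambda>x. Atom)"
| "computable car"
| "computable cdr"
| "computable f \<Longrightarrow> computable g \<Longrightarrow> computable (\<lambda>x. Cell (f x) (g x))"
| "computable f \<Longrightarrow> computable g \<Longrightarrow> computable (\<lambda>x. g (f x))"
| "computable p \<Longrightarrow> computable q \<Longrightarrow> computable f \<Longrightarrow> computable g \<Longrightarrow>
     computable (\<lambda>x. if p x = q x then f x else g x)"
| "computable p \<Longrightarrow> computable f \<Longrightarrow> \<forall>x. \<exists>n. p ((f ^^ n) x) = Atom \<Longrightarrow>
     computable (\<lambda>x. (f ^^ (LEAST n. p ((f ^^ n) x) = Atom)) x)"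

fun enc_nat :: "nat \<Rightarrow> sexp" where
  "enc_nat 0 = Atom"
| "enc_nat (Suc n) = Cell Atom (enc_nat n)"

fun enc_list :: "('b \<Rightarrow> sexp) \<Rightarrow> 'b list \<Rightarrow> sexp" where
  "enc_list e [] = Atom"
| "enc_list e (x # xs) = Cell (e x) (enc_list e xs)"

text \<open>In what follows, \<open>\<alpha>\<close> numbers the letters of the alphabet.\<close>

definition enc_word :: "('a \<Rightarrow> nat) \<Rightarrow> ('a \<times> nat) list \<Rightarrow> sexp" where
  "enc_word \<alpha> = enc_list (\<lambda>(a, n). Cell (enc_nat (\<alpha> a)) (enc_nat n))"

fun enc_op :: "reg_op \<Rightarrow> sexp" where
  "enc_op (Fresh r) = Cell (enc_nat 0) (enc_nat r)"
| "enc_op (Reuse r) = Cell (enc_nat 1) (enc_nat r)"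

definition enc_transition :: "('a \<Rightarrow> nat) \<Rightarrow> nat \<times> ('a \<times> reg_op) \<times> nat \<Rightarrow> sexp" where
  "enc_transition \<alpha> =
     (\<lambda>(s, (a, \<pi>), t). enc_list id [enc_nat s, enc_nat (\<alpha> a), enc_op \<pi>, enc_nat t])"

text \<open>The finite sets of an automaton are coded as lists of their elements, in any order.\<close>

inductive codes_automaton :: "('a \<Rightarrow> nat) \<Rightarrow> sexp \<Rightarrow> (nat, 'a) session_automaton \<Rightarrow> bool"
  for \<alpha> where
  "set ss = states H \<Longrightarrow> set fs = finals H \<Longrightarrow> set ts = transitions H \<Longrightarrow>
   codes_automaton \<alpha>
     (enc_list id [enc_list enc_nat ss, enc_nat (registers H), enc_nat (initial H),
        enc_list enc_nat fs, enc_list (enc_transition \<alpha>) ts]) H"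

inductive codes_action :: "('a \<Rightarrow> nat) \<Rightarrow> sexp \<Rightarrow> ('a, nat) action \<Rightarrow> bool"
  for \<alpha> where
  "codes_action \<alpha> (Cell (enc_nat 0) (enc_word \<alpha> w)) (Member w)"
| "codes_automaton \<alpha> c H \<Longrightarrow> codes_action \<alpha> (Cell (enc_nat 1) c) (Equiv H)"
| "codes_automaton \<alpha> c H \<Longrightarrow> codes_action \<alpha> (Cell (enc_nat 2) c) (Output H)"

text \<open>
  Data values carry no structure but equality. Those of a counterexample are therefore presented to
  a program by the position of their first occurrence.
\<close>

definition pattern :: "('a \<times> 'd) list \<Rightarrow> ('a \<times> nat) list" where
  "pattern w = map (\<lambda>(a, d). (a, first_pos w d)) w"

fun enc_answer :: "('a \<Rightarrow> nat) \<Rightarrow> ('a, 'd) answer \<Rightarrow> sexp" where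
  "enc_answer \<alpha> (Truth b) = Cell (enc_nat 0) (enc_nat (of_bool b))"
| "enc_answer \<alpha> Yes = Cell (enc_nat 1) Atom"
| "enc_answer \<alpha> (Counterexample w) = Cell (enc_nat 2) (enc_word \<alpha> (pattern w))"

text \<open>
  A learner is an algorithm if its actions are computed by a single computable function \<open>F\<close> from the
  answers received. In the data words that \<open>F\<close> asks for, the natural number \<open>n\<close> stands for the data
  value \<open>\<nu> n\<close>, where \<open>\<nu>\<close> is a fixed supply of distinct data values.
\<close>

definition algorithm :: "'a set \<Rightarrow> 'd set \<Rightarrow> ('a, 'd) learner \<Rightarrow> bool" where
  "algorithm \<Sigma> D \<Lambda> \<longleftrightarrow>
     (\<exists>(\<alpha> :: 'a \<Rightarrow> nat) (\<nu> :: nat \<Rightarrow> 'd) F.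
        inj_on \<alpha> \<Sigma> \<and> inj \<nu> \<and> range \<nu> \<subseteq> D \<and> computable F \<and>
        (\<forall>h. (\<forall>w. Counterexample w \<in> set h \<longrightarrow> w \<in> lists (\<Sigma> \<times> D)) \<longrightarrow>
           (\<exists>act. codes_action \<alpha> (F (enc_list (enc_answer \<alpha>) h)) act \<and>
                  \<Lambda> h = map_action \<nu> act)))"

end

theory Submission
  imports Defs "HOL-Library.More_List"
begin

text \<open>
  The language to be learned is \<open>K = snf ` L\<close>, which is regular: an automaton reading a normal form
  can follow all runs of the session automaton on the data word, remembering which registers hold
  equal values. A membership query for a symbolic word \<open>u\<close> is a membership query for the data word
  that \<open>u\<close> denotes, and \<open>u \<notin> K\<close> unless \<open>u\<close> is in normal form.

  The learner is the algorithm of Angluin in the version of Rivest and Schapire. It keeps access words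
  that are pairwise inequivalent for \<open>K\<close>, hence at most \<open>N\<close> of them, together with distinguishing
  suffixes. A counterexample is processed by binary search, which yields a new access word and a new
  suffix. The number of registers starts from 0 and is only increased when a counterexample demands
  it. Before asking an equivalence query, the learner makes sure that its hypothesis accepts normal
  forms only; then \<open>snf w\<close> is a counterexample for \<open>K\<close> whenever \<open>w\<close> is one for \<open>L\<close>, and a confirmed
  hypothesis recognizes \<open>K\<close> itself. Words not in normal form are excluded by a search of bounded
  length, and treated as further counterexamples; the logarithm of the bound is only linear in \<open>N\<close>
  and \<open>k\<close>. Finally \<open>k \<le> N\<close>, because after register \<open>k\<close> has been filled, every shortest completion in \<open>K\<close>
  has to reuse the \<open>k - 1\<close> smaller registers, and passes through pairwise inequivalent words.

  Since only queries are counted, all searches of the learner may be exhaustive. Its computability then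
  reduces to that of folding over lists, which is a single loop.
\<close>

section \<open>Effective functions\<close>

class encodable =
  fixes sexp_of :: "'a \<Rightarrow> sexp"
  assumes sexp_of_inject: "sexp_of x = sexp_of y \<longleftrightarrow> x = y"

instantiation sexp :: encodable
begin
definition "sexp_of (x :: sexp) = x"
instance by standard (simp add: sexp_of_sexp_def)
end

instantiation unit :: encodable
begin
definition "sexp_of (x :: unit) = Atom"
instance by standard simp
end

lemma enc_nat_inject: "enc_nat m = enc_nat n \<longleftrightarrow> m = n"
proof (induction m arbitrary: n)
  case 0 show ?case by (cases n) auto
next
  case (Suc m) show ?case by (cases n) (auto simp: Suc.IH)
qed

instantiation nat :: encodable
begin
definition "sexp_of (n :: nat) = enc_nat n"
instance by standard (simp add: sexp_of_nat_def enc_nat_inject)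
end

instantiation bool :: encodable
begin
definition "sexp_of (b :: bool) = enc_nat (of_bool b)"
instance by standard (simp add: sexp_of_bool_def enc_nat_inject)
end

instantiation prod :: (encodable, encodable) encodable
begin
definition "sexp_of (p :: 'a \<times> 'b) = Cell (sexp_of (fst p)) (sexp_of (snd p))"
instance by standard (auto simp: sexp_of_prod_def sexp_of_inject prod_eq_iff)
end

lemma enc_list_inject:
  assumes "\<And>x y. e x = e y \<longleftrightarrow> x = y"
  shows "enc_list e xs = enc_list e ys \<longleftrightarrow> xs = ys"
proof (induction xs arbitrary: ys)
  case Nil show ?case by (cases ys) auto
next
  case (Cons x xs) show ?case by (cases ys) (auto simp: Cons.IH assms)
qed

lemma enc_list_map: "enc_list e (map f xs) = enc_list (\<lambda>x. e (f x)) xs"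
  by (induction xs) simp_all

lemma enc_list_cong: "(\<And>x. x \<in> set xs \<Longrightarrow> e x = e' x) \<Longrightarrow> enc_list e xs = enc_list e' xs"
  by (induction xs) simp_all

instantiation list :: (encodable) encodable
begin
definition "sexp_of (xs :: 'a list) = enc_list sexp_of xs"
instance by standard (simp add: sexp_of_list_def enc_list_inject sexp_of_inject)
end

instantiation option :: (encodable) encodable
begin
fun sexp_of_option :: "'a option \<Rightarrow> sexp" where
  "sexp_of_option None = Atom"
| "sexp_of_option (Some x) = Cell (sexp_of x) Atom"
instance
proof
  fix x y :: "'a option"
  show "sexp_of x = sexp_of y \<longleftrightarrow> x = y"
    by (cases x; cases y) (auto simp: sexp_of_inject)
qed
end

instantiation reg_op :: encodable
begin
definition "sexp_of \<pi> = enc_op \<pi>"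
instance
proof
  fix x y :: reg_op
  show "sexp_of x = sexp_of y \<longleftrightarrow> x = y"
    by (cases x; cases y) (auto simp: sexp_of_reg_op_def enc_nat_inject)
qed
end

instantiation answer :: (encodable, encodable) encodable
begin
fun sexp_of_answer :: "('a, 'b) answer \<Rightarrow> sexp" where
  "sexp_of_answer (Truth b) = Cell (enc_nat 0) (sexp_of b)"
| "sexp_of_answer Yes = Cell (enc_nat 1) Atom"
| "sexp_of_answer (Counterexample w) = Cell (enc_nat 2) (sexp_of w)"
instance
proof
  fix x y :: "('a, 'b) answer"
  show "sexp_of x = sexp_of y \<longleftrightarrow> x = y"
    by (cases x; cases y) (auto simp: enc_nat_inject sexp_of_inject numeral_2_eq_2)
qed
end

lemma sexp_of_simps [simp]:
  "sexp_of (x, y) = Cell (sexp_of x) (sexp_of y)"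
  "sexp_of ([] :: 'b list) = Atom"
  "sexp_of (z # zs) = Cell (sexp_of z) (sexp_of (zs :: 'b :: encodable list))"
  "sexp_of (0 :: nat) = Atom"
  "sexp_of (Suc n) = Cell Atom (sexp_of n)"
  "sexp_of False = Atom"
  "sexp_of True = Cell Atom Atom"
  "sexp_of () = Atom"
  "sexp_of (t :: sexp) = t"
  by (simp_all add: sexp_of_prod_def sexp_of_list_def sexp_of_nat_def sexp_of_bool_def
      sexp_of_unit_def sexp_of_sexp_def)

definition effective :: "('a :: encodable \<Rightarrow> 'b :: encodable) \<Rightarrow> bool" where
  "effective f \<longleftrightarrow> (\<exists>F. computable F \<and> (\<forall>x. F (sexp_of x) = sexp_of (f x)))"

lemma effectiveI: "computable F \<Longrightarrow> (\<And>x. F (sexp_of x) = sexp_of (f x)) \<Longrightarrow> effective f"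
  unfolding effective_def by blast

named_theorems effective_intros

lemma computable_comp: "computable g \<Longrightarrow> computable f \<Longrightarrow> computable (\<lambda>x. g (f x))"
  by (rule computable.intros(6))

lemma computable_const: "computable (\<lambda>x. c)"
  by (induction c) (auto intro: computable.intros)

lemma computable_car: "computable f \<Longrightarrow> computable (\<lambda>x. car (f x))"
  and computable_cdr: "computable f \<Longrightarrow> computable (\<lambda>x. cdr (f x))"
  by (rule computable_comp, rule computable.intros, assumption)+

lemmas computable_intros = computable.intros(1,5,7) computable_const computable_car computable_cdr

lemma effective_id [effective_intros]: "effective (\<lambda>x. x)"
  by (rule effectiveI[of "\<lambda>x. x"]) (intro computable_intros, simp)

lemma effective_const [effective_intros]: "effective (\<lambda>x. c)"
  by (rule effectiveI[OF computable_const]) simp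

lemma effective_comp:
  assumes "effective g" "effective f"
  shows "effective (\<lambda>x. g (f x))"
proof -
  obtain F G where "computable F" "\<And>x. F (sexp_of x) = sexp_of (f x)"
    "computable G" "\<And>x. G (sexp_of x) = sexp_of (g x)"
    using assms unfolding effective_def by metis
  then show ?thesis
    by (intro effectiveI[of "\<lambda>x. G (F x)"]) (simp_all add: computable_comp)
qed

lemma effective_Pair [effective_intros]:
  assumes "effective f" "effective g"
  shows "effective (\<lambda>x. (f x, g x))"
proof -
  obtain F G where "computable F" "\<And>x. F (sexp_of x) = sexp_of (f x)"
    "computable G" "\<And>x. G (sexp_of x) = sexp_of (g x)"
    using assms unfolding effective_def by metis
  then show ?thesis
    by (intro effectiveI[of "\<lambda>x. Cell (F x) (G x)"] computable_intros) simp_all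
qed

lemma effective_comp2:
  assumes "effective (\<lambda>(y, z). g y z)" "effective f" "effective f'"
  shows "effective (\<lambda>x. g (f x) (f' x))"
  using effective_comp[OF assms(1) effective_Pair[OF assms(2,3)]] by simp

lemma effective_comp3:
  assumes "effective (\<lambda>(y, z, z'). g y z z')" "effective f" "effective f'" "effective f''"
  shows "effective (\<lambda>x. g (f x) (f' x) (f'' x))"
  using effective_comp[OF assms(1) effective_Pair[OF assms(2) effective_Pair[OF assms(3,4)]]]
  by simp

lemma effective_fst [THEN effective_comp, effective_intros]: "effective fst"
  by (rule effectiveI[of car]) (intro computable.intros, simp add: sexp_of_prod_def)

lemma effective_snd [THEN effective_comp, effective_intros]: "effective snd"
  by (rule effectiveI[of cdr]) (intro computable.intros, simp add: sexp_of_prod_def)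

lemma effective_case_prod [effective_intros]:
  "effective (\<lambda>x. g x (fst (f x)) (snd (f x))) \<Longrightarrow> effective (\<lambda>x. case f x of (y, z) \<Rightarrow> g x y z)"
  by (simp add: case_prod_beta)

lemma effective_sexp_of [THEN effective_comp, effective_intros]: "effective sexp_of"
  by (rule effectiveI[of "\<lambda>x. x"]) (intro computable_intros, simp)

lemma effective_Cell [THEN effective_comp2, effective_intros]: "effective (\<lambda>(x, y). Cell x y)"
  by (rule effectiveI[of "\<lambda>x. x"]) (intro computable_intros, auto)

lemma effective_Cons [THEN effective_comp2, effective_intros]: "effective (\<lambda>(x, xs). x # xs)"
  by (rule effectiveI[of "\<lambda>x. x"]) (intro computable_intros, auto)

lemma effective_tl [THEN effective_comp, effective_intros]: "effective tl"
proof (rule effectiveI[of cdr])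
  show "cdr (sexp_of xs) = sexp_of (tl xs)" for xs :: "'b :: encodable list" by (cases xs) auto
qed (rule computable.intros)

lemma effective_Suc [THEN effective_comp, effective_intros]: "effective Suc"
  by (rule effectiveI[of "\<lambda>x. Cell Atom x"]) (intro computable_intros, simp)

lemma effective_pred [THEN effective_comp]: "effective (\<lambda>n. n - Suc 0)"
proof (rule effectiveI[of cdr])
  show "cdr (sexp_of n) = sexp_of (n - Suc 0)" for n :: nat by (cases n) auto
qed (rule computable.intros)

lemma effective_if [THEN effective_comp3, effective_intros]:
  "effective (\<lambda>(b, x, y). if b then x else y)"
  by (rule effectiveI[of "\<lambda>x. if car x = Atom then cdr (cdr x) else car (cdr x)"])
    (intro computable_intros, auto)

lemma effective_eq [THEN effective_comp2, effective_intros]: "effective (\<lambda>(x, y). x = y)"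
  by (rule effectiveI[of "\<lambda>x. if car x = cdr x then Cell Atom Atom else Atom"])
    (intro computable_intros, auto simp: sexp_of_inject)

lemma effective_Not [THEN effective_comp, effective_intros]: "effective (\<lambda>b. \<not> b)"
proof -
  have "effective (\<lambda>b. if b then False else True)" by (intro effective_intros)
  moreover have "(if b then False else True) \<longleftrightarrow> \<not> b" for b by simp
  ultimately show ?thesis by (simp only:)
qed

lemma effective_conj [THEN effective_comp2, effective_intros]: "effective (\<lambda>(b, c). b \<and> c)"
proof -
  have "(\<lambda>(b, c). b \<and> c) = (\<lambda>(b, c). if b then c else False)" by auto
  then show ?thesis by (simp only:) (intro effective_intros)
qed

lemma effective_Some [THEN effective_comp, effective_intros]: "effective Some"
  by (rule effectiveI[of "\<lambda>x. Cell x Atom"]) (intro computable_intros, simp)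

lemma effective_the [THEN effective_comp, effective_intros]:
  "effective (the :: 'a :: encodable option \<Rightarrow> 'a)"
proof (rule effectiveI[of "\<lambda>x. if x = Atom then sexp_of (the None :: 'a) else car x"])
  show "(if sexp_of p = Atom then sexp_of (the None :: 'a) else car (sexp_of p)) = sexp_of (the p)"
    for p :: "'a option"
    by (cases p) auto
qed (intro computable_intros)

lemma effective_case_option [effective_intros]:
  assumes "effective p" "effective f" "effective (\<lambda>(x, y). g x y)"
  shows "effective (\<lambda>x. case p x of None \<Rightarrow> f x | Some y \<Rightarrow> g x y)"
proof -
  have "effective (\<lambda>x. if p x = None then f x else g x (the (p x)))"
    by (intro effective_intros assms effective_comp2[OF assms(3)])
  moreover have "(if p x = None then f x else g x (the (p x))) =
      (case p x of None \<Rightarrow> f x | Some y \<Rightarrow> g x y)" for x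
    by (simp split: option.split)
  ultimately show ?thesis by simp
qed

lemma effective_case_answer [effective_intros]:
  assumes "effective r" "effective (\<lambda>(x, b). f x b)" "effective g" "effective (\<lambda>(x, w). h x w)"
  shows "effective (\<lambda>x. case r x of Truth b \<Rightarrow> f x b | Yes \<Rightarrow> g x | Counterexample w \<Rightarrow> h x w)"
proof -
  obtain R where R: "computable R" "\<And>x. R (sexp_of x) = sexp_of (r x)"
    using assms(1) unfolding effective_def by blast
  obtain F where F: "computable F" "\<And>p. F (sexp_of p) = sexp_of (case_prod f p)"
    using assms(2) unfolding effective_def by blast
  obtain G where G: "computable G" "\<And>x. G (sexp_of x) = sexp_of (g x)"
    using assms(3) unfolding effective_def by blast
  obtain H where H: "computable H" "\<And>p. H (sexp_of p) = sexp_of (case_prod h p)"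
    using assms(4) unfolding effective_def by blast
  have payload: "F (Cell (sexp_of x) (sexp_of b)) = sexp_of (f x b)"
    "H (Cell (sexp_of x) (sexp_of w)) = sexp_of (h x w)" for x b w
    using F(2)[of "(x, b)"] H(2)[of "(x, w)"] by simp_all
  show ?thesis
  proof (rule effectiveI[of "\<lambda>x. if car (R x) = Atom then F (Cell x (cdr (R x)))
      else if car (R x) = Cell Atom Atom then G x else H (Cell x (cdr (R x)))"])
    show "computable (\<lambda>x. if car (R x) = Atom then F (Cell x (cdr (R x)))
        else if car (R x) = Cell Atom Atom then G x else H (Cell x (cdr (R x))))"
      by (intro computable_intros R(1) G(1) computable_comp[OF F(1)] computable_comp[OF H(1)])
  qed (simp add: R(2) G(2) payload numeral_2_eq_2 split: answer.split)
qed

subsection \<open>Loops\<close>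

lemma while_unfold:
  assumes "\<exists>n. p ((f ^^ n) x) = Atom"
  shows "(f ^^ (LEAST n. p ((f ^^ n) x) = Atom)) x =
    (if p x = Atom then x else (f ^^ (LEAST n. p ((f ^^ n) (f x)) = Atom)) (f x))"
proof (cases "p x = Atom")
  case True
  then have "(LEAST n. p ((f ^^ n) x) = Atom) = 0" by (intro Least_eq_0) simp
  with True show ?thesis by simp
next
  case False
  obtain n where "p ((f ^^ n) x) = Atom" using assms by blast
  then have "(LEAST n. p ((f ^^ n) x) = Atom) = Suc (LEAST n. p ((f ^^ Suc n) x) = Atom)"
    using False by (intro Least_Suc) auto
  with False show ?thesis by (simp add: funpow_swap1)
qed

lemma cdr_iterates_to_Atom: "\<exists>n. (cdr ^^ n) x = Atom"
proof (induction x)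
  case Atom show ?case by (rule exI[of _ 0]) simp
next
  case (Cell x y)
  then obtain n where "(cdr ^^ n) y = Atom" by blast
  then show ?case by (intro exI[of _ "Suc n"]) (simp add: funpow_swap1)
qed

lemma computable_fold:
  assumes "computable F"
  obtains G where "computable G"
    "\<And>c l a. G (Cell c (Cell (enc_list e l) a)) =
       fold (\<lambda>x acc. F (Cell c (Cell (e x) acc))) l a"
proof -
  define f where "f = (\<lambda>s. Cell (car s) (Cell (cdr (car (cdr s)))
      (F (Cell (car s) (Cell (car (car (cdr s))) (cdr (cdr s)))))))"
  define p where "p = (\<lambda>s. car (cdr s))"
  have f: "computable f" unfolding f_def by (intro computable_intros computable_comp[OF assms])
  have p: "computable p" unfolding p_def by (intro computable_intros)
  have "p ((f ^^ n) s) = (cdr ^^ n) (p s)" for n s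
    by (induction n) (simp_all add: p_def f_def)
  then have halts: "\<exists>n. p ((f ^^ n) s) = Atom" for s
    using cdr_iterates_to_Atom by metis
  define W where "W = (\<lambda>s. (f ^^ (LEAST n. p ((f ^^ n) s) = Atom)) s)"
  have W: "computable W" unfolding W_def using p f halts by (intro computable.intros(8)) auto
  have unfold: "W s = (if p s = Atom then s else W (f s))" for s
    unfolding W_def by (rule while_unfold[OF halts])
  have "cdr (cdr (W (Cell c (Cell (enc_list e l) a)))) =
      fold (\<lambda>x acc. F (Cell c (Cell (e x) acc))) l a" for c l a
  proof (induction l arbitrary: a)
    case Nil show ?case by (subst unfold) (simp add: p_def)
  next
    case (Cons x l)
    show ?case by (subst unfold) (simp add: p_def f_def Cons.IH)
  qed
  moreover have "computable (\<lambda>s. cdr (cdr (W s)))" by (intro computable_intros W)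
  ultimately show thesis using that by blast
qed

lemma effective_fold [effective_intros]:
  fixes l :: "'a :: encodable \<Rightarrow> 'b :: encodable list"
  assumes "effective (\<lambda>(x, y, z). f x y z)" "effective l" "effective i"
  shows "effective (\<lambda>x. fold (f x) (l x) (i x))"
proof -
  obtain F L I where computable: "computable F" "computable L" "computable I"
    and F: "\<And>p. F (sexp_of p) = sexp_of (case p of (x, y, z) \<Rightarrow> f x y z)"
    and LI: "\<And>x. L (sexp_of x) = sexp_of (l x)" "\<And>x. I (sexp_of x) = sexp_of (i x)"
    using assms unfolding effective_def by metis
  obtain G where G: "computable G"
    "\<And>c l a. G (Cell c (Cell (enc_list sexp_of l) a)) =
       fold (\<lambda>x acc. F (Cell c (Cell (sexp_of (x :: 'b)) acc))) l a"
    using computable_fold[OF computable(1)] by blast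
  have "F (Cell (sexp_of x) (Cell (sexp_of y) (sexp_of z))) = sexp_of (f x y z)" for x y z
    using F[of "(x, y, z)"] by simp
  then have "fold (\<lambda>y acc. F (Cell (sexp_of x) (Cell (sexp_of y) acc))) ys (sexp_of z) =
      sexp_of (fold (f x) ys z)" for x z and ys :: "'b list"
    by (induction ys arbitrary: z) simp_all
  then show ?thesis
    by (intro effectiveI[of "\<lambda>x. G (Cell x (Cell (L x) (I x)))"])
      (auto intro!: computable_intros computable computable_comp[OF G(1)]
        simp: G(2) LI sexp_of_list_def)
qed

lemma effective_replicate_unit: "effective (\<lambda>n. replicate n ())"
proof (rule effectiveI[of "\<lambda>x. x"])
  show "sexp_of n = sexp_of (replicate n ())" for n by (induction n) simp_all
qed (intro computable_intros)

lemma effective_funpow [effective_intros]: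
  fixes f :: "'a :: encodable \<Rightarrow> 'b :: encodable \<Rightarrow> 'b"
  assumes "effective (\<lambda>(x, y). f x y)" "effective n" "effective i"
  shows "effective (\<lambda>x. (f x ^^ n x) (i x))"
proof -
  have "effective (\<lambda>x. fold (\<lambda>_. f x) (replicate (n x) ()) (i x))"
    by (intro effective_intros assms(3) effective_comp[OF effective_replicate_unit assms(2)]
        effective_comp2[OF assms(1)])
  then show ?thesis by (simp add: fold_replicate)
qed

subsection \<open>Lists and numbers\<close>

lemma effective_rev [THEN effective_comp, effective_intros]: "effective rev"
  unfolding rev_conv_fold by (intro effective_intros)

lemma effective_append [THEN effective_comp2, effective_intros]: "effective (\<lambda>(xs, ys). xs @ ys)"
proof -
  have "xs @ ys = fold Cons (rev xs) ys" for xs ys :: "'a list"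
    by (induction xs) simp_all
  then show ?thesis by (simp only:) (intro effective_intros)
qed

lemma effective_map [effective_intros]:
  assumes "effective (\<lambda>(x, y). f x y)" "effective l"
  shows "effective (\<lambda>x. map (f x) (l x))"
proof -
  have "fold (\<lambda>y acc. acc @ [f x y]) ys zs = zs @ map (f x) ys" for x ys zs
    by (induction ys arbitrary: zs) simp_all
  moreover have "effective (\<lambda>x. fold (\<lambda>y acc. acc @ [f x y]) (l x) [])"
    by (intro effective_intros assms(2) effective_comp2[OF assms(1)])
  ultimately show ?thesis by simp
qed

lemma effective_filter [effective_intros]:
  assumes "effective (\<lambda>(x, y). P x y)" "effective l"
  shows "effective (\<lambda>x. filter (P x) (l x))"
proof -
  have "fold (\<lambda>y acc. if P x y then acc @ [y] else acc) ys zs = zs @ filter (P x) ys" for x ys zs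
    by (induction ys arbitrary: zs) simp_all
  moreover have "effective (\<lambda>x. fold (\<lambda>y acc. if P x y then acc @ [y] else acc) (l x) [])"
    by (intro effective_intros assms(2) effective_comp2[OF assms(1)])
  ultimately show ?thesis by simp
qed

lemma effective_concat [THEN effective_comp, effective_intros]: "effective concat"
proof -
  have "fold (\<lambda>ys acc. acc @ ys) xss zs = zs @ concat xss" for xss and zs :: "'a list"
    by (induction xss arbitrary: zs) simp_all
  moreover have "effective (\<lambda>xss. fold (\<lambda>ys acc. acc @ ys) xss ([] :: 'a :: encodable list))"
    by (intro effective_intros)
  ultimately show ?thesis by simp
qed

lemma effective_Ball_set [effective_intros]:
  assumes "effective (\<lambda>(x, y). P x y)" "effective l"
  shows "effective (\<lambda>x. \<forall>y\<in>set (l x). P x y)"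
proof -
  have "effective (\<lambda>x. filter (\<lambda>y. \<not> P x y) (l x) = [])"
    by (intro effective_intros assms(2) effective_comp2[OF assms(1)])
  then show ?thesis by (simp add: filter_empty_conv)
qed

lemma effective_in_set [THEN effective_comp2, effective_intros]: "effective (\<lambda>(x, xs). x \<in> set xs)"
proof -
  have "x \<in> set xs \<longleftrightarrow> \<not> (\<forall>y\<in>set xs. y \<noteq> x)" for x and xs :: "'a list" by blast
  then show ?thesis by (simp only:) (intro effective_intros)
qed

lemma effective_length [THEN effective_comp, effective_intros]: "effective length"
proof -
  have "fold (\<lambda>_. Suc) xs n = n + length xs" for xs :: "'a list" and n
    by (induction xs arbitrary: n) simp_all
  moreover have "effective (\<lambda>xs :: 'a :: encodable list. fold (\<lambda>_. Suc) xs 0)"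
    by (intro effective_intros)
  ultimately show ?thesis by simp
qed

lemma effective_drop [THEN effective_comp2, effective_intros]: "effective (\<lambda>(n, xs). drop n xs)"
proof -
  have "drop n xs = (tl ^^ n) xs" for n and xs :: "'a list"
    by (induction n) (simp_all add: drop_Suc drop_tl)
  then show ?thesis by (simp only:) (intro effective_intros)
qed

lemma effective_minus [THEN effective_comp2, effective_intros]: "effective (\<lambda>(m, n). m - n :: nat)"
proof -
  have "((\<lambda>i. i - Suc 0) ^^ n) m = m - n" for m n :: nat
    by (induction n) simp_all
  moreover have "effective (\<lambda>(m, n). ((\<lambda>i. i - Suc 0) ^^ n) m)"
    by (intro effective_intros effective_pred)
  ultimately show ?thesis by simp
qed

lemma effective_take [THEN effective_comp2, effective_intros]: "effective (\<lambda>(n, xs). take n xs)"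
proof -
  have "take n xs = rev (drop (length xs - n) (rev xs))" for n and xs :: "'a list"
    by (cases "n \<le> length xs") (simp_all add: rev_drop)
  then show ?thesis by (simp only:) (intro effective_intros)
qed

lemma effective_plus [THEN effective_comp2, effective_intros]: "effective (\<lambda>(m, n). m + n :: nat)"
proof -
  have "m + n = (Suc ^^ n) m" for m n :: nat
    by (induction n) simp_all
  then show ?thesis by (simp only:) (intro effective_intros)
qed

lemma effective_times [THEN effective_comp2, effective_intros]: "effective (\<lambda>(m, n). m * n :: nat)"
proof -
  have "m * n = ((\<lambda>i. m + i) ^^ n) 0" for m n :: nat
    by (induction n) simp_all
  then show ?thesis by (simp only:) (intro effective_intros)
qed

lemma effective_power [THEN effective_comp2, effective_intros]: "effective (\<lambda>(m, n). m ^ n :: nat)"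
proof -
  have "m ^ n = ((\<lambda>i. m * i) ^^ n) 1" for m n :: nat
    by (induction n) simp_all
  then show ?thesis by (simp only:) (intro effective_intros)
qed

lemma effective_le [THEN effective_comp2, effective_intros]: "effective (\<lambda>(m, n). (m :: nat) \<le> n)"
  unfolding diff_is_0_eq[symmetric] by (intro effective_intros)

lemma effective_less [THEN effective_comp2, effective_intros]: "effective (\<lambda>(m, n). (m :: nat) < n)"
  unfolding less_eq_Suc_le by (intro effective_intros)

lemma effective_upt [THEN effective_comp2, effective_intros]: "effective (\<lambda>(m, n). [m..<n])"
proof -
  have "((\<lambda>l. l @ [m + length l]) ^^ j) [] = [m..<m + j]" for m j
    by (induction j) simp_all
  then have "((\<lambda>l. l @ [m + length l]) ^^ (n - m)) [] = [m..<n]" for m n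
    by (cases "m \<le> n") simp_all
  moreover have "effective (\<lambda>(m, n). ((\<lambda>l. l @ [m + length l]) ^^ (n - m)) [])"
    by (intro effective_intros)
  ultimately show ?thesis by simp
qed

lemma effective_half [THEN effective_comp, effective_intros]: "effective (\<lambda>n :: nat. n div 2)"
proof -
  have "{i. 2 * Suc i \<le> n} \<inter> set [0..<n] = {..<n div 2}" for n :: nat by auto
  then have "n div 2 = length (filter (\<lambda>i. 2 * Suc i \<le> n) [0..<n])" for n :: nat
    by (simp only: distinct_length_filter[OF distinct_upt] card_lessThan)
  then show ?thesis by (simp only:) (intro effective_intros)
qed

lemma effective_nth_default [THEN effective_comp3, effective_intros]:
  "effective (\<lambda>(d, xs, i). nth_default d xs i)"
proof -
  let ?head = "\<lambda>p. if cdr p = Atom then car p else car (cdr p)"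
  have head: "effective (\<lambda>(d, xs). nth_default d xs 0 :: 'a :: encodable)"
  proof (rule effectiveI[of ?head])
    show "?head (sexp_of p) = sexp_of (case p of (d, xs) \<Rightarrow> nth_default d xs 0)"
      for p :: "'a \<times> 'a list"
      by (cases p; cases "snd p") auto
  qed (intro computable_intros)
  have "effective (\<lambda>(d, xs, i). nth_default d (drop i xs) 0 :: 'a)"
    by (intro effective_intros effective_comp2[OF head])
  moreover have "nth_default d (drop i xs) 0 = nth_default d xs i" for d :: 'a and xs i
    by (simp add: nth_default_def)
  ultimately show ?thesis by simp
qed

lemma effective_find [effective_intros]:
  assumes "effective (\<lambda>(x, y). P x y)" "effective l"
  shows "effective (\<lambda>x. List.find (P x) (l x))"
proof -
  have "List.find Q ys = nth_default None (map Some (filter Q ys)) 0" for Q and ys :: "'b list"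
    by (induction ys) auto
  then show ?thesis
    by (simp only:) (intro effective_intros assms(2) effective_comp2[OF assms(1)])
qed

lemma effective_Fresh [THEN effective_comp, effective_intros]: "effective Fresh"
  by (rule effectiveI[of "\<lambda>x. Cell Atom x"])
    (intro computable_intros, simp add: sexp_of_reg_op_def sexp_of_nat_def)

lemma effective_Reuse [THEN effective_comp, effective_intros]: "effective Reuse"
  by (rule effectiveI[of "\<lambda>x. Cell (Cell Atom Atom) x"])
    (intro computable_intros, simp add: sexp_of_reg_op_def sexp_of_nat_def)

lemma effective_reg [THEN effective_comp, effective_intros]: "effective reg"
proof (rule effectiveI[of cdr])
  show "cdr (sexp_of \<pi>) = sexp_of (reg \<pi>)" for \<pi>
    by (cases \<pi>) (auto simp: sexp_of_reg_op_def sexp_of_nat_def)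
qed (rule computable.intros)

lemma effective_is_Fresh [THEN effective_comp, effective_intros]: "effective (\<lambda>\<pi>. is_Fresh \<pi>)"
proof -
  have "effective (\<lambda>\<pi>. \<pi> = Fresh (reg \<pi>))" by (intro effective_intros)
  moreover have "\<pi> = Fresh (reg \<pi>) \<longleftrightarrow> is_Fresh \<pi>" for \<pi> by (cases \<pi>) auto
  ultimately show ?thesis by simp
qed

section \<open>Symbolic words\<close>

definition binding :: "('a \<times> reg_op) list \<Rightarrow> nat \<Rightarrow> nat option" where
  "binding u r = List.find (\<lambda>j. snd (u ! j) = Fresh r) (rev [0..<length u])"

definition bound :: "('a \<times> reg_op) list \<Rightarrow> reg_op \<Rightarrow> bool" where
  "bound u \<pi> \<longleftrightarrow> is_Fresh \<pi> \<or> binding u (reg \<pi>) \<noteq> None"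

definition denoted_value :: "('a \<times> reg_op) list \<Rightarrow> reg_op \<Rightarrow> nat" where
  "denoted_value u \<pi> = (if is_Fresh \<pi> then length u else the (binding u (reg \<pi>)))"

text \<open>A data value is named by the position at which it was introduced, as in \<^const>\<open>pattern\<close>.\<close>

definition denotation :: "('a \<times> reg_op) list \<Rightarrow> ('a \<times> nat) list" where
  "denotation u = map (\<lambda>i. (fst (u ! i), denoted_value (take i u) (snd (u ! i)))) [0..<length u]"

definition stepwise :: "(('a \<times> reg_op) list \<Rightarrow> reg_op \<Rightarrow> bool) \<Rightarrow> ('a \<times> reg_op) list \<Rightarrow> bool" where
  "stepwise P u \<longleftrightarrow> (\<forall>i<length u. P (take i u) (snd (u ! i)))"

definition well_formed :: "('a \<times> reg_op) list \<Rightarrow> bool" where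
  "well_formed = stepwise bound"

text \<open>
  In a normal form, a fresh value is stored in register \<open>r\<close> only if the values in all smaller
  registers occur again. The obligations of a word are the registers that have to be reused before
  they are overwritten, because of an earlier fresh value in a greater register.
\<close>

definition obligations :: "('a \<times> reg_op) list \<Rightarrow> nat list" where
  "obligations u = fold (\<lambda>x rs. if is_Fresh (snd x) then [1..<reg (snd x)] @ rs
     else filter (\<lambda>r. r \<noteq> reg (snd x)) rs) u []"

definition normal_step :: "('a \<times> reg_op) list \<Rightarrow> reg_op \<Rightarrow> bool" where
  "normal_step u \<pi> \<longleftrightarrow> (if is_Fresh \<pi>
     then 1 \<le> reg \<pi> \<and> (\<forall>r\<in>set [1..<reg \<pi>]. binding u r \<noteq> None) \<and> reg \<pi> \<notin> set (obligations u)
     else binding u (reg \<pi>) \<noteq> None)"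

definition normal_prefix :: "('a \<times> reg_op) list \<Rightarrow> bool" where
  "normal_prefix = stepwise normal_step"

definition normal_form :: "('a \<times> reg_op) list \<Rightarrow> bool" where
  "normal_form u \<longleftrightarrow> normal_prefix u \<and> obligations u = []"

lemma binding_Nil [simp]: "binding [] r = None"
  by (simp add: binding_def)

lemma binding_snoc [simp]:
  "binding (u @ [x]) r = (if snd x = Fresh r then Some (length u) else binding u r)"
proof -
  have "List.find (\<lambda>j. snd ((u @ [x]) ! j) = Fresh r) (rev [0..<length u]) = binding u r"
    unfolding binding_def by (rule find_cong) (simp_all add: nth_append)
  then show ?thesis by (simp add: binding_def)
qed



lemma binding_SomeD:
  assumes "binding u r = Some p"
  shows "p < length u" "snd (u ! p) = Fresh r"
  using assms by (induction u rule: rev_induct) (auto simp: nth_append split: if_splits)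

lemma binding_inj: "binding u r = Some p \<Longrightarrow> binding u q = Some p \<Longrightarrow> r = q"
  using binding_SomeD(2) by (metis reg_op.inject(1))

lemma binding_append_not_Fresh:
  "\<forall>x\<in>set z. snd x \<noteq> Fresh r \<Longrightarrow> binding (v @ z) r = binding v r"
proof (induction z rule: rev_induct)
  case (snoc x z) then show ?case using binding_snoc[of "v @ z" x r] by simp
qed simp

lemma binding_take_earlier:
  assumes "binding (take j u) r = Some p" "p < m" "m \<le> j"
  shows "binding (take m u) r = Some p"
  using \<open>m \<le> j\<close>
proof (induction rule: inc_induct)
  case (step i)
  show ?case
  proof (cases "i < length u")
    case True
    with step show ?thesis
      using \<open>p < m\<close> by (auto simp: take_Suc_conv_app_nth split: if_splits)
  qed (use step in simp)
qed (rule assms(1))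

lemma stepwise_Nil [simp]: "stepwise P []"
  by (simp add: stepwise_def)

lemma stepwise_snoc [simp]: "stepwise P (u @ [x]) \<longleftrightarrow> stepwise P u \<and> P u (snd x)"
  by (auto simp: stepwise_def nth_append less_Suc_eq)



lemma bound_simps [simp]:
  "bound u (Fresh r)" "bound u (Reuse r) \<longleftrightarrow> binding u r \<noteq> None"
  by (simp_all add: bound_def)

lemma denoted_value_simps [simp]:
  "denoted_value u (Fresh r) = length u" "denoted_value u (Reuse r) = the (binding u r)"
  by (simp_all add: denoted_value_def)

lemma well_formed_Nil [simp]: "well_formed []"
  by (simp add: well_formed_def)

lemma well_formed_snoc [simp]: "well_formed (u @ [x]) \<longleftrightarrow> well_formed u \<and> bound u (snd x)"
  by (simp add: well_formed_def)

lemma normal_step_simps [simp]: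
  "normal_step u (Fresh r) \<longleftrightarrow>
    1 \<le> r \<and> (\<forall>q\<in>{1..<r}. binding u q \<noteq> None) \<and> r \<notin> set (obligations u)"
  "normal_step u (Reuse r) \<longleftrightarrow> binding u r \<noteq> None"
  by (simp_all add: normal_step_def)

lemma normal_step_imp_bound: "normal_step u \<pi> \<Longrightarrow> bound u \<pi>"
  by (cases \<pi>) simp_all

lemma well_formedD: "well_formed u \<Longrightarrow> i < length u \<Longrightarrow> bound (take i u) (snd (u ! i))"
  by (simp add: well_formed_def stepwise_def)

lemma normal_prefixD: "normal_prefix u \<Longrightarrow> i < length u \<Longrightarrow> normal_step (take i u) (snd (u ! i))"
  by (simp add: normal_prefix_def stepwise_def)

lemma normal_prefix_appendD: "normal_prefix (u @ v) \<Longrightarrow> normal_prefix u"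
proof (induction v rule: rev_induct)
  case (snoc x v) then show ?case by (metis append_assoc normal_prefix_def stepwise_snoc)
qed simp

lemma obligations_Nil [simp]: "obligations [] = []"
  by (simp add: obligations_def)

lemma obligations_snoc [simp]:
  "obligations (u @ [x]) = (if is_Fresh (snd x) then [1..<reg (snd x)] @ obligations u
     else filter (\<lambda>r. r \<noteq> reg (snd x)) (obligations u))"
  by (simp add: obligations_def)

lemma normal_prefix_Nil [simp]: "normal_prefix []"
  by (simp add: normal_prefix_def)

lemma normal_prefix_snoc [simp]:
  "normal_prefix (u @ [x]) \<longleftrightarrow> normal_prefix u \<and> normal_step u (snd x)"
  by (simp add: normal_prefix_def)

lemma normal_form_Nil [simp]: "normal_form []"
  by (simp add: normal_form_def)

lemma normal_formD: "normal_form u \<Longrightarrow> i < length u \<Longrightarrow> normal_step (take i u) (snd (u ! i))"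
  by (simp add: normal_form_def normal_prefixD)

lemma normal_form_imp_well_formed: "normal_form u \<Longrightarrow> well_formed u"
  unfolding well_formed_def stepwise_def by (blast intro: normal_step_imp_bound normal_formD)

lemma denotation_Nil [simp]: "denotation [] = []"
  by (simp add: denotation_def)

lemma denotation_snoc [simp]:
  "denotation (u @ [x]) = denotation u @ [(fst x, denoted_value u (snd x))]"
  by (simp add: denotation_def nth_append)

lemma length_denotation [simp]: "length (denotation u) = length u"
  by (simp add: denotation_def)

lemma denotation_eq_length: "denotation u = denotation v \<Longrightarrow> length u = length v"
  by (metis length_denotation)

lemma nth_denotation:
  "i < length u \<Longrightarrow> denotation u ! i = (fst (u ! i), denoted_value (take i u) (snd (u ! i)))"
  by (simp add: denotation_def)

lemma map_fst_denotation: "map fst (denotation u) = map fst u"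
  by (rule nth_equalityI) (simp_all add: nth_denotation)

lemma denotation_eq_map_fst: "denotation u = denotation v \<Longrightarrow> map fst u = map fst v"
  by (metis map_fst_denotation)

lemma denoted_value_le: "bound u \<pi> \<Longrightarrow> denoted_value u \<pi> \<le> length u"
  by (cases \<pi>) (auto dest: binding_SomeD(1)[THEN less_imp_le])

lemma denoted_value_eq_length_iff: "bound u \<pi> \<Longrightarrow> denoted_value u \<pi> = length u \<longleftrightarrow> is_Fresh \<pi>"
  by (cases \<pi>) (auto dest: binding_SomeD(1))

lemma denoted_value_less:
  assumes "bound u \<pi>" "denoted_value u \<pi> = p" "p < length u"
  obtains r where "\<pi> = Reuse r" "binding u r = Some p"
  using assms by (cases \<pi>) auto

lemma snd_denotation_binding:
  assumes "binding u r = Some p"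
  shows "snd (denotation u ! p) = p"
  using binding_SomeD[OF assms] by (simp add: nth_denotation)

section \<open>Patterns and runs\<close>

lemma first_pos_props:
  assumes "d \<in> snd ` set w"
  shows "first_pos w d < length w" "snd (w ! first_pos w d) = d"
proof -
  have "\<exists>i. i < length w \<and> snd (w ! i) = d" using assms by (metis image_iff in_set_conv_nth)
  from LeastI_ex[OF this] show "first_pos w d < length w" "snd (w ! first_pos w d) = d"
    by (auto simp: first_pos_def)
qed

lemma first_pos_le: "i < length w \<Longrightarrow> snd (w ! i) = d \<Longrightarrow> first_pos w d \<le> i"
  unfolding first_pos_def by (rule Least_le) simp

lemma last_pos_props:
  assumes "d \<in> snd ` set w"
  shows "last_pos w d < length w" "snd (w ! last_pos w d) = d"
proof -
  obtain i where "i < length w \<and> snd (w ! i) = d" using assms by (metis image_iff in_set_conv_nth)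
  then have "last_pos w d < length w \<and> snd (w ! last_pos w d) = d"
    unfolding last_pos_def by (rule GreatestI_nat[where b = "length w"]) auto
  then show "last_pos w d < length w" "snd (w ! last_pos w d) = d" by auto
qed

lemma last_pos_ge: "i < length w \<Longrightarrow> snd (w ! i) = d \<Longrightarrow> i \<le> last_pos w d"
  unfolding last_pos_def by (rule Greatest_le_nat[where b = "length w"]) auto

lemma first_pos_eqI:
  assumes "i < length w" "snd (w ! i) = d" "\<And>j. j < i \<Longrightarrow> snd (w ! j) \<noteq> d"
  shows "first_pos w d = i"
proof -
  have "first_pos w d \<le> i" using assms by (intro first_pos_le)
  moreover have "snd (w ! first_pos w d) = d"
    using assms by (intro first_pos_props) (auto intro!: image_eqI[of _ _ "w ! i"])
  ultimately show ?thesis using assms(3) by (meson le_neq_implies_less)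
qed

lemma first_pos_append:
  assumes "d \<in> snd ` set w"
  shows "first_pos (w @ w') d = first_pos w d"
proof (rule first_pos_eqI)
  fix j assume "j < first_pos w d"
  then show "snd ((w @ w') ! j) \<noteq> d"
    using first_pos_props(1)[OF assms] first_pos_le[of j w d] by (auto simp: nth_append)
qed (use first_pos_props[OF assms] in \<open>auto simp: nth_append\<close>)

lemma first_pos_snoc_new:
  assumes "d \<notin> snd ` set w"
  shows "first_pos (w @ [(a, d)]) d = length w"
proof (rule first_pos_eqI)
  fix j assume "j < length w"
  then show "snd ((w @ [(a, d)]) ! j) \<noteq> d"
    using assms by (auto simp: nth_append)
qed simp_all

definition value_index :: "('a \<times> 'd) list \<Rightarrow> 'd \<Rightarrow> nat" where
  "value_index w d = (if d \<in> snd ` set w then first_pos w d else length w)"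

lemma value_index_eq_length_iff: "value_index w d = length w \<longleftrightarrow> d \<notin> snd ` set w"
  using first_pos_props(1)[of d w] by (cases "d \<in> snd ` set w") (simp_all add: value_index_def)

lemma length_pattern [simp]: "length (pattern w) = length w"
  by (simp add: pattern_def)

lemma nth_pattern: "i < length w \<Longrightarrow> pattern w ! i = (fst (w ! i), first_pos w (snd (w ! i)))"
  by (simp add: pattern_def case_prod_beta)

lemma map_fst_pattern: "map fst (pattern w) = map fst w"
  by (simp add: pattern_def case_prod_beta)

lemma pattern_Nil [simp]: "pattern [] = []"
  by (simp add: pattern_def)

lemma pattern_snoc: "pattern (w @ [(a, d)]) = pattern w @ [(a, value_index w d)]"
proof -
  have "first_pos (w @ [(a, d)]) (snd x) = first_pos w (snd x)" if "x \<in> set w" for x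
    using that by (intro first_pos_append) simp
  moreover have "first_pos (w @ [(a, d)]) d = value_index w d"
    by (simp add: value_index_def first_pos_append first_pos_snoc_new)
  ultimately show ?thesis by (simp add: pattern_def case_prod_beta)
qed

lemma pattern_map_prod:
  assumes "inj \<nu>"
  shows "pattern (map (map_prod h \<nu>) w) = map (apfst h) (pattern w)"
proof -
  have "first_pos (map (map_prod h \<nu>) w) (\<nu> d) = first_pos w d" for d
    unfolding first_pos_def using injD[OF assms] by (intro arg_cong[where f = Least]) auto
  then show ?thesis by (simp add: pattern_def case_prod_beta)
qed

lemma pattern_denotation:
  assumes "well_formed u"
  shows "pattern (denotation u) = denotation u"
  using assms
proof (induction u rule: rev_induct)
  case (snoc x u)
  obtain a \<pi> where x: "x = (a, \<pi>)" by (cases x)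
  have le: "snd (denotation u ! j) \<le> j" if "j < length u" for j
    using that snoc.prems denoted_value_le[OF well_formedD[of u j]] by (simp add: nth_denotation)
  have "value_index (denotation u) (denoted_value u \<pi>) = denoted_value u \<pi>"
  proof (cases \<pi>)
    case (Fresh r)
    have "length u \<notin> snd ` set (denotation u)"
      using le by (fastforce simp: in_set_conv_nth)
    then show ?thesis by (simp add: Fresh value_index_def)
  next
    case (Reuse r)
    then obtain p where p: "binding u r = Some p" using snoc.prems x by auto
    have "p < length u" "snd (denotation u ! p) = p"
      using binding_SomeD(1)[OF p] snd_denotation_binding[OF p] by simp_all
    moreover from this have "first_pos (denotation u) p = p"
    proof (intro first_pos_eqI)
      fix j assume "j < p"
      then show "snd (denotation u ! j) \<noteq> p" using le[of j] \<open>p < length u\<close> by simp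
    qed simp_all
    moreover have "p \<in> snd ` set (denotation u)"
      using calculation(1,2) by (metis image_eqI length_denotation nth_mem)
    ultimately show ?thesis by (simp add: Reuse p value_index_def)
  qed
  then show ?case using snoc by (simp add: x pattern_snoc)
qed simp

lemma denotation_eq_pattern_length: "denotation z = pattern w \<Longrightarrow> length z = length w"
  by (metis length_denotation length_pattern)

lemma denotation_eq_pattern_Nil_iff: "denotation z = pattern [] \<longleftrightarrow> z = []"
  by (metis denotation_eq_pattern_length denotation_Nil length_0_conv pattern_Nil)

lemma run_append: "run A c (w @ w') c' \<longleftrightarrow> (\<exists>c''. run A c w c'' \<and> run A c'' w' c')"
  by (induction w arbitrary: c) (simp_all, blast)

lemma sym_path_append:
  "sym_path A s (u @ v) t \<longleftrightarrow> (\<exists>s'. sym_path A s u s' \<and> sym_path A s' v t)"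
  by (induction u arbitrary: s) auto

definition store :: "('a \<times> reg_op) list \<Rightarrow> ('b \<times> 'd) list \<Rightarrow> nat \<rightharpoonup> 'd" where
  "store z w r = map_option (\<lambda>p. snd (w ! p)) (binding z r)"

lemma store_snoc_Fresh:
  assumes "length z = length w"
  shows "store (z @ [(a, Fresh r)]) (w @ [(b, d)]) = (store z w)(r \<mapsto> d)"
proof
  show "store (z @ [(a, Fresh r)]) (w @ [(b, d)]) q = ((store z w)(r \<mapsto> d)) q" for q
    using assms by (cases "binding z q") (auto simp: store_def nth_append dest: binding_SomeD(1))
qed

lemma store_snoc_Reuse:
  assumes "length z = length w"
  shows "store (z @ [(a, Reuse r)]) (w @ [y]) = store z w"
proof
  show "store (z @ [(a, Reuse r)]) (w @ [y]) q = store z w q" for q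
    using assms by (cases "binding z q") (auto simp: store_def nth_append dest: binding_SomeD(1))
qed

lemma store_eq_Some_iff:
  assumes "denotation z = pattern w"
  shows "store z w r = Some d \<longleftrightarrow> d \<in> snd ` set w \<and> binding z r = Some (first_pos w d)"
proof
  assume "store z w r = Some d"
  then obtain p where p: "binding z r = Some p" "d = snd (w ! p)" by (auto simp: store_def)
  have "p < length w"
    using binding_SomeD(1)[OF p(1)] denotation_eq_pattern_length[OF assms] by simp
  moreover from this have "first_pos w d = p"
    using snd_denotation_binding[OF p(1)] by (simp add: assms nth_pattern p(2))
  ultimately show "d \<in> snd ` set w \<and> binding z r = Some (first_pos w d)"
    using p by simp
qed (simp add: store_def first_pos_props(2))

lemma step_store_iff:
  assumes "denotation z = pattern w"
  shows "step A (s, store z w, snd ` set w) (a, d) c \<longleftrightarrow>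
    (\<exists>\<pi> s'. (s, (a, \<pi>), s') \<in> transitions A \<and> bound z \<pi> \<and> denoted_value z \<pi> = value_index w d \<and>
      c = (s', store (z @ [(a, \<pi>)]) (w @ [(a, d)]), insert d (snd ` set w)))" (is "_ \<longleftrightarrow> ?R")
proof
  have len: "length z = length w" by (rule denotation_eq_pattern_length[OF assms])
  {
    assume "step A (s, store z w, snd ` set w) (a, d) c"
    then show ?R
    proof cases
      case (fresh r s')
      then show ?thesis
        by (intro exI[of _ "Fresh r"] exI[of _ s'])
          (simp add: store_snoc_Fresh len value_index_def)
    next
      case (reuse r s')
      then show ?thesis
        by (intro exI[of _ "Reuse r"] exI[of _ s'])
          (simp add: store_snoc_Reuse len value_index_def fun_upd_idem store_eq_Some_iff[OF assms])
    qed
  next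
    assume ?R
    then obtain \<pi> s' where \<pi>: "(s, (a, \<pi>), s') \<in> transitions A" "bound z \<pi>"
      "denoted_value z \<pi> = value_index w d"
      and c: "c = (s', store (z @ [(a, \<pi>)]) (w @ [(a, d)]), insert d (snd ` set w))" by blast
    show "step A (s, store z w, snd ` set w) (a, d) c"
    proof (cases \<pi>)
      case (Fresh r)
      then have "d \<notin> snd ` set w" using \<pi>(3) len value_index_eq_length_iff[of w d] by simp
      then show ?thesis using step.fresh \<pi>(1) by (simp add: c Fresh store_snoc_Fresh len)
    next
      case (Reuse r)
      with \<pi>(2,3) have r: "binding z r = Some (value_index w d)" by auto
      then have "value_index w d \<noteq> length w" using binding_SomeD(1)[OF r] len by simp
      then have "store z w r = Some d"
        using r by (simp add: store_eq_Some_iff[OF assms] value_index_def split: if_splits)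
      then show ?thesis
        using step.reuse[of s a r s' A "store z w" d] \<pi>(1)
        by (simp add: c Reuse store_snoc_Reuse len fun_upd_idem)
    qed
  }
qed

lemma run_iff_sym_path:
  "run A (i, Map.empty, {}) w (s, \<tau>, U) \<longleftrightarrow>
    (\<exists>z. sym_path A i z s \<and> well_formed z \<and> denotation z = pattern w \<and>
      \<tau> = store z w \<and> U = snd ` set w)"
proof (induction w arbitrary: s \<tau> U rule: rev_induct)
  case Nil
  show ?case by (auto simp: denotation_eq_pattern_Nil_iff[simplified] store_def fun_eq_iff)
next
  case (snoc y w)
  obtain a d where y: "y = (a, d)" by (cases y)
  have "run A (i, Map.empty, {}) (w @ [y]) (s, \<tau>, U) \<longleftrightarrow>
      (\<exists>z s'. sym_path A i z s' \<and> well_formed z \<and> denotation z = pattern w \<and>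
        step A (s', store z w, snd ` set w) (a, d) (s, \<tau>, U))"
    by (simp add: run_append snoc.IH y) blast
  also have "\<dots> \<longleftrightarrow> (\<exists>z s' \<pi>. sym_path A i z s' \<and> well_formed z \<and> denotation z = pattern w \<and>
        (s', (a, \<pi>), s) \<in> transitions A \<and> bound z \<pi> \<and> denoted_value z \<pi> = value_index w d \<and>
        \<tau> = store (z @ [(a, \<pi>)]) (w @ [y]) \<and> U = insert d (snd ` set w))"
    by (simp add: step_store_iff y cong: conj_cong)
  also have "\<dots> \<longleftrightarrow> (\<exists>z. sym_path A i z s \<and> well_formed z \<and> denotation z = pattern (w @ [y]) \<and>
      \<tau> = store z (w @ [y]) \<and> U = snd ` set (w @ [y]))" (is "?L \<longleftrightarrow> ?R")
  proof
    assume ?L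
    then obtain z s' \<pi> where "sym_path A i z s'" "well_formed z" "denotation z = pattern w"
      "(s', (a, \<pi>), s) \<in> transitions A" "bound z \<pi>" "denoted_value z \<pi> = value_index w d"
      "\<tau> = store (z @ [(a, \<pi>)]) (w @ [y])" "U = insert d (snd ` set w)"
      by blast
    then show ?R
      by (intro exI[of _ "z @ [(a, \<pi>)]"]) (auto simp: y pattern_snoc sym_path_append)
  next
    assume ?R
    then obtain z' where z': "sym_path A i z' s" "well_formed z'"
      "denotation z' = pattern (w @ [y])" "\<tau> = store z' (w @ [y])" "U = snd ` set (w @ [y])"
      by blast
    have "length z' = Suc (length w)" using denotation_eq_pattern_length[OF z'(3)] by simp
    then obtain z b \<pi> where "z' = z @ [(b, \<pi>)]"
      by (cases z' rule: rev_cases) auto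
    with z' show ?L by (auto simp: y pattern_snoc sym_path_append)
  qed
  finally show ?case .
qed

lemma data_lang_iff:
  "w \<in> data_lang \<Sigma> D A \<longleftrightarrow>
    w \<in> lists (\<Sigma> \<times> D) \<and> (\<exists>z\<in>sym_lang A. well_formed z \<and> denotation z = pattern w)"
  unfolding data_lang_def sym_lang_def by (auto simp: run_iff_sym_path)

section \<open>Normal forms\<close>

definition live :: "('a \<times> 'd) list \<Rightarrow> nat \<Rightarrow> 'd set" where
  "live w i = {d \<in> snd ` set w. first_pos w d < i \<and> i \<le> last_pos w d}"

lemma finite_live: "finite (live w i)"
  by (simp add: live_def)

lemma live_length: "live w (length w) = {}"
  using last_pos_props(1)[of _ w] by (fastforce simp: live_def)

lemma live_Suc:
  assumes "i < length w" "d = snd (w ! i)"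
  shows "live w (Suc i) = (if i = last_pos w d then live w i - {d} else insert d (live w i))"
proof -
  have d: "d \<in> snd ` set w" "first_pos w d \<le> i" "i \<le> last_pos w d"
    using assms by (auto intro: first_pos_le last_pos_ge)
  have "d' \<in> live w (Suc i) \<longleftrightarrow> d' \<in> live w i" if "d' \<noteq> d" for d'
  proof (cases "d' \<in> snd ` set w")
    case True
    then have "first_pos w d' \<noteq> i" "last_pos w d' \<noteq> i"
      using that assms(2) first_pos_props(2) last_pos_props(2) by metis+
    then have "first_pos w d' < Suc i \<longleftrightarrow> first_pos w d' < i"
      "Suc i \<le> last_pos w d' \<longleftrightarrow> i \<le> last_pos w d'"
      by linarith+
    then show ?thesis by (simp add: live_def)
  qed (simp add: live_def)
  moreover have "d \<in> live w (Suc i) \<longleftrightarrow> i \<noteq> last_pos w d"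
    using d by (auto simp: live_def)
  ultimately show ?thesis
    by (intro set_eqI) (metis Diff_iff insert_iff singletonD)
qed

lemma in_live_iff:
  assumes "i < length w"
  shows "snd (w ! i) \<in> live w i \<longleftrightarrow> i \<noteq> first_pos w (snd (w ! i))"
  using assms first_pos_le[of i w] last_pos_ge[of i w] by (auto simp: live_def)

definition register_of :: "('a \<times> 'd) list \<Rightarrow> ('a \<times> reg_op) list \<Rightarrow> 'd \<Rightarrow> nat" where
  "register_of w u d = reg (snd (u ! first_pos w d))"

definition occupied :: "('a \<times> 'd) list \<Rightarrow> ('a \<times> reg_op) list \<Rightarrow> nat set" where
  "occupied w u = register_of w u ` live w (length u)"

definition snf_invariant :: "('a \<times> 'd) list \<Rightarrow> nat set \<Rightarrow> ('a \<times> reg_op) list \<Rightarrow> bool" where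
  "snf_invariant w free u \<longleftrightarrow> length u \<le> length w \<and> free = {1..} - occupied w u \<and>
     (\<forall>d\<in>live w (length u). binding u (register_of w u d) = Some (first_pos w d)) \<and>
     normal_prefix u \<and> denotation u = take (length u) (pattern w) \<and>
     set (obligations u) \<subseteq> occupied w u"

lemma register_of_snoc: "first_pos w d < length u \<Longrightarrow> register_of w (u @ [x]) d = register_of w u d"
  by (simp add: register_of_def nth_append)

lemma register_of_snoc_image:
  "register_of w (u @ [x]) ` (live w (length u) - X) = register_of w u ` (live w (length u) - X)"
  by (rule image_cong) (simp_all add: register_of_snoc live_def)

lemma occupied_snoc_Fresh:
  assumes "length u < length w" "w ! length u = (a, d)" "length u = first_pos w d"
  shows "occupied w (u @ [(a, Fresh m)]) =
    (if length u = last_pos w d then occupied w u else insert m (occupied w u))"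
proof -
  let ?L = "live w (length u)" and ?g = "register_of w (u @ [(a, Fresh m)])"
  have "d \<notin> ?L" using in_live_iff[OF assms(1)] assms(2,3) by simp
  then have live: "live w (Suc (length u)) = (if length u = last_pos w d then ?L else insert d ?L)"
    using live_Suc[OF assms(1), of d] assms(2) by auto
  have g: "?g ` ?L = register_of w u ` ?L" "?g d = m"
    using register_of_snoc_image[of w u _ "{}"]
    by simp (simp add: register_of_def assms(3)[symmetric])
  show ?thesis
    unfolding occupied_def length_append_singleton live if_distrib[of "image ?g"] image_insert g ..
qed

lemma occupied_snoc_Reuse:
  assumes "length u < length w" "w ! length u = (a, d)" "length u \<noteq> first_pos w d"
    and inj: "inj_on (register_of w u) (live w (length u))"
  shows "occupied w (u @ [(a, Reuse r)]) =
    occupied w u - (if length u = last_pos w d then {register_of w u d} else {})"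
proof -
  have d: "d \<in> live w (length u)" using in_live_iff[OF assms(1)] assms(2,3) by simp
  then have "live w (Suc (length u)) =
      live w (length u) - (if length u = last_pos w d then {d} else {})"
    using live_Suc[OF assms(1), of d] assms(2) by auto
  then show ?thesis
    using d inj by (auto simp: occupied_def register_of_snoc_image inj_on_def)
qed

lemma take_Suc_pattern:
  "i < length w \<Longrightarrow> take (Suc i) (pattern w) =
    take i (pattern w) @ [(fst (w ! i), first_pos w (snd (w ! i)))]"
  by (simp add: take_Suc_conv_app_nth nth_pattern)

lemma snf_invariant_least_free:
  assumes "snf_invariant w free u"
  defines "m \<equiv> LEAST r. r \<in> free"
  shows "m \<in> free" "\<And>r. 1 \<le> r \<Longrightarrow> r < m \<Longrightarrow> r \<in> occupied w u"
proof -
  have free: "free = {1..} - occupied w u"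
    using assms(1) by (simp add: snf_invariant_def)
  then have "infinite free" by (simp add: occupied_def finite_live infinite_Ici)
  then show "m \<in> free" unfolding m_def by (metis LeastI ex_in_conv finite.emptyI)
  show "r \<in> occupied w u" if "1 \<le> r" "r < m" for r
    using that not_less_Least[of r "\<lambda>r. r \<in> free"] unfolding m_def free by auto
qed

lemma snf_invariant_Fresh:
  assumes inv: "snf_invariant w free u" and i: "length u < length w"
    and x: "w ! length u = (a, d)" and first: "length u = first_pos w d"
  defines "m \<equiv> LEAST r. r \<in> free"
  shows "snf_invariant w (if length u = last_pos w d then free \<union> {m} else free - {m})
    (u @ [(a, Fresh m)])" (is "snf_invariant w ?free ?u")
proof -
  have free: "free = {1..} - occupied w u"
    and stored: "\<And>d. d \<in> live w (length u) \<Longrightarrow> binding u (register_of w u d) = Some (first_pos w d)"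
    and u: "normal_prefix u" "denotation u = take (length u) (pattern w)"
    and ob: "set (obligations u) \<subseteq> occupied w u"
    using inv by (auto simp: snf_invariant_def)
  note m = snf_invariant_least_free[OF inv, folded m_def]
  note occupied = occupied_snoc_Fresh[OF i x first, of m]
  have "binding ?u (register_of w ?u d') = Some (first_pos w d')"
    if d': "d' \<in> live w (Suc (length u))" for d'
  proof (cases "d' = d")
    case True
    then show ?thesis by (simp add: register_of_def first[symmetric])
  next
    case False
    then have d'_live: "d' \<in> live w (length u)"
      using d' live_Suc[OF i, of d] x by (auto split: if_splits)
    then have "register_of w u d' \<noteq> m" using m(1) by (auto simp: free occupied_def)
    then show ?thesis using stored d'_live by (simp add: register_of_snoc live_def)
  qed
  moreover have "normal_step u (Fresh m)"
    using m stored ob by (fastforce simp: free occupied_def)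
  moreover have "set (obligations ?u) \<subseteq> occupied w ?u" using ob m(2) by (auto simp: occupied)
  moreover have "?free = {1..} - occupied w ?u" using m(1) unfolding occupied free by auto
  moreover have "denotation ?u = take (Suc (length u)) (pattern w)"
    unfolding take_Suc_pattern[OF i] using u(2) x first by simp
  ultimately show ?thesis
    using u(1) i by (simp add: snf_invariant_def)
qed

lemma snf_invariant_Reuse:
  assumes inv: "snf_invariant w free u" and i: "length u < length w"
    and x: "w ! length u = (a, d)" and not_first: "length u \<noteq> first_pos w d"
  shows "snf_invariant w (if length u = last_pos w d then free \<union> {register_of w u d} else free)
    (u @ [(a, Reuse (register_of w u d))])" (is "snf_invariant w ?free ?u")
proof -
  let ?L = "live w (length u)" and ?r = "register_of w u d"
  have free: "free = {1..} - occupied w u"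
    and stored: "\<And>d. d \<in> ?L \<Longrightarrow> binding u (register_of w u d) = Some (first_pos w d)"
    and u: "normal_prefix u" "denotation u = take (length u) (pattern w)"
    and ob: "set (obligations u) \<subseteq> occupied w u"
    using inv by (auto simp: snf_invariant_def)
  have d: "d \<in> ?L" using in_live_iff[OF i] not_first x by simp
  have "snd (w ! first_pos w d') = d'" if "d' \<in> ?L" for d'
    using that by (simp add: live_def first_pos_props(2))
  then have "inj_on (register_of w u) ?L"
    by (intro inj_onI) (metis stored option.inject)
  note occupied = occupied_snoc_Reuse[OF i x not_first this, of ?r]
  have bound: "binding u ?r = Some (first_pos w d)" by (rule stored[OF d])
  then have "normal_step (take (first_pos w d) u) (Fresh ?r)"
    using binding_SomeD[OF bound] normal_prefixD[OF u(1)] by metis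
  then have "?r \<in> {1..} \<inter> occupied w u" using d by (simp add: occupied_def)
  then have "?free = {1..} - occupied w ?u" unfolding occupied free by auto
  moreover have "binding ?u (register_of w ?u d') = Some (first_pos w d')"
    if "d' \<in> live w (Suc (length u))" for d'
  proof -
    have "d' \<in> ?L" using that d live_Suc[OF i, of d] x by (auto split: if_splits)
    then show ?thesis using stored by (simp add: register_of_snoc live_def)
  qed
  moreover have "set (obligations ?u) \<subseteq> occupied w ?u" using ob unfolding occupied by auto
  moreover have "denotation ?u = take (Suc (length u)) (pattern w)"
    using u(2) x bound by (simp add: take_Suc_pattern[OF i])
  ultimately show ?thesis
    using u(1) i bound by (simp add: snf_invariant_def)
qed

lemma zip_snoc_right:
  "length ys < length xs \<Longrightarrow> zip xs (ys @ [y]) = zip xs ys @ [(xs ! length ys, y)]"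
proof (induction ys arbitrary: xs)
  case Nil then show ?case by (cases xs) auto
next
  case (Cons z ys) then show ?case by (cases xs) auto
qed

lemma snf_upto_invariant:
  assumes "i \<le> length w" "snf_upto w i = (free, \<pi>s)"
  shows "length \<pi>s = i \<and> snf_invariant w free (zip (map fst w) \<pi>s)"
  using assms
proof (induction i arbitrary: free \<pi>s)
  case 0
  then show ?case by (auto simp: live_def occupied_def snf_invariant_def)
next
  case (Suc i)
  obtain free0 \<pi>s0 where up: "snf_upto w i = (free0, \<pi>s0)" by fastforce
  obtain a d where x: "w ! i = (a, d)" by fastforce
  have i: "i < length w" using Suc.prems by simp
  define u where "u = zip (map fst w) \<pi>s0"
  have len: "length \<pi>s0 = i" and inv: "snf_invariant w free0 u"
    using Suc.IH[OF _ up] i by (simp_all add: u_def)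
  have u: "length u = i" using len i by (simp add: u_def)
  have zip: "zip (map fst w) (\<pi>s0 @ [\<pi>]) = u @ [(a, \<pi>)]" for \<pi>
    using i x by (simp add: zip_snoc_right len u_def)
  show ?case
  proof (cases "i = first_pos w d")
    case True
    then show ?thesis
      using Suc.prems(2) up snf_invariant_Fresh[OF inv, of a d] i x u len
      by (auto simp: Let_def zip[symmetric] split: if_splits)
  next
    case False
    then have "d \<in> live w i" using in_live_iff[OF i] x by simp
    then have "first_pos w d < length \<pi>s0" by (simp add: len live_def)
    then have "reg (\<pi>s0 ! first_pos w d) = register_of w u d"
      using i len by (simp add: u_def register_of_def)
    with False show ?thesis
      using Suc.prems(2) up snf_invariant_Reuse[OF inv, of a d] i x u len
      by (auto simp: Let_def zip[symmetric] split: if_splits)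
  qed
qed

lemma normal_form_snf: "normal_form (snf w)"
  and denotation_snf: "denotation (snf w) = pattern w"
proof -
  obtain free \<pi>s where "snf_upto w (length w) = (free, \<pi>s)" by fastforce
  from snf_upto_invariant[OF order.refl this] this
  show "normal_form (snf w)" "denotation (snf w) = pattern w"
    by (auto simp: snf_def normal_form_def live_length occupied_def snf_invariant_def)
qed

lemma obligation_discharged:
  assumes "normal_prefix (v @ z)" "r \<in> set (obligations v)" "r \<notin> set (obligations (v @ z))"
  shows "\<exists>z1 a z2. z = z1 @ (a, Reuse r) # z2 \<and> (\<forall>x\<in>set z1. snd x \<noteq> Fresh r)"
  using assms
proof (induction z arbitrary: v)
  case (Cons x z)
  obtain a \<pi> where x: "x = (a, \<pi>)" by (cases x)
  show ?case
  proof (cases "\<pi> = Reuse r")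
    case True
    then show ?thesis by (intro exI[of _ "[]"]) (auto simp: x)
  next
    case False
    have "normal_prefix (v @ [x])"
      using Cons.prems(1) normal_prefix_appendD[of "v @ [x]" z] by simp
    then have "\<pi> \<noteq> Fresh r" using Cons.prems(2) by (auto simp: x)
    moreover have "r \<in> set (obligations (v @ [x]))"
      using Cons.prems(2) False by (cases \<pi>) (auto simp: x)
    then obtain z1 b z2 where "z = z1 @ (b, Reuse r) # z2" "\<forall>x\<in>set z1. snd x \<noteq> Fresh r"
      using Cons.IH[of "v @ [x]"] Cons.prems by auto
    ultimately show ?thesis by (intro exI[of _ "x # z1"]) (auto simp: x)
  qed
qed simp

lemma normal_form_smaller_register_recurs:
  assumes "normal_form u" "i < length u" "snd (u ! i) = Fresh r" "1 \<le> q" "q < r"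
  obtains p j where "binding (take i u) q = Some p"
    "i < j" "j < length u" "snd (denotation u ! j) = p"
proof -
  define v where "v = take (Suc i) u"
  have v: "v = take i u @ [u ! i]" using assms(2) by (simp add: v_def take_Suc_conv_app_nth)
  have u: "v @ drop (Suc i) u = u" by (simp add: v_def)
  have "q \<in> set (obligations v)" using assms by (auto simp: v)
  then obtain z a z' where z: "drop (Suc i) u = z @ (a, Reuse q) # z'" "\<forall>x\<in>set z. snd x \<noteq> Fresh q"
    using obligation_discharged[of v "drop (Suc i) u" q] u assms(1) by (auto simp: normal_form_def)
  have split: "u = (v @ z) @ (a, Reuse q) # z'" using u z(1) by simp
  have "normal_step (take i u) (Fresh r)"
    using normal_formD[OF assms(1,2)] assms(3) by simp
  then obtain p where p: "binding (take i u) q = Some p"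
    using assms(4,5) by (auto dest!: bspec[of _ _ q])
  then have "binding (v @ z) q = Some p"
    using z(2) assms(3,5) by (simp add: binding_append_not_Fresh v)
  moreover have "take (length (v @ z)) u = v @ z" by (subst split) simp
  moreover have "u ! length (v @ z) = (a, Reuse q)" by (subst split) (rule nth_append_length)
  moreover have less: "length (v @ z) < length u" by (subst split) simp
  ultimately have "snd (denotation u ! length (v @ z)) = p"
    by (simp only: nth_denotation snd_conv denoted_value_simps option.sel)
  moreover have "i < length (v @ z)" using assms(2) by (simp add: v_def)
  ultimately show thesis using p less that by blast
qed

lemma held_until_reused:
  assumes "well_formed z" "j < length z" "snd (denotation z ! j) = p" "p < m" "m \<le> j"
  obtains r where "Reuse r = snd (z ! j)" "binding (take m z) r = Some p"
proof -
  have "bound (take j z) (snd (z ! j))" "denoted_value (take j z) (snd (z ! j)) = p"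
    using well_formedD[OF assms(1,2)] assms(2,3) by (simp_all add: nth_denotation)
  moreover have "p < length (take j z)" using assms(2,4,5) by simp
  ultimately obtain r where "snd (z ! j) = Reuse r" "binding (take j z) r = Some p"
    by (rule denoted_value_less)
  then show thesis using that binding_take_earlier assms(4,5) by metis
qed

lemma normal_form_Fresh_le:
  assumes "normal_form u" "normal_form v" "denotation u = denotation v" "i < length u"
    and same: "take i u = take i v" and Fresh: "snd (u ! i) = Fresh r" "snd (v ! i) = Fresh q"
  shows "r \<le> q"
proof (rule ccontr)
  assume "\<not> r \<le> q"
  have i: "i < length v" using assms(4) denotation_eq_length[OF assms(3)] by simp
  have "normal_step (take i v) (Fresh q)"
    using normal_formD[OF assms(2) i] Fresh(2) by simp
  then have q: "1 \<le> q" "q < r" using \<open>\<not> r \<le> q\<close> by simp_all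
  obtain p j where p: "binding (take i u) q = Some p"
    and j: "i < j" "j < length v" "snd (denotation v ! j) = p"
    using normal_form_smaller_register_recurs[OF assms(1,4) Fresh(1) q]
      denotation_eq_length[OF assms(3)] assms(3) by metis
  have "p < i" using binding_SomeD(1)[OF p] by simp
  then obtain q' where q': "binding (take (Suc i) v) q' = Some p"
    using held_until_reused[OF normal_form_imp_well_formed[OF assms(2)] j(2,3), of "Suc i"] j(1)
    by (metis Suc_leI less_SucI)
  then have "binding (take i v) q' = Some p" using binding_take_earlier \<open>p < i\<close> by fastforce
  then have "q' = q" using p same binding_inj by metis
  with q' show False
    using \<open>p < i\<close> i Fresh(2) by (simp add: take_Suc_conv_app_nth)
qed

lemma normal_form_next_letter_unique:
  assumes nf: "normal_form u" "normal_form v" and denote: "denotation u = denotation v"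
    and i: "i < length u" and same: "take i u = take i v"
  shows "u ! i = v ! i"
proof -
  have i': "i < length v" using i denotation_eq_length[OF denote] by simp
  define \<pi> \<rho> where "\<pi> = snd (u ! i)" and "\<rho> = snd (v ! i)"
  have bound: "bound (take i u) \<pi>" "bound (take i u) \<rho>"
    using nf[THEN normal_form_imp_well_formed, THEN well_formedD] i i' same
    by (metis \<pi>_def \<rho>_def)+
  have "denotation u ! i = denotation v ! i" by (simp add: denote)
  then have letter: "fst (u ! i) = fst (v ! i)"
    and val: "denoted_value (take i u) \<pi> = denoted_value (take i u) \<rho>"
    using i i' same by (simp_all add: nth_denotation \<pi>_def \<rho>_def)
  have kind: "is_Fresh \<pi> \<longleftrightarrow> is_Fresh \<rho>"
    using denoted_value_eq_length_iff bound val by metis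
  have "\<pi> = \<rho>"
  proof (cases "is_Fresh \<pi>")
    case True
    then obtain r q where rq: "\<pi> = Fresh r" "\<rho> = Fresh q"
      using kind by (metis reg_op.collapse(1))
    have "r \<le> q" "q \<le> r"
      using normal_form_Fresh_le[OF nf denote i same] rq
        normal_form_Fresh_le[OF nf(2,1) denote[symmetric] i' same[symmetric]]
      by (simp_all add: \<pi>_def \<rho>_def)
    then show ?thesis using rq by simp
  next
    case False
    then obtain r q where rq: "\<pi> = Reuse r" "\<rho> = Reuse q"
      using kind by (metis reg_op.collapse(2))
    then show ?thesis using val bound binding_inj by auto
  qed
  then show ?thesis using letter by (simp add: prod_eq_iff \<pi>_def \<rho>_def)
qed

lemma normal_form_unique:
  assumes "normal_form u" "normal_form v" "denotation u = denotation v"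
  shows "u = v"
proof -
  have len: "length u = length v" by (rule denotation_eq_length[OF assms(3)])
  have "take i u = take i v" if "i \<le> length u" for i
    using that
  proof (induction i)
    case (Suc i)
    then show ?case
      using normal_form_next_letter_unique[OF assms, of i] len
      by (simp add: take_Suc_conv_app_nth)
  qed simp
  from this[of "length u"] len show ?thesis by simp
qed

lemma eq_snf_iff: "u = snf w \<longleftrightarrow> normal_form u \<and> denotation u = pattern w"
  using normal_form_unique normal_form_snf denotation_snf by metis

section \<open>Deterministic automata and right-invariant maps\<close>

lemma finite_Gam: "finite (Gam k)"
proof (rule finite_subset)
  show "Gam k \<subseteq> Fresh ` {1..k} \<union> Reuse ` {1..k}"
  proof
    fix \<pi> assume "\<pi> \<in> Gam k"
    then show "\<pi> \<in> Fresh ` {1..k} \<union> Reuse ` {1..k}" by (cases \<pi>) (auto simp: Gam_def)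
  qed
qed simp

lemma Gam_mono: "k \<le> k' \<Longrightarrow> Gam k \<subseteq> Gam k'"
  by (auto simp: Gam_def)

definition right_invariant :: "'x set \<Rightarrow> ('x list \<Rightarrow> 'q) \<Rightarrow> bool" where
  "right_invariant Al f \<longleftrightarrow>
     (\<forall>u\<in>lists Al. \<forall>v\<in>lists Al. \<forall>x\<in>Al. f u = f v \<longrightarrow> f (u @ [x]) = f (v @ [x]))"

definition recognizes :: "'x set \<Rightarrow> ('x list \<Rightarrow> 'q) \<Rightarrow> 'x list set \<Rightarrow> bool" where
  "recognizes Al f K \<longleftrightarrow> (\<forall>u\<in>lists Al. \<forall>v\<in>lists Al. f u = f v \<longrightarrow> u \<in> K \<longrightarrow> v \<in> K)"

lemma right_invariant_append:
  assumes "right_invariant Al f" "u \<in> lists Al" "v \<in> lists Al" "z \<in> lists Al" "f u = f v"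
  shows "f (u @ z) = f (v @ z)"
  using assms(4)
proof (induction z rule: rev_induct)
  case (snoc x z)
  then have "f (u @ z) = f (v @ z)" "u @ z \<in> lists Al" "v @ z \<in> lists Al" "x \<in> Al"
    using assms(2,3) by auto
  then have "f ((u @ z) @ [x]) = f ((v @ z) @ [x])"
    using assms(1) unfolding right_invariant_def by blast
  then show ?case by simp
qed (use assms(5) in simp)

text \<open>A shortest member of \<open>K\<close> cannot be cut between two prefixes of equal value.\<close>

lemma recognized_short_member:
  assumes inv: "right_invariant Al f" and fin: "finite (f ` lists Al)" and K: "recognizes Al f K"
    and u: "u \<in> lists Al" "u \<in> K"
  obtains v where "v \<in> lists Al" "v \<in> K" "length v < card (f ` lists Al)"
proof -
  obtain v where v: "v \<in> lists Al" "v \<in> K"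
    and least: "\<And>z. z \<in> lists Al \<Longrightarrow> z \<in> K \<Longrightarrow> length v \<le> length z"
    using ex_has_least_nat[of "\<lambda>v. v \<in> lists Al \<and> v \<in> K" u length] u by blast
  have parts: "take i v \<in> lists Al" "drop i v \<in> lists Al" for i
    using v(1) by (auto dest: in_set_takeD in_set_dropD)
  have "f (take i v) \<noteq> f (take j v)" if "i < j" "j \<le> length v" for i j
  proof
    assume "f (take i v) = f (take j v)"
    then have "f v = f (take i v @ drop j v)"
      using right_invariant_append[OF inv parts(1) parts(1) parts(2), of i j j] by simp
    then have "take i v @ drop j v \<in> K"
      using K v parts unfolding recognizes_def by (metis append_in_lists_conv)
    then have "length v \<le> length (take i v @ drop j v)" using parts by (intro least) auto
    then show False using that by simp
  qed
  then have "inj_on (\<lambda>i. f (take i v)) {..length v}"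
    by (intro linorder_inj_onI) auto
  then have "card {..length v} \<le> card (f ` lists Al)"
    using parts fin by (intro card_inj_on_le) auto
  then show thesis using that v by simp
qed

definition dfa_of :: "'s set \<Rightarrow> ('a \<times> reg_op) set \<Rightarrow> nat \<Rightarrow> ('s \<Rightarrow> 'a \<times> reg_op \<Rightarrow> 's) \<Rightarrow> 's \<Rightarrow> 's set
    \<Rightarrow> ('s, 'a) session_automaton" where
  "dfa_of Q Al k \<delta> i F = \<lparr>states = Q, registers = k, initial = i, finals = F,
     transitions = {(s, x, \<delta> s x) | s x. s \<in> Q \<and> x \<in> Al}\<rparr>"

lemma foldl_closed:
  assumes "\<And>s x. s \<in> Q \<Longrightarrow> x \<in> Al \<Longrightarrow> \<delta> s x \<in> Q" "s \<in> Q" "u \<in> lists Al"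
  shows "foldl \<delta> s u \<in> Q"
  using assms(2,3)
proof (induction u arbitrary: s)
  case (Cons x u) then show ?case using assms(1) by simp
qed simp

lemma sym_path_deterministic_iff:
  assumes trans: "transitions A = {(s, x, \<delta> s x) | s x. s \<in> Q \<and> x \<in> Al}"
    and closed: "\<And>s x. s \<in> Q \<Longrightarrow> x \<in> Al \<Longrightarrow> \<delta> s x \<in> Q" and "s \<in> Q"
  shows "sym_path A s u t \<longleftrightarrow> u \<in> lists Al \<and> t = foldl \<delta> s u"
  using \<open>s \<in> Q\<close>
proof (induction u arbitrary: s)
  case (Cons x u)
  have "sym_path A s (x # u) t \<longleftrightarrow> x \<in> Al \<and> sym_path A (\<delta> s x) u t"
    using Cons.prems unfolding sym_path.simps trans by blast
  then show ?case using Cons closed[of s x] by auto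
qed auto

lemma complete_dfa_dfa_of:
  assumes "finite \<Sigma>" "finite Q" "i \<in> Q" "F \<subseteq> Q"
    and "\<And>s x. s \<in> Q \<Longrightarrow> x \<in> \<Sigma> \<times> Gam k \<Longrightarrow> \<delta> s x \<in> Q"
  shows "complete_dfa \<Sigma> k (dfa_of Q (\<Sigma> \<times> Gam k) k \<delta> i F)"
proof -
  have "{(s, x, \<delta> s x) | s x. s \<in> Q \<and> x \<in> \<Sigma> \<times> Gam k} =
      (\<lambda>(s, x). (s, x, \<delta> s x)) ` (Q \<times> (\<Sigma> \<times> Gam k))" by auto
  moreover have "finite \<dots>" using assms finite_Gam by (intro finite_imageI finite_cartesian_product)
  ultimately show ?thesis
    using assms by (auto simp: complete_dfa_def session_automaton_def dfa_of_def)
qed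

lemma sym_lang_dfa_of:
  assumes "i \<in> Q" "\<And>s x. s \<in> Q \<Longrightarrow> x \<in> Al \<Longrightarrow> \<delta> s x \<in> Q"
  shows "sym_lang (dfa_of Q Al k \<delta> i F) = {u \<in> lists Al. foldl \<delta> i u \<in> F}"
proof -
  have "sym_path (dfa_of Q Al k \<delta> i F) i u t \<longleftrightarrow> u \<in> lists Al \<and> t = foldl \<delta> i u" for u t
    using assms by (intro sym_path_deterministic_iff[where Q = Q]) (auto simp: dfa_of_def)
  then show ?thesis by (auto simp: sym_lang_def) (auto simp: dfa_of_def)
qed

lemma right_invariant_transition_function:
  assumes "right_invariant Al f"
  obtains \<delta> where "\<And>u x. u \<in> lists Al \<Longrightarrow> x \<in> Al \<Longrightarrow> \<delta> (f u) x = f (u @ [x])"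
    "\<And>u. u \<in> lists Al \<Longrightarrow> foldl \<delta> (f []) u = f u"
proof -
  define rep where "rep = (\<lambda>s. SOME u. u \<in> lists Al \<and> f u = s)"
  define \<delta> where "\<delta> = (\<lambda>s x. f (rep s @ [x]))"
  have \<delta>: "\<delta> (f u) x = f (u @ [x])" if "u \<in> lists Al" "x \<in> Al" for u x
  proof -
    have "rep (f u) \<in> lists Al \<and> f (rep (f u)) = f u"
      unfolding rep_def by (rule someI[of _ u]) (use that in simp)
    then show ?thesis using assms that unfolding right_invariant_def \<delta>_def by blast
  qed
  moreover have "foldl \<delta> (f []) u = f u" if "u \<in> lists Al" for u
    using that by (induction u rule: rev_induct) (auto simp: \<delta>)
  ultimately show thesis using that by blast
qed

lemma complete_dfa_of_right_invariant:
  fixes f :: "('a \<times> reg_op) list \<Rightarrow> 's"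
  assumes "finite \<Sigma>" and inv: "right_invariant (\<Sigma> \<times> Gam k) f" and "finite (f ` lists (\<Sigma> \<times> Gam k))"
    and K: "K \<subseteq> lists (\<Sigma> \<times> Gam k)" "recognizes (\<Sigma> \<times> Gam k) f K"
  obtains B :: "('s, 'a) session_automaton" where "complete_dfa \<Sigma> k B" "sym_lang B = K"
proof -
  let ?Al = "\<Sigma> \<times> Gam k"
  obtain \<delta> where \<delta>: "\<And>u x. u \<in> lists ?Al \<Longrightarrow> x \<in> ?Al \<Longrightarrow> \<delta> (f u) x = f (u @ [x])"
    and run: "\<And>u. u \<in> lists ?Al \<Longrightarrow> foldl \<delta> (f []) u = f u"
    using right_invariant_transition_function[OF inv] by metis
  define B where "B = dfa_of (f ` lists ?Al) ?Al k \<delta> (f []) (f ` K)"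
  have closed: "\<delta> s x \<in> f ` lists ?Al" if "s \<in> f ` lists ?Al" "x \<in> ?Al" for s x
    using that(1)
  proof (rule imageE)
    fix u assume "s = f u" "u \<in> lists ?Al"
    then have "\<delta> s x = f (u @ [x])" "u @ [x] \<in> lists ?Al" using \<delta> that(2) by simp_all
    then show ?thesis by (simp del: in_lists_conv_set)
  qed
  then have "complete_dfa \<Sigma> k B"
    unfolding B_def using assms(1,3) K(1) by (intro complete_dfa_dfa_of) auto
  moreover have "sym_lang B = {u \<in> lists ?Al. foldl \<delta> (f []) u \<in> f ` K}"
    unfolding B_def using closed by (intro sym_lang_dfa_of) auto
  moreover have "\<dots> = K"
  proof (intro set_eqI iffI)
    fix u assume "u \<in> {u \<in> lists ?Al. foldl \<delta> (f []) u \<in> f ` K}"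
    then have u: "u \<in> lists ?Al" and "f u \<in> f ` K" using run[of u] by simp_all
    then obtain v where v: "v \<in> K" "f v = f u" by auto
    moreover from this K(1) have "v \<in> lists ?Al" by blast
    ultimately show "u \<in> K" using K(2) u unfolding recognizes_def by metis
  next
    fix u assume "u \<in> K"
    with K(1) have "u \<in> lists ?Al" by blast
    with run[OF this] \<open>u \<in> K\<close> show "u \<in> {u \<in> lists ?Al. foldl \<delta> (f []) u \<in> f ` K}" by simp
  qed
  ultimately show thesis using that by simp
qed

lemma right_invariant_comp_inj:
  assumes "right_invariant Al f" "inj_on g (f ` lists Al)"
  shows "right_invariant Al (g \<circ> f)"
  unfolding right_invariant_def
proof (intro ballI impI)
  fix u v x assume letters: "u \<in> lists Al" "v \<in> lists Al" "x \<in> Al" and "(g \<circ> f) u = (g \<circ> f) v"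
  then have "f u = f v" using inj_onD[OF assms(2), of "f u" "f v"] by (simp only: comp_apply imageI)
  then have "f (u @ [x]) = f (v @ [x])"
    using assms(1) letters unfolding right_invariant_def by blast
  then show "(g \<circ> f) (u @ [x]) = (g \<circ> f) (v @ [x])" by simp
qed

lemma recognizes_comp_inj:
  assumes "recognizes Al f K" "inj_on g (f ` lists Al)"
  shows "recognizes Al (g \<circ> f) K"
  unfolding recognizes_def
proof (intro ballI impI)
  fix u v assume letters: "u \<in> lists Al" "v \<in> lists Al" and "(g \<circ> f) u = (g \<circ> f) v" and u: "u \<in> K"
  then have "f u = f v" using inj_onD[OF assms(2), of "f u" "f v"] by (simp only: comp_apply imageI)
  then show "v \<in> K" using assms(1) letters u unfolding recognizes_def by blast
qed

lemma complete_dfa_exists: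
  fixes f :: "('a \<times> reg_op) list \<Rightarrow> 'q"
  assumes "finite \<Sigma>" "right_invariant (\<Sigma> \<times> Gam k) f" "finite (f ` lists (\<Sigma> \<times> Gam k))"
    and "K \<subseteq> lists (\<Sigma> \<times> Gam k)" "recognizes (\<Sigma> \<times> Gam k) f K"
  obtains B :: "(nat, 'a) session_automaton" where "complete_dfa \<Sigma> k B" "sym_lang B = K"
proof -
  obtain g :: "'q \<Rightarrow> nat" where g: "inj_on g (f ` lists (\<Sigma> \<times> Gam k))"
    using finite_imp_inj_to_nat_seg[OF assms(3)] by blast
  have "finite ((g \<circ> f) ` lists (\<Sigma> \<times> Gam k))" using assms(3) by (metis finite_imageI image_comp)
  from complete_dfa_of_right_invariant[OF assms(1) right_invariant_comp_inj[OF assms(2) g] this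
      assms(4) recognizes_comp_inj[OF assms(5) g]]
  show thesis using that .
qed

lemma complete_dfa_reach:
  assumes "complete_dfa \<Sigma> k B"
  obtains \<rho> where "\<And>u. u \<in> lists (\<Sigma> \<times> Gam k) \<Longrightarrow> \<rho> u \<in> states B"
    "right_invariant (\<Sigma> \<times> Gam k) \<rho>"
    "sym_lang B = {u \<in> lists (\<Sigma> \<times> Gam k). \<rho> u \<in> finals B}"
proof -
  let ?Al = "\<Sigma> \<times> Gam k"
  define \<delta> where "\<delta> = (\<lambda>s x. THE s'. (s, x, s') \<in> transitions B)"
  have B: "initial B \<in> states B" "transitions B \<subseteq> states B \<times> ?Al \<times> states B"
    and ex1: "\<And>s x. s \<in> states B \<Longrightarrow> x \<in> ?Al \<Longrightarrow> \<exists>!s'. (s, x, s') \<in> transitions B"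
    using assms unfolding complete_dfa_def session_automaton_def by blast+
  have in_trans: "(s, x, \<delta> s x) \<in> transitions B" if "s \<in> states B" "x \<in> ?Al" for s x
    unfolding \<delta>_def by (rule theI') (rule ex1[OF that])
  have "(s, x, s') \<in> transitions B \<longleftrightarrow> s \<in> states B \<and> x \<in> ?Al \<and> s' = \<delta> s x" for s x s'
    using B(2) in_trans ex1 by blast
  then have trans: "transitions B = {(s, x, \<delta> s x) | s x. s \<in> states B \<and> x \<in> ?Al}" by auto
  have closed: "\<delta> s x \<in> states B" if "s \<in> states B" "x \<in> ?Al" for s x
    using in_trans[OF that] B(2) by auto
  let ?\<rho> = "foldl \<delta> (initial B)"
  have "u \<in> lists ?Al \<Longrightarrow> ?\<rho> u \<in> states B" for u
    using closed B(1) by (rule foldl_closed)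
  moreover have "right_invariant ?Al ?\<rho>" by (simp add: right_invariant_def)
  moreover have "sym_lang B = {u \<in> lists ?Al. ?\<rho> u \<in> finals B}"
    using sym_path_deterministic_iff[OF trans closed B(1)] by (auto simp: sym_lang_def)
  ultimately show thesis using that by blast
qed

lemma complete_dfa_finite_states: "complete_dfa \<Sigma> k B \<Longrightarrow> finite (states B)"
  by (simp add: complete_dfa_def session_automaton_def)

definition distinguishable :: "'x list set \<Rightarrow> 'x list \<Rightarrow> 'x list \<Rightarrow> bool" where
  "distinguishable K u v \<longleftrightarrow> (\<exists>z. (u @ z \<in> K) \<noteq> (v @ z \<in> K))"

lemma card_distinguishable_le_states:
  assumes B: "complete_dfa \<Sigma> k B" and W: "W \<subseteq> lists (\<Sigma> \<times> Gam k)"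
    and dist: "pairwise (distinguishable (sym_lang B)) W"
  shows "card W \<le> card (states B)"
proof -
  obtain \<rho> where \<rho>: "\<And>u. u \<in> lists (\<Sigma> \<times> Gam k) \<Longrightarrow> \<rho> u \<in> states B"
    "right_invariant (\<Sigma> \<times> Gam k) \<rho>" "sym_lang B = {u \<in> lists (\<Sigma> \<times> Gam k). \<rho> u \<in> finals B}"
    using complete_dfa_reach[OF B] by blast
  have "inj_on \<rho> W"
  proof (rule inj_onI, rule ccontr)
    fix u v assume uv: "u \<in> W" "v \<in> W" "\<rho> u = \<rho> v" "u \<noteq> v"
    then obtain z where z: "(u @ z \<in> sym_lang B) \<noteq> (v @ z \<in> sym_lang B)"
      using dist unfolding pairwise_def distinguishable_def by blast
    have letters: "u \<in> lists (\<Sigma> \<times> Gam k)" "v \<in> lists (\<Sigma> \<times> Gam k)" using uv W by auto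
    then have "z \<in> lists (\<Sigma> \<times> Gam k)" using z \<rho>(3) by auto
    then show False using z right_invariant_append[OF \<rho>(2) letters _ uv(3)] letters \<rho>(3) by auto
  qed
  moreover have "\<rho> ` W \<subseteq> states B" using \<rho>(1) W by blast
  ultimately show ?thesis using complete_dfa_finite_states[OF B] by (rule card_inj_on_le)
qed

lemma short_completion:
  assumes B: "complete_dfa \<Sigma> k B" and vz: "v @ z \<in> sym_lang B"
  obtains z' where "v @ z' \<in> sym_lang B" "length z' < card (states B)"
proof -
  let ?Al = "\<Sigma> \<times> Gam k"
  obtain \<rho> where \<rho>: "\<And>u. u \<in> lists ?Al \<Longrightarrow> \<rho> u \<in> states B"
    "right_invariant ?Al \<rho>" "sym_lang B = {u \<in> lists ?Al. \<rho> u \<in> finals B}"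
    using complete_dfa_reach[OF B] by blast
  let ?f = "\<lambda>z. \<rho> (v @ z)"
  have letters: "v \<in> lists ?Al" "z \<in> lists ?Al" using vz \<rho>(3) by auto
  have "right_invariant ?Al ?f"
    unfolding right_invariant_def
  proof (intro ballI impI)
    fix z z' x assume "z \<in> lists ?Al" "z' \<in> lists ?Al" "x \<in> ?Al" "\<rho> (v @ z) = \<rho> (v @ z')"
    then show "\<rho> (v @ z @ [x]) = \<rho> (v @ z' @ [x])"
      using right_invariant_append[OF \<rho>(2), of "v @ z" "v @ z'" "[x]"] letters by simp
  qed
  moreover have range: "?f ` lists ?Al \<subseteq> states B"
    by (intro image_subsetI \<rho>(1)) (use letters in simp)
  moreover have fin: "finite (states B)" by (rule complete_dfa_finite_states[OF B])
  moreover have "recognizes ?Al ?f {z. v @ z \<in> sym_lang B}"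
    using letters by (simp add: recognizes_def \<rho>(3))
  ultimately obtain z' where "v @ z' \<in> sym_lang B" "length z' < card (?f ` lists ?Al)"
    using recognized_short_member[of ?Al ?f "{z. v @ z \<in> sym_lang B}" z] letters(2) vz
    by (metis finite_subset mem_Collect_eq)
  then show thesis using that card_mono[OF fin range] by fastforce
qed

section \<open>Regularity of the set of normal forms\<close>

definition nf_state :: "nat \<Rightarrow> ('a \<times> reg_op) list \<Rightarrow> (nat set \<times> nat set) option" where
  "nf_state k u = (if normal_prefix u
     then Some ({q \<in> {1..k}. binding u q \<noteq> None}, set (obligations u)) else None)"

lemma nf_state_eqD:
  assumes "nf_state k u = nf_state k v"
  shows "normal_prefix u \<longleftrightarrow> normal_prefix v" "normal_form u \<longleftrightarrow> normal_form v"
  using assms by (auto simp: nf_state_def normal_form_def split: if_splits)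

lemma nf_state_eq_SomeD:
  assumes "nf_state k u = nf_state k v" "normal_prefix u"
  shows "q \<in> {1..k} \<Longrightarrow> binding u q = None \<longleftrightarrow> binding v q = None"
    "set (obligations u) = set (obligations v)"
proof -
  have "{q \<in> {1..k}. binding u q \<noteq> None} = {q \<in> {1..k}. binding v q \<noteq> None}"
    and "set (obligations u) = set (obligations v)"
    using assms by (auto simp: nf_state_def split: if_splits)
  then show "q \<in> {1..k} \<Longrightarrow> binding u q = None \<longleftrightarrow> binding v q = None"
    "set (obligations u) = set (obligations v)"
    by blast+
qed

lemma normal_step_cong:
  assumes "nf_state k u = nf_state k v" "normal_prefix u" "\<pi> \<in> Gam k"
  shows "normal_step u \<pi> \<longleftrightarrow> normal_step v \<pi>"
  using nf_state_eq_SomeD[OF assms(1,2)] assms(3) by (cases \<pi>) (auto simp: Gam_def)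

lemma right_invariant_nf_state: "right_invariant (\<Sigma> \<times> Gam k) (nf_state k)"
  unfolding right_invariant_def
proof (intro ballI impI)
  fix u v :: "('a \<times> reg_op) list" and x
  assume same: "nf_state k u = nf_state k v" and x: "x \<in> \<Sigma> \<times> Gam k"
  show "nf_state k (u @ [x]) = nf_state k (v @ [x])"
  proof (cases "normal_prefix u")
    case True
    note state = nf_state_eq_SomeD[OF same True]
    have "normal_step u (snd x) \<longleftrightarrow> normal_step v (snd x)"
      using normal_step_cong[OF same True] x by auto
    moreover have "{q \<in> {1..k}. binding (u @ [x]) q \<noteq> None} =
        {q \<in> {1..k}. binding (v @ [x]) q \<noteq> None}"
      by (intro Collect_cong conj_cong refl) (simp add: state(1) del: not_None_eq)
    moreover have "set (obligations (u @ [x])) = set (obligations (v @ [x]))"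
      using state(2) by auto
    ultimately show ?thesis
      using nf_state_eqD(1)[OF same] True
      by (simp add: nf_state_def del: obligations_snoc binding_snoc)
  next
    case False
    then show ?thesis using nf_state_eqD(1)[OF same] by (simp add: nf_state_def)
  qed
qed



lemma obligations_subset: "u \<in> lists (\<Sigma> \<times> Gam k) \<Longrightarrow> set (obligations u) \<subseteq> {1..k}"
  by (induction u rule: rev_induct) (auto simp: Gam_def)

lemma nf_state_range:
  "nf_state k ` lists (\<Sigma> \<times> Gam k) \<subseteq> insert None (Some ` (Pow {1..k} \<times> Pow {1..k}))"
  using obligations_subset by (fastforce simp: nf_state_def)

lemma finite_nf_state_range: "finite (nf_state k ` lists (\<Sigma> \<times> Gam k))"
  by (rule finite_subset[OF nf_state_range]) simp

lemma card_nf_state_range: "card (nf_state k ` lists (\<Sigma> \<times> Gam k)) \<le> Suc (4 ^ k)"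
proof -
  have "card (nf_state k ` lists (\<Sigma> \<times> Gam k)) \<le>
      card (insert None (Some ` (Pow {1..k} \<times> Pow {1..k})))"
    by (rule card_mono[OF _ nf_state_range]) simp
  also have "\<dots> = Suc (card (Pow {1..k} \<times> Pow {1..k}))"
    by (subst card_insert_disjoint) (auto simp: card_image)
  also have "card (Pow {1..k} \<times> Pow {1..k}) = 2 ^ k * 2 ^ k"
    by (simp only: card_cartesian_product card_Pow finite_atLeastAtMost card_atLeastAtMost) simp
  also have "(2 :: nat) ^ k * 2 ^ k = 4 ^ k" by (simp flip: power_mult_distrib)
  finally show ?thesis .
qed

lemma sym_path_letters:
  assumes "session_automaton \<Sigma> A"
  shows "sym_path A s z t \<Longrightarrow> z \<in> lists (\<Sigma> \<times> Gam (registers A))"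
  using assms by (induction z arbitrary: s) (fastforce simp: session_automaton_def)+

lemma sym_path_states:
  assumes "session_automaton \<Sigma> A"
  shows "sym_path A s z t \<Longrightarrow> s \<in> states A \<Longrightarrow> t \<in> states A"
  using assms by (induction z arbitrary: s) (fastforce simp: session_automaton_def)+

lemma sym_lang_letters:
  "session_automaton \<Sigma> A \<Longrightarrow> z \<in> sym_lang A \<Longrightarrow> z \<in> lists (\<Sigma> \<times> Gam (registers A))"
  unfolding sym_lang_def mem_Collect_eq by (elim bexE) (rule sym_path_letters)

lemma snf_data_lang_iff:
  fixes \<Sigma> :: "'a set" and D :: "'d set"
  assumes "infinite D" "session_automaton \<Sigma> A"
  shows "u \<in> snf ` data_lang \<Sigma> D A \<longleftrightarrow>
    normal_form u \<and> (\<exists>z\<in>sym_lang A. well_formed z \<and> denotation z = denotation u)"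
proof
  assume "u \<in> snf ` data_lang \<Sigma> D A"
  then show "normal_form u \<and> (\<exists>z\<in>sym_lang A. well_formed z \<and> denotation z = denotation u)"
    by (auto simp: data_lang_iff normal_form_snf denotation_snf)
next
  assume "normal_form u \<and> (\<exists>z\<in>sym_lang A. well_formed z \<and> denotation z = denotation u)"
  then obtain z where u: "normal_form u"
    and z: "z \<in> sym_lang A" "well_formed z" "denotation z = denotation u" by blast
  obtain \<nu> :: "nat \<Rightarrow> 'd" where \<nu>: "inj \<nu>" "range \<nu> \<subseteq> D"
    using infinite_countable_subset[OF assms(1)] by blast
  define w where "w = map (map_prod id \<nu>) (denotation u)"
  have pat: "pattern w = denotation u"
    unfolding w_def pattern_map_prod[OF \<nu>(1)]
    by (simp add: pattern_denotation[OF normal_form_imp_well_formed[OF u]])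
  have "fst x \<in> \<Sigma>" if "x \<in> set (denotation u)" for x
  proof -
    have "fst x \<in> fst ` set z"
      using that map_fst_denotation[of z] z(3) by (metis imageI list.set_map)
    then show ?thesis using sym_lang_letters[OF assms(2) z(1)] by auto
  qed
  then have "w \<in> lists (\<Sigma> \<times> D)" using \<nu>(2) by (auto simp: w_def image_subset_iff mem_Times_iff)
  then have "w \<in> data_lang \<Sigma> D A" using z pat by (auto simp: data_lang_iff)
  moreover have "u = snf w" using u pat by (simp add: eq_snf_iff)
  ultimately show "u \<in> snf ` data_lang \<Sigma> D A" by blast
qed

text \<open>
  Besides the normal form \<open>u\<close>, the automaton also tracks the runs of \<open>A\<close> on the data word of \<open>u\<close>,
  each with the set of pairs of registers, one of \<open>A\<close> and one of \<open>u\<close>, that hold the same value.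
\<close>

definition shared_registers ::
  "nat \<Rightarrow> nat \<Rightarrow> ('a \<times> reg_op) list \<Rightarrow> ('a \<times> reg_op) list \<Rightarrow> (nat \<times> nat) set" where
  "shared_registers l k z u =
     {(p, q) \<in> {1..l} \<times> {1..k}. binding z p \<noteq> None \<and> binding z p = binding u q}"

definition runs ::
  "('s, 'a) session_automaton \<Rightarrow> nat \<Rightarrow> ('a \<times> reg_op) list \<Rightarrow> ('s \<times> (nat \<times> nat) set) set" where
  "runs A k u = {(s, shared_registers (registers A) k z u) | s z.
     sym_path A (initial A) z s \<and> well_formed z \<and> denotation z = denotation u}"

definition update_shared :: "reg_op \<Rightarrow> reg_op \<Rightarrow> (nat \<times> nat) set \<Rightarrow> (nat \<times> nat) set" where
  "update_shared \<rho> \<pi> E = (if is_Fresh \<pi>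
     then insert (reg \<rho>, reg \<pi>) {(p, q) \<in> E. p \<noteq> reg \<rho> \<and> q \<noteq> reg \<pi>} else E)"

lemma shared_registers_snoc:
  assumes "length z = length u" "is_Fresh \<rho> \<longleftrightarrow> is_Fresh \<pi>" "\<rho> \<in> Gam l" "\<pi> \<in> Gam k"
  shows "shared_registers l k (z @ [(a, \<rho>)]) (u @ [(b, \<pi>)]) =
    update_shared \<rho> \<pi> (shared_registers l k z u)"
proof (cases \<pi>)
  case (Fresh q)
  then obtain p where \<rho>: "\<rho> = Fresh p" using assms(2) by (cases \<rho>) auto
  have "binding z p' \<noteq> Some (length u)" "Some (length u) \<noteq> binding u q'" for p' q'
    using binding_SomeD(1) assms(1) by (metis less_irrefl)+
  then have "(p', q') \<in> shared_registers l k (z @ [(a, \<rho>)]) (u @ [(b, \<pi>)]) \<longleftrightarrow>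
      (p', q') \<in> update_shared \<rho> \<pi> (shared_registers l k z u)" for p' q'
    using assms Fresh \<rho>
    by (cases "p' = p"; cases "q' = q")
      (auto simp: shared_registers_def update_shared_def Gam_def)
  then show ?thesis by auto
next
  case (Reuse q)
  then obtain p where "\<rho> = Reuse p" using assms(2) by (cases \<rho>) auto
  with Reuse show ?thesis by (simp add: shared_registers_def update_shared_def)
qed

lemma same_value_iff:
  assumes "length z = length u" "bound u \<pi>" "\<rho> \<in> Gam l" "\<pi> \<in> Gam k"
  shows "bound z \<rho> \<and> denoted_value z \<rho> = denoted_value u \<pi> \<longleftrightarrow>
    (is_Fresh \<rho> \<longleftrightarrow> is_Fresh \<pi>) \<and> (is_Fresh \<pi> \<or> (reg \<rho>, reg \<pi>) \<in> shared_registers l k z u)"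
  using assms binding_SomeD(1)[of z "reg \<rho>"] binding_SomeD(1)[of u "reg \<pi>"]
  by (cases \<rho>; cases \<pi>) (auto simp: shared_registers_def Gam_def)

lemma transition_registers:
  "session_automaton \<Sigma> A \<Longrightarrow> (s, (a, \<rho>), s') \<in> transitions A \<Longrightarrow> \<rho> \<in> Gam (registers A)"
  by (auto simp: session_automaton_def)

definition moves :: "('s, 'a) session_automaton \<Rightarrow> 'a \<Rightarrow> reg_op \<Rightarrow> ('s \<times> (nat \<times> nat) set) set \<Rightarrow>
    ('s \<times> (nat \<times> nat) set) set" where
  "moves A a \<pi> R = {(s', update_shared \<rho> \<pi> E) | s' \<rho> E.
     \<exists>s. (s, E) \<in> R \<and> (s, (a, \<rho>), s') \<in> transitions A \<and>
       (is_Fresh \<rho> \<longleftrightarrow> is_Fresh \<pi>) \<and> (is_Fresh \<pi> \<or> (reg \<rho>, reg \<pi>) \<in> E)}"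

lemma runs_snoc_subset:
  assumes A: "session_automaton \<Sigma> A" and \<pi>: "bound u \<pi>" "\<pi> \<in> Gam k"
  shows "runs A k (u @ [(a, \<pi>)]) \<subseteq> moves A a \<pi> (runs A k u)"
proof
  let ?l = "registers A"
  fix y assume "y \<in> runs A k (u @ [(a, \<pi>)])"
  then obtain z' s' where y: "y = (s', shared_registers ?l k z' (u @ [(a, \<pi>)]))"
    and z': "sym_path A (initial A) z' s'" "well_formed z'"
      "denotation z' = denotation (u @ [(a, \<pi>)])"
    by (auto simp: runs_def)
  have "length z' = Suc (length u)" using denotation_eq_length[OF z'(3)] by simp
  then obtain z b \<rho> where split: "z' = z @ [(b, \<rho>)]" by (cases z' rule: rev_cases) auto
  obtain s where s: "sym_path A (initial A) z s" "(s, (b, \<rho>), s') \<in> transitions A"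
    using z'(1) by (auto simp: split sym_path_append)
  note \<rho> = transition_registers[OF A s(2)]
  have denote: "denotation z = denotation u" "b = a" "denoted_value z \<rho> = denoted_value u \<pi>"
    using z'(3) by (auto simp: split)
  note len = denotation_eq_length[OF denote(1)]
  have wf: "well_formed z" "bound z \<rho>" using z'(2) by (simp_all add: split)
  have kind: "is_Fresh \<rho> \<longleftrightarrow> is_Fresh \<pi>" "is_Fresh \<pi> \<or> (reg \<rho>, reg \<pi>) \<in> shared_registers ?l k z u"
    using same_value_iff[OF len \<pi>(1) \<rho> \<pi>(2)] wf(2) denote(3) by blast+
  have "(s, shared_registers ?l k z u) \<in> runs A k u"
    using s(1) wf(1) denote(1) unfolding runs_def by blast
  then show "y \<in> moves A a \<pi> (runs A k u)"
    using s(2) denote(2) kind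
    unfolding y split shared_registers_snoc[OF len kind(1) \<rho> \<pi>(2)] moves_def by blast
qed

lemma moves_subset_runs_snoc:
  assumes A: "session_automaton \<Sigma> A" and \<pi>: "bound u \<pi>" "\<pi> \<in> Gam k"
  shows "moves A a \<pi> (runs A k u) \<subseteq> runs A k (u @ [(a, \<pi>)])"
proof
  let ?l = "registers A"
  fix y assume "y \<in> moves A a \<pi> (runs A k u)"
  then obtain s s' \<rho> z where y: "y = (s', update_shared \<rho> \<pi> (shared_registers ?l k z u))"
    and z: "sym_path A (initial A) z s" "well_formed z" "denotation z = denotation u"
    and s': "(s, (a, \<rho>), s') \<in> transitions A"
    and kind: "is_Fresh \<rho> \<longleftrightarrow> is_Fresh \<pi>" "is_Fresh \<pi> \<or> (reg \<rho>, reg \<pi>) \<in> shared_registers ?l k z u"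
    by (auto simp: moves_def runs_def)
  note len = denotation_eq_length[OF z(3)] and \<rho> = transition_registers[OF A s']
  have "bound z \<rho>" "denoted_value z \<rho> = denoted_value u \<pi>"
    using same_value_iff[OF len \<pi>(1) \<rho> \<pi>(2)] kind by blast+
  then have "well_formed (z @ [(a, \<rho>)])" "denotation (z @ [(a, \<rho>)]) = denotation (u @ [(a, \<pi>)])"
    "sym_path A (initial A) (z @ [(a, \<rho>)]) s'"
    using z s' by (auto simp: sym_path_append)
  then show "y \<in> runs A k (u @ [(a, \<pi>)])"
    unfolding y runs_def shared_registers_snoc[OF len kind(1) \<rho> \<pi>(2), of a a, symmetric] by blast
qed

lemma runs_snoc:
  assumes "session_automaton \<Sigma> A" "bound u \<pi>" "\<pi> \<in> Gam k"
  shows "runs A k (u @ [(a, \<pi>)]) = moves A a \<pi> (runs A k u)"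
  using runs_snoc_subset[OF assms] moves_subset_runs_snoc[OF assms] by (rule subset_antisym)

definition run_state ::
  "('s, 'a) session_automaton \<Rightarrow> nat \<Rightarrow> ('a \<times> reg_op) list \<Rightarrow>
    (nat set \<times> nat set) option \<times> ('s \<times> (nat \<times> nat) set) set" where
  "run_state A k u = (nf_state k u, if normal_prefix u then runs A k u else {})"

lemma right_invariant_run_state:
  assumes A: "session_automaton \<Sigma> A"
  shows "right_invariant (\<Sigma> \<times> Gam k) (run_state A k)"
  unfolding right_invariant_def
proof (intro ballI impI)
  fix u v x
  assume uv: "u \<in> lists (\<Sigma> \<times> Gam k)" "v \<in> lists (\<Sigma> \<times> Gam k)" and x: "x \<in> \<Sigma> \<times> Gam k"
    and same: "run_state A k u = run_state A k v"
  obtain a \<pi> where [simp]: "x = (a, \<pi>)" by (cases x)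
  have "nf_state k u = nf_state k v" using same by (simp add: run_state_def)
  then have nf: "nf_state k (u @ [x]) = nf_state k (v @ [x])"
    using right_invariant_nf_state uv x unfolding right_invariant_def by blast
  have "runs A k (u @ [x]) = runs A k (v @ [x])"
    if "normal_prefix (u @ [x])" "normal_prefix (v @ [x])"
  proof -
    have "bound u \<pi>" "bound v \<pi>" "\<pi> \<in> Gam k" using that x normal_step_imp_bound by auto
    moreover have "runs A k u = runs A k v" using same that by (simp add: run_state_def)
    ultimately show ?thesis by (simp add: runs_snoc[OF A])
  qed
  then show "run_state A k (u @ [x]) = run_state A k (v @ [x])"
    using nf nf_state_eqD(1)[OF nf] by (simp add: run_state_def del: normal_prefix_snoc)
qed

lemma finite_run_state_range:
  assumes A: "session_automaton \<Sigma> A"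
  shows "finite (run_state A k ` lists (\<Sigma> \<times> Gam k))"
proof (rule finite_subset)
  let ?R = "states A \<times> Pow ({1..registers A} \<times> {1..k})"
  have "runs A k u \<subseteq> ?R" for u
    using sym_path_states[OF A] A
    by (auto simp: runs_def shared_registers_def session_automaton_def)
  then show "run_state A k ` lists (\<Sigma> \<times> Gam k) \<subseteq> nf_state k ` lists (\<Sigma> \<times> Gam k) \<times> Pow ?R"
    unfolding run_state_def by (intro image_subsetI SigmaI imageI) (simp_all split: if_split)
  show "finite (nf_state k ` lists (\<Sigma> \<times> Gam k) \<times> Pow ?R)"
    using finite_nf_state_range A by (auto simp: session_automaton_def)
qed

lemma recognizes_snf_data_lang:
  assumes "infinite D" and A: "session_automaton \<Sigma> A"
  shows "recognizes Al (run_state A k) (snf ` data_lang \<Sigma> D A)"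
  unfolding recognizes_def snf_data_lang_iff[OF assms]
proof (intro ballI impI conjI)
  fix u v
  assume same: "run_state A k u = run_state A k v"
    and u: "normal_form u \<and> (\<exists>z\<in>sym_lang A. well_formed z \<and> denotation z = denotation u)"
  show "normal_form v" using u same nf_state_eqD(2)[of k u v] by (simp add: run_state_def)
  then have "runs A k u = runs A k v" using u same by (simp add: run_state_def normal_form_def)
  moreover obtain z t where "sym_path A (initial A) z t" "t \<in> finals A"
    "well_formed z" "denotation z = denotation u"
    using u by (auto simp: sym_lang_def)
  moreover from this have "(t, shared_registers (registers A) k z u) \<in> runs A k u"
    by (auto simp: runs_def)
  ultimately show "\<exists>z\<in>sym_lang A. well_formed z \<and> denotation z = denotation v"
    by (auto simp: runs_def sym_lang_def)
qed

lemma snf_data_lang_regular: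
  assumes "finite \<Sigma>" "infinite D" "session_automaton \<Sigma> A"
    and "snf ` data_lang \<Sigma> D A \<subseteq> lists (\<Sigma> \<times> Gam k)"
  obtains B :: "(nat, 'a) session_automaton"
    where "complete_dfa \<Sigma> k B" "sym_lang B = snf ` data_lang \<Sigma> D A"
  by (rule complete_dfa_exists[OF assms(1) right_invariant_run_state[OF assms(3)]
        finite_run_state_range[OF assms(3)] assms(4) recognizes_snf_data_lang[OF assms(2,3)]])

section \<open>The number of registers\<close>

lemma normal_form_register_opened:
  assumes "normal_form u" "x \<in> set u"
  obtains i where "i < length u" "snd (u ! i) = Fresh (reg (snd x))" "1 \<le> reg (snd x)"
proof -
  obtain j where j: "j < length u" "u ! j = x" using assms(2) by (auto simp: in_set_conv_nth)
  have "\<exists>i<length u. snd (u ! i) = Fresh (reg (snd x))"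
  proof (cases "snd x")
    case (Fresh r) then show ?thesis using j by auto
  next
    case (Reuse r)
    then have "bound (take j u) (Reuse r)"
      using well_formedD[OF normal_form_imp_well_formed[OF assms(1)] j(1)] j(2) by simp
    then obtain i where "binding (take j u) r = Some i" by auto
    from binding_SomeD[OF this] show ?thesis using j Reuse by (intro exI[of _ i]) auto
  qed
  then obtain i where i: "i < length u" "snd (u ! i) = Fresh (reg (snd x))" by blast
  then have "normal_step (take i u) (Fresh (reg (snd x)))"
    using normal_formD[OF assms(1)] by metis
  then show thesis using i that by simp
qed

lemma normal_form_register_held:
  assumes nf: "normal_form u" and z: "well_formed z" "denotation z = denotation u"
    and i: "i < length u" "snd (u ! i) = Fresh r" and q: "1 \<le> q" "q \<le> r"
  obtains c p where "binding (take (Suc i) u) q = Some c" "binding (take (Suc i) z) p = Some c"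
    "p \<in> reg ` snd ` set z"
proof -
  note len = denotation_eq_length[OF z(2)]
  have u_Suc: "take (Suc i) u = take i u @ [u ! i]" using i by (simp add: take_Suc_conv_app_nth)
  show thesis
  proof (cases "q = r")
    case True
    have "denoted_value (take i z) (snd (z ! i)) = denoted_value (take i u) (snd (u ! i))"
      using z(2) i(1) len nth_denotation by (metis snd_conv)
    then have "is_Fresh (snd (z ! i))"
      using denoted_value_eq_length_iff[OF well_formedD[OF z(1), of i]] i len by simp
    then have "binding (take (Suc i) z) (reg (snd (z ! i))) = Some i"
      using i(1) len by (simp add: take_Suc_conv_app_nth)
    moreover have "binding (take (Suc i) u) q = Some i" using i True by (simp add: u_Suc)
    ultimately show thesis using that i(1) len by simp
  next
    case False
    then have "q < r" using q(2) by simp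
    then obtain c j where c: "binding (take i u) q = Some c"
      and j: "i < j" "j < length z" "snd (denotation z ! j) = c"
      using normal_form_smaller_register_recurs[OF nf i q(1)] z(2) len by metis
    have "c < Suc i" using binding_SomeD(1)[OF c] by simp
    then obtain p where p: "Reuse p = snd (z ! j)" "binding (take (Suc i) z) p = Some c"
      using held_until_reused[OF z(1) j(2,3), of "Suc i"] j(1) by (metis Suc_leI)
    have "p \<in> reg ` snd ` set z" using j(2) p(1) by (metis image_eqI nth_mem reg_op.sel(2))
    moreover have "binding (take (Suc i) u) q = Some c" using c i(2) False by (simp add: u_Suc)
    ultimately show thesis using that p(2) by blast
  qed
qed

lemma normal_form_registers_le:
  assumes nf: "normal_form u" and z: "well_formed z" "denotation z = denotation u"
    and registers: "z \<in> lists (\<Sigma> \<times> Gam k)" and i: "i < length u" "snd (u ! i) = Fresh r"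
  shows "r \<le> k"
proof -
  have "\<exists>p c. p \<in> reg ` snd ` set z \<and> binding (take (Suc i) u) q = Some c \<and>
      binding (take (Suc i) z) p = Some c" if "q \<in> {1..r}" for q
    using normal_form_register_held[OF nf z i, of q] that by (metis atLeastAtMost_iff)
  then obtain h c where h: "\<And>q. q \<in> {1..r} \<Longrightarrow> h q \<in> reg ` snd ` set z \<and>
      binding (take (Suc i) u) q = Some (c q) \<and> binding (take (Suc i) z) (h q) = Some (c q)"
    by metis
  have "inj_on h {1..r}" by (rule inj_onI) (metis h binding_inj option.inject)
  moreover have "reg ` snd ` set z \<subseteq> {1..k}" using registers by (auto simp: Gam_def)
  then have "h ` {1..r} \<subseteq> {1..k}" using h by blast
  ultimately have "card {1..r} \<le> card {1..k}" by (rule card_inj_on_le) simp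
  then show ?thesis by simp
qed

lemma snf_data_lang_registers:
  assumes "infinite D" and A: "session_automaton \<Sigma> A"
  shows "snf ` data_lang \<Sigma> D A \<subseteq> lists (\<Sigma> \<times> Gam (registers A))"
proof
  fix u assume "u \<in> snf ` data_lang \<Sigma> D A"
  then obtain z where nf: "normal_form u"
    and z: "z \<in> sym_lang A" "well_formed z" "denotation z = denotation u"
    unfolding snf_data_lang_iff[OF assms] by blast
  have letters: "z \<in> lists (\<Sigma> \<times> Gam (registers A))" by (rule sym_lang_letters[OF A z(1)])
  have "fst ` set u = fst ` set z" using denotation_eq_map_fst[OF z(3)] by (metis list.set_map)
  then have "fst ` set u \<subseteq> \<Sigma>" using letters by auto
  moreover have "snd x \<in> Gam (registers A)" if x: "x \<in> set u" for x
  proof -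
    obtain i where i: "i < length u" "snd (u ! i) = Fresh (reg (snd x))" "1 \<le> reg (snd x)"
      using normal_form_register_opened[OF nf x] by blast
    with normal_form_registers_le[OF nf z(2,3) letters i(1,2)] show ?thesis
      by (simp add: Gam_def)
  qed
  ultimately show "u \<in> lists (\<Sigma> \<times> Gam (registers A))" by (auto simp: mem_Times_iff)
qed

lemma snf_registers_subset:
  assumes "infinite D" "session_automaton \<Sigma> A"
  defines "L \<equiv> data_lang \<Sigma> D A"
  shows "snf ` L \<subseteq> lists (\<Sigma> \<times> Gam (snf_registers \<Sigma> L))"
  unfolding snf_registers_def L_def
  by (rule LeastI[where P = "\<lambda>k. snf ` data_lang \<Sigma> D A \<subseteq> lists (\<Sigma> \<times> Gam k)"])
    (rule snf_data_lang_registers[OF assms(1,2)])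

lemma snf_registers_attained:
  assumes sub: "snf ` L \<subseteq> lists (\<Sigma> \<times> Gam (snf_registers \<Sigma> L))" and "snf_registers \<Sigma> L \<noteq> 0"
  obtains u i where "u \<in> snf ` L" "i < length u" "snd (u ! i) = Fresh (snf_registers \<Sigma> L)"
proof -
  let ?k = "snf_registers \<Sigma> L"
  have "\<not> snf ` L \<subseteq> lists (\<Sigma> \<times> Gam (?k - 1))"
    using not_less_Least[of "?k - 1" "\<lambda>k. snf ` L \<subseteq> lists (\<Sigma> \<times> Gam k)"] assms(2)
    by (simp add: snf_registers_def)
  then obtain u x where u: "u \<in> snf ` L" "x \<in> set u" "x \<notin> \<Sigma> \<times> Gam (?k - 1)" by blast
  then have "x \<in> \<Sigma> \<times> Gam ?k" using sub by blast
  with u(3) assms(2) have "reg (snd x) = ?k" by (auto simp: Gam_def)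
  moreover have "normal_form u" using u(1) normal_form_snf by blast
  ultimately show thesis using normal_form_register_opened[OF _ u(2)] that[OF u(1)] by metis
qed

lemma obligation_in_completion:
  assumes "normal_form (v @ z)" "q \<in> set (obligations v)"
  shows "Reuse q \<in> snd ` set z"
proof -
  obtain z1 a z2 where "z = z1 @ (a, Reuse q) # z2"
    using obligation_discharged[of v z q] assms by (auto simp: normal_form_def)
  then show ?thesis by force
qed

lemma snf_registers_le_states:
  assumes sub: "snf ` L \<subseteq> lists (\<Sigma> \<times> Gam (snf_registers \<Sigma> L))"
    and B: "complete_dfa \<Sigma> (snf_registers \<Sigma> L) B" "sym_lang B = snf ` L"
  shows "snf_registers \<Sigma> L \<le> card (states B)"
proof (cases "snf_registers \<Sigma> L = 0")
  case False
  let ?k = "snf_registers \<Sigma> L"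
  obtain u i where u: "u \<in> snf ` L" and i: "i < length u" "snd (u ! i) = Fresh ?k"
    using snf_registers_attained[OF sub False] by blast
  let ?v = "take (Suc i) u"
  have "?v @ drop (Suc i) u \<in> sym_lang B" using u B(2) by simp
  then obtain z where z: "?v @ z \<in> sym_lang B" "length z < card (states B)"
    by (rule short_completion[OF B(1)])
  have "normal_form (?v @ z)" using z(1) B(2) normal_form_snf by auto
  moreover have "{1..<?k} \<subseteq> set (obligations ?v)" using i by (simp add: take_Suc_conv_app_nth)
  ultimately have "Reuse ` {1..<?k} \<subseteq> snd ` set z" using obligation_in_completion by blast
  then have "card (Reuse ` {1..<?k}) \<le> card (snd ` set z)" by (intro card_mono) auto
  also have "\<dots> \<le> length z" by (meson card_image_le card_length finite_set le_trans)
  also have "card (Reuse ` {1..<?k}) = ?k - 1" by (subst card_image) (auto simp: inj_on_def)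
  finally show ?thesis using z(2) by simp
qed simp

section \<open>The learner\<close>

type_synonym sword = "(nat \<times> reg_op) list"

text \<open>
  The prefixes are the access words of the states of the hypothesis.
\<close>

datatype table =
  Table (regs: nat) (prefixes: "sword list") (suffixes: "sword list")
    (answers: "(sword \<times> bool) list")

text \<open>
  \<open>Searching u lo hi\<close> is a binary search for a position of the counterexample \<open>u\<close> at which the
  hypothesis goes wrong.
\<close>

datatype phase = Exploring | Searching sword nat nat | Finished

type_synonym learner_state = "table \<times> phase"

locale alphabet =
  fixes n :: nat
begin

abbreviation symbols :: "nat \<Rightarrow> (nat \<times> reg_op) set" where
  "symbols k \<equiv> {..<n} \<times> Gam k"

definition letters :: "nat \<Rightarrow> (nat \<times> reg_op) list" where
  "letters k =
     concat (map (\<lambda>a. concat (map (\<lambda>r. [(a, Fresh r), (a, Reuse r)]) [1..<Suc k])) [0..<n])"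

definition words :: "nat \<Rightarrow> nat \<Rightarrow> sword list" where
  "words k m = ((\<lambda>W. [] # concat (map (\<lambda>x. map (\<lambda>w. x # w) W) (letters k))) ^^ m) [[]]"

definition normal_form_of :: "(nat \<times> nat) list \<Rightarrow> sword option" where
  "normal_form_of p =
     List.find (\<lambda>u. normal_form u \<and> denotation u = p) (words (length p) (length p))"

definition normalize :: "(nat \<times> nat) list \<Rightarrow> sword" where
  "normalize p = (case normal_form_of p of None \<Rightarrow> [] | Some u \<Rightarrow> u)"

definition max_reg :: "sword \<Rightarrow> nat" where
  "max_reg u = fold (\<lambda>x m. max m (reg (snd x))) u 0"

definition positive :: "table \<Rightarrow> sword \<Rightarrow> bool" where
  "positive T u \<longleftrightarrow> (u, True) \<in> set (answers T)"

definition answered :: "table \<Rightarrow> sword \<Rightarrow> bool" where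
  "answered T u \<longleftrightarrow> u \<in> set (map fst (answers T))"

definition row :: "table \<Rightarrow> sword \<Rightarrow> bool list" where
  "row T u = map (\<lambda>e. positive T (u @ e)) (suffixes T)"

definition extensions :: "table \<Rightarrow> sword list" where
  "extensions T = concat (map (\<lambda>s. map (\<lambda>x. s @ [x]) (letters (regs T))) (prefixes T))"

text \<open>
  There are no cells if there are no registers: with \<open>k = 0\<close>, and no counterexample, the bound
  leaves no membership query.
\<close>

definition cells :: "table \<Rightarrow> sword list" where
  "cells T = concat (map (\<lambda>s. concat (map (\<lambda>x. concat (map (\<lambda>e. [s @ e, s @ x # e]) (suffixes T)))
     (letters (regs T)))) (prefixes T))"

definition missing_cell :: "table \<Rightarrow> sword option" where
  "missing_cell T = List.find (\<lambda>u. \<not> answered T u) (cells T)"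

definition unclosed_extension :: "table \<Rightarrow> sword option" where
  "unclosed_extension T =
     List.find (\<lambda>u. row T u \<notin> set (map (\<lambda>s. row T s) (prefixes T))) (extensions T)"

definition successor :: "table \<Rightarrow> nat \<Rightarrow> nat \<times> reg_op \<Rightarrow> nat" where
  "successor T i x = (case List.find (\<lambda>j. row T (nth_default [] (prefixes T) j) =
       row T (nth_default [] (prefixes T) i @ [x])) [0..<length (prefixes T)] of
     None \<Rightarrow> 0 | Some j \<Rightarrow> j)"

definition reached :: "table \<Rightarrow> sword \<Rightarrow> nat" where
  "reached T u = fold (\<lambda>x i. successor T i x) u 0"

definition access :: "table \<Rightarrow> sword \<Rightarrow> sword" where
  "access T u = nth_default [] (prefixes T) (reached T u)"

definition accepts :: "table \<Rightarrow> sword \<Rightarrow> bool" where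
  "accepts T u \<longleftrightarrow> positive T (access T u)"

text \<open>
  If the hypothesis accepts any word that is not in normal form, then it accepts such a word whose
  length is bounded by the product of the numbers of its states and of the states of an automaton
  for normal forms.
\<close>

definition abnormal_word :: "table \<Rightarrow> sword option" where
  "abnormal_word T = List.find (\<lambda>u. accepts T u \<and> \<not> normal_form u)
     (words (regs T) (length (prefixes T) * Suc (4 ^ regs T)))"

definition redirect :: "table \<Rightarrow> sword \<Rightarrow> nat \<Rightarrow> sword" where
  "redirect T u m = access T (take m u) @ drop m u"

text \<open>
  The query for the empty word is only a means to spend a step when there is nothing to be asked:
  its answer is ignored.
\<close>

definition query :: "learner_state \<Rightarrow> sword option" where
  "query = (\<lambda>(T, p). case p of
     Exploring \<Rightarrow> (case missing_cell T of
         None \<Rightarrow> if unclosed_extension T = None \<and> abnormal_word T = None then None else Some []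
       | Some u \<Rightarrow> Some u)
   | Searching u lo hi \<Rightarrow> Some (if hi \<le> Suc lo then [] else redirect T u ((lo + hi) div 2))
   | Finished \<Rightarrow> None)"

definition add_answer :: "sword \<Rightarrow> bool \<Rightarrow> table \<Rightarrow> table" where
  "add_answer u b T = Table (regs T) (prefixes T) (suffixes T) ((u, b) # answers T)"

definition add_prefix :: "sword \<Rightarrow> table \<Rightarrow> table" where
  "add_prefix s T = Table (regs T) (prefixes T @ [s]) (suffixes T) (answers T)"

definition add_suffix :: "sword \<Rightarrow> table \<Rightarrow> table" where
  "add_suffix e T = Table (regs T) (prefixes T) (suffixes T @ [e]) (answers T)"

definition set_regs :: "nat \<Rightarrow> table \<Rightarrow> table" where
  "set_regs k T = Table k (prefixes T) (suffixes T) (answers T)"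

definition explore :: "table \<Rightarrow> bool \<Rightarrow> learner_state" where
  "explore T b = (case missing_cell T of
     Some u \<Rightarrow> (add_answer u b T, Exploring)
   | None \<Rightarrow> (case unclosed_extension T of
       Some s \<Rightarrow> (add_prefix s T, Exploring)
     | None \<Rightarrow> (case abnormal_word T of
         Some v \<Rightarrow> (T, Searching v 0 (length v))
       | None \<Rightarrow> (T, Exploring))))"

definition split_state :: "sword \<Rightarrow> nat \<Rightarrow> table \<Rightarrow> table" where
  "split_state u lo T =
     add_suffix (drop (Suc lo) u) (add_prefix (access T (take lo u) @ take 1 (drop lo u)) T)"

definition search :: "table \<Rightarrow> sword \<Rightarrow> nat \<Rightarrow> nat \<Rightarrow> bool \<Rightarrow> learner_state" where
  "search T u lo hi b = (if hi \<le> Suc lo then (split_state u lo T, Exploring)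
     else if b = accepts T u then (T, Searching u lo ((lo + hi) div 2))
     else (T, Searching u ((lo + hi) div 2) hi))"

definition process_truth :: "learner_state \<Rightarrow> bool \<Rightarrow> learner_state" where
  "process_truth \<sigma> b = (case snd \<sigma> of
     Exploring \<Rightarrow> explore (fst \<sigma>) b
   | Searching u lo hi \<Rightarrow> search (fst \<sigma>) u lo hi b
   | Finished \<Rightarrow> \<sigma>)"

definition process_counterexample :: "table \<Rightarrow> sword \<Rightarrow> learner_state" where
  "process_counterexample T v = (if v = [] then (add_answer [] True T, Exploring)
     else if regs T < max_reg v then (set_regs (max_reg v) T, Exploring)
     else (T, Searching v 0 (length v)))"

definition respond :: "learner_state \<Rightarrow> (nat, nat) answer \<Rightarrow> learner_state" where
  "respond \<sigma> r = (case r of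
     Truth b \<Rightarrow> process_truth \<sigma> (b \<and> normal_form (the (query \<sigma>)))
   | Yes \<Rightarrow> (fst \<sigma>, Finished)
   | Counterexample p \<Rightarrow> process_counterexample (fst \<sigma>) (normalize p))"

definition init_state :: learner_state where
  "init_state = (Table 0 [[]] [[]] [], Exploring)"

definition hyp_transitions :: "table \<Rightarrow> (nat \<times> (nat \<times> reg_op) \<times> nat) list" where
  "hyp_transitions T = concat (map (\<lambda>i. map (\<lambda>x. (i, x, successor T i x)) (letters (regs T)))
     [0..<length (prefixes T)])"

definition hyp_finals :: "table \<Rightarrow> nat list" where
  "hyp_finals T = filter (\<lambda>i. positive T (nth_default [] (prefixes T) i)) [0..<length (prefixes T)]"

definition transition_code :: "nat \<times> (nat \<times> reg_op) \<times> nat \<Rightarrow> sexp" where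
  "transition_code = (\<lambda>(i, x, j). sexp_of [sexp_of i, sexp_of (fst x), sexp_of (snd x), sexp_of j])"

definition hyp_code :: "table \<Rightarrow> sexp" where
  "hyp_code T = sexp_of [sexp_of [0..<length (prefixes T)], sexp_of (regs T), sexp_of (0 :: nat),
     sexp_of (hyp_finals T), sexp_of (map transition_code (hyp_transitions T))]"

definition action_code :: "learner_state \<Rightarrow> sexp" where
  "action_code \<sigma> = (case query \<sigma> of
     Some u \<Rightarrow> Cell (enc_nat 0) (sexp_of (denotation u))
   | None \<Rightarrow> if snd \<sigma> = Finished then Cell (enc_nat 2) (hyp_code (fst \<sigma>))
       else Cell (enc_nat 1) (hyp_code (fst \<sigma>)))"

end

subsection \<open>Effectiveness of the learner\<close>

lemma effective_binding [THEN effective_comp2, effective_intros]: "effective (\<lambda>(u, r). binding u r)"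
proof -
  have "binding u r =
      List.find (\<lambda>j. snd (nth_default undefined u j) = Fresh r) (rev [0..<length u])"
    for u :: "('a \<times> reg_op) list" and r
    unfolding binding_def by (rule find_cong) (simp_all add: nth_default_nth)
  then show ?thesis by (simp only:) (intro effective_intros)
qed

lemma effective_denoted_value [THEN effective_comp2, effective_intros]:
  "effective (\<lambda>(u, \<pi>). denoted_value u \<pi>)"
  unfolding denoted_value_def by (intro effective_intros)

lemma effective_denotation [THEN effective_comp, effective_intros]: "effective (\<lambda>u. denotation u)"
proof -
  have "denotation u = map (\<lambda>i. (fst (nth_default undefined u i),
      denoted_value (take i u) (snd (nth_default undefined u i)))) [0..<length u]"
    for u :: "('a \<times> reg_op) list"
    by (simp add: denotation_def nth_default_nth)
  then show ?thesis by (simp only:) (intro effective_intros)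
qed

lemma effective_obligations [THEN effective_comp, effective_intros]: "effective (\<lambda>u. obligations u)"
  unfolding obligations_def by (intro effective_intros)

lemma effective_normal_step [THEN effective_comp2, effective_intros]:
  "effective (\<lambda>(u, \<pi>). normal_step u \<pi>)"
  unfolding normal_step_def by (intro effective_intros)

lemma effective_normal_form [THEN effective_comp, effective_intros]: "effective (\<lambda>u. normal_form u)"
proof -
  have "normal_form u \<longleftrightarrow> obligations u = [] \<and>
      (\<forall>i\<in>set [0..<length u]. normal_step (take i u) (snd (nth_default undefined u i)))"
    for u :: "('a \<times> reg_op) list"
    by (auto simp: normal_form_def normal_prefix_def stepwise_def nth_default_nth)
  then show ?thesis by (simp only:) (intro effective_intros)
qed

instantiation table :: encodable
begin
definition "sexp_of T = sexp_of (regs T, prefixes T, suffixes T, answers T)"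
instance by standard (auto simp: sexp_of_table_def sexp_of_inject table.expand)
end

fun phase_components :: "phase \<Rightarrow> nat \<times> sword \<times> nat \<times> nat" where
  "phase_components Exploring = (0, [], 0, 0)"
| "phase_components (Searching u lo hi) = (1, u, lo, hi)"
| "phase_components Finished = (2, [], 0, 0)"

instantiation phase :: encodable
begin
definition "sexp_of p = sexp_of (phase_components p)"
instance
proof
  fix p q :: phase
  show "sexp_of p = sexp_of q \<longleftrightarrow> p = q"
    unfolding sexp_of_phase_def sexp_of_inject by (cases p; cases q) auto
qed
end

lemma effective_table_selectors [THEN effective_comp, effective_intros]:
  "effective regs" "effective prefixes" "effective suffixes" "effective answers"
  by (rule effectiveI[of car] effectiveI[of "\<lambda>x. car (cdr x)"]
      effectiveI[of "\<lambda>x. car (cdr (cdr x))"] effectiveI[of "\<lambda>x. cdr (cdr (cdr x))"],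
      intro computable_intros computable.intros(3), simp add: sexp_of_table_def)+

lemma effective_Table [effective_intros]:
  assumes "effective k" "effective S" "effective E" "effective h"
  shows "effective (\<lambda>x. Table (k x) (S x) (E x) (h x))"
proof -
  have "effective (\<lambda>(k, S, E, h). Table k S E h)"
    by (rule effectiveI[of "\<lambda>x. x"]) (intro computable_intros, auto simp: sexp_of_table_def)
  moreover have "effective (\<lambda>x. (k x, S x, E x, h x))" by (intro effective_intros assms)
  ultimately show ?thesis using effective_comp by fastforce
qed

lemma effective_Searching [THEN effective_comp3, effective_intros]:
  "effective (\<lambda>(u, lo, hi). Searching u lo hi)"
  by (rule effectiveI[of "\<lambda>x. Cell (Cell Atom Atom) x"])
    (intro computable_intros, auto simp: sexp_of_phase_def)

lemma effective_case_phase [effective_intros]: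
  assumes "effective p" "effective f" "effective (\<lambda>(x, u, lo, hi). g x u lo hi)" "effective h"
  shows "effective
    (\<lambda>x. case p x of Exploring \<Rightarrow> f x | Searching u lo hi \<Rightarrow> g x u lo hi | Finished \<Rightarrow> h x)"
proof -
  have "effective phase_components"
    by (rule effectiveI[of "\<lambda>x. x"]) (intro computable_intros, simp add: sexp_of_phase_def)
  note components = effective_comp[OF this assms(1)]
  have "effective (\<lambda>x. case snd (phase_components (p x)) of (u, lo, hi) \<Rightarrow> g x u lo hi)"
    using effective_comp[OF assms(3) effective_Pair[OF effective_id effective_snd[OF components]]]
    by simp
  then have "effective (\<lambda>x. if fst (phase_components (p x)) = 0 then f x
      else if fst (phase_components (p x)) = 2 then h x
      else case snd (phase_components (p x)) of (u, lo, hi) \<Rightarrow> g x u lo hi)"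
    by (intro effective_if effective_eq effective_fst components effective_const assms)
  moreover have "(if fst (phase_components q) = 0 then f x
      else if fst (phase_components q) = 2 then h x
      else case snd (phase_components q) of (u, lo, hi) \<Rightarrow> g x u lo hi) =
    (case q of Exploring \<Rightarrow> f x | Searching u lo hi \<Rightarrow> g x u lo hi | Finished \<Rightarrow> h x)" for q x
    by (cases q) simp_all
  ultimately show ?thesis by simp
qed

context alphabet
begin

lemma effective_letters [THEN effective_comp, effective_intros]: "effective (\<lambda>k. letters k)"
  unfolding letters_def by (intro effective_intros)

lemma effective_words [THEN effective_comp2, effective_intros]: "effective (\<lambda>(k, m). words k m)"
  unfolding words_def by (intro effective_intros)

lemma effective_normalize [THEN effective_comp, effective_intros]: "effective (\<lambda>p. normalize p)"
  unfolding normalize_def normal_form_of_def by (intro effective_intros)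

lemma effective_max_reg [THEN effective_comp, effective_intros]: "effective (\<lambda>u. max_reg u)"
  unfolding max_reg_def max_def by (intro effective_intros)

lemma effective_positive [THEN effective_comp2, effective_intros]:
  "effective (\<lambda>(T, u). positive T u)"
  unfolding positive_def by (intro effective_intros)

lemma effective_answered [THEN effective_comp2, effective_intros]:
  "effective (\<lambda>(T, u). answered T u)"
  unfolding answered_def by (intro effective_intros)

lemma effective_row [THEN effective_comp2, effective_intros]: "effective (\<lambda>(T, u). row T u)"
  unfolding row_def by (intro effective_intros)

lemma effective_missing_cell [THEN effective_comp, effective_intros]:
  "effective (\<lambda>T. missing_cell T)"
  unfolding missing_cell_def cells_def by (intro effective_intros)

lemma effective_unclosed_extension [THEN effective_comp, effective_intros]:
  "effective (\<lambda>T. unclosed_extension T)"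
  unfolding unclosed_extension_def extensions_def by (intro effective_intros)

lemma effective_successor [THEN effective_comp3, effective_intros]:
  "effective (\<lambda>(T, i, x). successor T i x)"
  unfolding successor_def by (intro effective_intros)

lemma effective_access [THEN effective_comp2, effective_intros]: "effective (\<lambda>(T, u). access T u)"
  unfolding access_def reached_def by (intro effective_intros)

lemma effective_accepts [THEN effective_comp2, effective_intros]: "effective (\<lambda>(T, u). accepts T u)"
  unfolding accepts_def by (intro effective_intros)

lemma effective_abnormal_word [THEN effective_comp, effective_intros]:
  "effective (\<lambda>T. abnormal_word T)"
  unfolding abnormal_word_def by (intro effective_intros)

lemma effective_query [THEN effective_comp, effective_intros]: "effective (\<lambda>\<sigma>. query \<sigma>)"
  unfolding query_def redirect_def by (intro effective_intros)

lemma effective_explore [THEN effective_comp2, effective_intros]: "effective (\<lambda>(T, b). explore T b)"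
  unfolding explore_def add_answer_def add_prefix_def by (intro effective_intros)

lemma effective_process_truth [THEN effective_comp2, effective_intros]:
  "effective (\<lambda>(\<sigma>, b). process_truth \<sigma> b)"
  unfolding process_truth_def search_def split_state_def add_prefix_def add_suffix_def table.sel
  by (intro effective_intros)

lemma effective_process_counterexample [THEN effective_comp2, effective_intros]:
  "effective (\<lambda>(T, v). process_counterexample T v)"
  unfolding process_counterexample_def add_answer_def set_regs_def by (intro effective_intros)

lemma effective_respond [THEN effective_comp2, effective_intros]: "effective (\<lambda>(\<sigma>, r). respond \<sigma> r)"
  unfolding respond_def by (intro effective_intros)

lemma effective_hyp_code [THEN effective_comp, effective_intros]: "effective (\<lambda>T. hyp_code T)"
  unfolding hyp_code_def hyp_transitions_def hyp_finals_def transition_code_def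
  by (intro effective_intros)

lemma effective_learner: "effective (\<lambda>h. action_code (fold (\<lambda>r \<sigma>. respond \<sigma> r) h init_state))"
  unfolding action_code_def by (intro effective_intros)

end

section \<open>Invariants of the learner\<close>

lemma length_concat_map_const:
  "(\<And>x. length (h x) = c) \<Longrightarrow> length (concat (map h xs)) = length xs * c"
  by (induction xs) auto

lemma find_SomeD: "List.find P xs = Some x \<Longrightarrow> x \<in> set xs \<and> P x"
  by (auto simp: find_Some_iff)

context alphabet
begin

lemma set_letters: "set (letters k) = symbols k"
proof -
  have "x \<in> set (letters k) \<longleftrightarrow> x \<in> symbols k" for x
  proof (cases x)
    case (Pair a \<pi>)
    then show ?thesis by (cases \<pi>) (auto simp: letters_def Gam_def)
  qed
  then show ?thesis by blast
qed

lemma length_letters: "length (letters k) = 2 * n * k"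
proof -
  have per_letter:
    "length (concat (map (\<lambda>r. [(a, Fresh r), (a, Reuse r)]) [1..<Suc k])) = k * 2" for a :: nat
    by (subst length_concat_map_const[where c = 2]) simp_all
  show ?thesis
    by (simp only: letters_def length_concat_map_const[OF per_letter] length_upt) simp
qed

lemma set_words: "set (words k m) = {u \<in> lists (symbols k). length u \<le> m}"
proof (induction m)
  case 0 show ?case by (auto simp: words_def)
next
  case (Suc m)
  have "words k (Suc m) = [] # concat (map (\<lambda>x. map ((#) x) (words k m)) (letters k))"
    by (simp add: words_def)
  then have Suc_words: "set (words k (Suc m)) =
      insert [] {x # u | x u. x \<in> symbols k \<and> u \<in> set (words k m)}"
    by (auto simp: set_letters)
  have "v \<in> set (words k (Suc m)) \<longleftrightarrow> v \<in> {u \<in> lists (symbols k). length u \<le> Suc m}" for v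
    unfolding Suc_words Suc by (cases v) auto
  then show ?case by blast
qed

lemma max_reg_le_iff: "max_reg u \<le> m \<longleftrightarrow> (\<forall>x\<in>set u. reg (snd x) \<le> m)"
proof -
  have "fold (\<lambda>x m. max m (reg (snd x))) u l \<le> m \<longleftrightarrow> l \<le> m \<and> (\<forall>x\<in>set u. reg (snd x) \<le> m)" for l
    by (induction u arbitrary: l) auto
  then show ?thesis by (simp add: max_reg_def)
qed

lemma normal_form_reg_le_length:
  assumes "normal_form u" "x \<in> set u"
  shows "reg (snd x) \<le> length u"
proof -
  let ?r = "reg (snd x)"
  obtain i where i: "i < length u" "snd (u ! i) = Fresh ?r"
    using normal_form_register_opened[OF assms] by metis
  have "normal_step (take i u) (Fresh ?r)"
    using normal_formD[OF assms(1) i(1)] i(2) by simp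
  then have bound: "binding (take i u) q \<noteq> None" if "q \<in> {1..<?r}" for q
    using that by (simp del: not_None_eq)
  let ?c = "\<lambda>q. the (binding (take i u) q)"
  have "inj_on ?c {1..<?r}"
    by (rule inj_onI) (metis binding_inj bound option.collapse)
  moreover have "?c ` {1..<?r} \<subseteq> {..<i}"
    using binding_SomeD(1) bound by (metis (no_types, lifting) image_subsetI lessThan_iff
        length_take min_less_iff_conj option.collapse)
  ultimately have "card {1..<?r} \<le> card {..<i}" by (intro card_inj_on_le) auto
  then show ?thesis using i(1) by simp
qed

lemma normal_form_of_SomeD:
  assumes "normal_form_of p = Some u"
  shows "normal_form u" "denotation u = p" "u \<in> lists ({..<n} \<times> UNIV)"
  using find_SomeD[OF assms[unfolded normal_form_of_def]] by (auto simp: set_words)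

lemma normalize_denotation:
  assumes "normal_form u" "u \<in> lists ({..<n} \<times> UNIV)"
  shows "normalize (denotation u) = u"
proof -
  have "x \<in> symbols (length u)" if x: "x \<in> set u" for x
  proof -
    have "1 \<le> reg (snd x)" using normal_form_register_opened[OF assms(1) x] by metis
    with normal_form_reg_le_length[OF assms(1) x] show ?thesis
      using assms(2) x by (auto simp: mem_Times_iff Gam_def)
  qed
  then have "u \<in> set (words (length u) (length u))" by (auto simp: set_words)
  then have "normal_form_of (denotation u) \<noteq> None"
    using assms(1) unfolding normal_form_of_def find_None_iff length_denotation by blast
  then obtain v where v: "normal_form_of (denotation u) = Some v" by blast
  then have "v = u" using normal_form_of_SomeD[OF v] normal_form_unique assms(1) by blast
  then show ?thesis using v by (simp add: normalize_def)
qed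

lemma normalize_letters: "normalize p \<in> lists ({..<n} \<times> UNIV)"
  using normal_form_of_SomeD(3) by (cases "normal_form_of p") (simp_all add: normalize_def)

lemma in_cells_iff:
  "v \<in> set (cells T) \<longleftrightarrow>
    (\<exists>s\<in>set (prefixes T). \<exists>x\<in>symbols (regs T). \<exists>e\<in>set (suffixes T). v = s @ e \<or> v = s @ x # e)"
  unfolding set_letters[symmetric] by (simp add: cells_def)

lemma length_cells:
  "length (cells T) = length (prefixes T) * (2 * n * regs T * (length (suffixes T) * 2))"
  unfolding cells_def length_letters[symmetric] by (simp add: length_concat_map_const)

lemma cells_mono:
  assumes "regs T \<le> regs T'" "set (prefixes T) \<subseteq> set (prefixes T')"
    and "set (suffixes T) \<subseteq> set (suffixes T')"
  shows "set (cells T) \<subseteq> set (cells T')"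
proof
  fix v assume "v \<in> set (cells T)"
  then obtain s x e where "s \<in> set (prefixes T)" "x \<in> symbols (regs T)" "e \<in> set (suffixes T)"
    "v = s @ e \<or> v = s @ x # e"
    unfolding in_cells_iff by blast
  moreover from this have "x \<in> symbols (regs T')" using Gam_mono[OF assms(1)] by auto
  ultimately show "v \<in> set (cells T')" using assms unfolding in_cells_iff by blast
qed



lemma missing_cell_SomeD: "missing_cell T = Some u \<Longrightarrow> u \<in> set (cells T) \<and> \<not> answered T u"
  unfolding missing_cell_def by (rule find_SomeD)

lemma unclosed_extension_SomeD:
  assumes "unclosed_extension T = Some u"
  obtains s x where "s \<in> set (prefixes T)" "x \<in> symbols (regs T)" "u = s @ [x]"
    "row T u \<notin> row T ` set (prefixes T)"
  using find_SomeD[OF assms[unfolded unclosed_extension_def]]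
  by (auto simp: extensions_def set_letters)

lemma abnormal_word_SomeD:
  assumes "abnormal_word T = Some v"
  shows "v \<in> lists (symbols (regs T))" "length v \<le> length (prefixes T) * Suc (4 ^ regs T)"
    "accepts T v" "\<not> normal_form v"
  using find_SomeD[OF assms[unfolded abnormal_word_def]] unfolding set_words by auto

lemma reached_Nil [simp]: "reached T [] = 0"
  by (simp add: reached_def)

lemma reached_snoc: "reached T (u @ [x]) = successor T (reached T u) x"
  by (simp add: reached_def)

lemma successor_less: "prefixes T \<noteq> [] \<Longrightarrow> successor T i x < length (prefixes T)"
  using find_SomeD by (fastforce simp: successor_def split: option.split)

lemma reached_less: "prefixes T \<noteq> [] \<Longrightarrow> reached T u < length (prefixes T)"
  by (cases u rule: rev_cases) (auto simp: reached_snoc successor_less)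

lemma access_nth: "prefixes T \<noteq> [] \<Longrightarrow> access T u = prefixes T ! reached T u"
  by (simp add: access_def reached_less nth_default_nth)

lemma access_in: "prefixes T \<noteq> [] \<Longrightarrow> access T u \<in> set (prefixes T)"
  by (simp add: access_nth reached_less)

definition hyp_lang :: "table \<Rightarrow> sword set" where
  "hyp_lang T = {u \<in> lists (symbols (regs T)). accepts T u}"

lemma hyp_lang_normal_form:
  assumes "prefixes T \<noteq> []" "abnormal_word T = None" "u \<in> hyp_lang T"
  shows "normal_form u"
proof (rule ccontr)
  assume "\<not> normal_form u"
  let ?Al = "symbols (regs T)"
  let ?f = "\<lambda>u. (reached T u, nf_state (regs T) u)"
  let ?R = "{..<length (prefixes T)} \<times> nf_state (regs T) ` lists ?Al"
  have inv: "right_invariant ?Al ?f"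
    using right_invariant_nf_state[of "{..<n}" "regs T"] unfolding right_invariant_def
    by (metis reached_snoc prod.inject)
  have sub: "?f ` lists ?Al \<subseteq> ?R"
    using reached_less[OF assms(1)] by auto
  have fin: "finite ?R" using finite_nf_state_range by blast
  have rec: "recognizes ?Al ?f {v. accepts T v \<and> \<not> normal_form v}"
    using nf_state_eqD(2)[of "regs T"] by (auto simp: recognizes_def accepts_def access_def)
  have u: "u \<in> lists ?Al" "u \<in> {v. accepts T v \<and> \<not> normal_form v}"
    using assms(3) \<open>\<not> normal_form u\<close> by (auto simp: hyp_lang_def)
  obtain v where v: "v \<in> lists ?Al" "v \<in> {v. accepts T v \<and> \<not> normal_form v}"
    "length v < card (?f ` lists ?Al)"
    by (rule recognized_short_member[OF inv finite_subset[OF sub fin] rec u])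
  have "length v \<le> card ?R" using v(3) card_mono[OF fin sub] by simp
  also have "\<dots> \<le> length (prefixes T) * Suc (4 ^ regs T)"
    using card_nf_state_range[of "regs T" "{..<n}"]
    by (simp add: card_cartesian_product del: mult_Suc_right)
  finally have "v \<in> set (words (regs T) (length (prefixes T) * Suc (4 ^ regs T)))"
    using v(1) unfolding set_words by blast
  then show False using assms(2) v(2) unfolding abnormal_word_def find_None_iff by blast
qed

definition closed_table :: "table \<Rightarrow> bool" where
  "closed_table T \<longleftrightarrow> missing_cell T = None \<and> unclosed_extension T = None"

lemma query_NoneD:
  assumes "query (T, p) = None" "p \<noteq> Finished"
  shows "p = Exploring" "closed_table T" "abnormal_word T = None"
  using assms by (auto simp: query_def closed_table_def split: phase.splits option.splits if_splits)

lemma row_successor: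
  assumes "closed_table T" "i < length (prefixes T)" "x \<in> symbols (regs T)"
  shows "row T (prefixes T ! successor T i x) = row T (prefixes T ! i @ [x])"
proof -
  let ?P = "\<lambda>j. row T (nth_default [] (prefixes T) j) = row T (nth_default [] (prefixes T) i @ [x])"
  have "prefixes T ! i @ [x] \<in> set (extensions T)"
    using assms(2,3) by (fastforce simp: extensions_def set_letters)
  then have "row T (prefixes T ! i @ [x]) \<in> row T ` set (prefixes T)"
    using assms(1) by (auto simp: closed_table_def unclosed_extension_def find_None_iff)
  then obtain j where "j < length (prefixes T)" "?P j"
    using assms(2) by (auto simp: in_set_conv_nth nth_default_nth)
  then have "List.find ?P [0..<length (prefixes T)] \<noteq> None" by (auto simp: find_None_iff)
  then obtain l where l: "List.find ?P [0..<length (prefixes T)] = Some l" by blast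
  then have "l < length (prefixes T)" "?P l" using find_SomeD by fastforce+
  then show ?thesis using l assms(2) by (simp add: successor_def nth_default_nth)
qed

lemma row_eqD: "row T u = row T v \<Longrightarrow> e \<in> set (suffixes T) \<Longrightarrow> positive T (u @ e) \<longleftrightarrow> positive T (v @ e)"
  by (simp add: row_def)

lemma table_update_sel [simp]:
  "regs (add_answer u b T) = regs T" "prefixes (add_answer u b T) = prefixes T"
  "suffixes (add_answer u b T) = suffixes T" "answers (add_answer u b T) = (u, b) # answers T"
  "regs (add_prefix s T) = regs T" "prefixes (add_prefix s T) = prefixes T @ [s]"
  "suffixes (add_prefix s T) = suffixes T" "answers (add_prefix s T) = answers T"
  "regs (add_suffix e T) = regs T" "prefixes (add_suffix e T) = prefixes T"
  "suffixes (add_suffix e T) = suffixes T @ [e]" "answers (add_suffix e T) = answers T"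
  "regs (set_regs k T) = k" "prefixes (set_regs k T) = prefixes T"
  "suffixes (set_regs k T) = suffixes T" "answers (set_regs k T) = answers T"
  by (simp_all add: add_answer_def add_prefix_def add_suffix_def set_regs_def)

lemma positive_add_answer: "positive (add_answer u b T) v \<longleftrightarrow> v = u \<and> b \<or> positive T v"
  by (auto simp: positive_def)

lemma positive_cong: "answers T = answers T' \<Longrightarrow> positive T = positive T'"
  by (simp add: positive_def fun_eq_iff)

lemma positive_table_update [simp]:
  "positive (add_prefix s T) = positive T" "positive (add_suffix e T) = positive T"
  "positive (set_regs k T) = positive T"
  by (rule positive_cong, simp)+

lemma no_query_without_registers:
  assumes "regs T = 0"
  shows "query (T, Exploring) = None"
proof -
  have Gam0: "Gam 0 = {}" by (auto simp: Gam_def)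
  have "letters 0 = []" using length_letters[of 0] by simp
  then have "cells T = []" "extensions T = []" by (simp_all add: assms cells_def extensions_def)
  then have "missing_cell T = None" "unclosed_extension T = None"
    by (simp_all add: missing_cell_def unclosed_extension_def)
  moreover have "u = []" if "u \<in> set (words 0 m)" for u m
    using that by (auto simp: set_words Gam0)
  then have "abnormal_word T = None"
    unfolding abnormal_word_def assms find_None_iff by (metis normal_form_Nil)
  ultimately show ?thesis by (simp add: query_def)
qed

end

text \<open>
  The target \<open>K\<close> is the set of normal forms of the language to be learned. The \<open>Q\<close>-th power of 2
  bounds the length of every counterexample, including those that the learner finds by itself.
\<close>

locale learning_target = alphabet n for n :: nat +
  fixes kmax N Q :: nat and K :: "sword set"
  assumes n_pos: "0 < n"
    and K_normal_form: "u \<in> K \<Longrightarrow> normal_form u"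
    and K_letters: "K \<subseteq> lists (symbols kmax)"
    and card_distinguishable_le:
      "W \<subseteq> lists (symbols kmax) \<Longrightarrow> pairwise (distinguishable K) W \<Longrightarrow> card W \<le> N"
    and Q: "N * Suc (4 ^ kmax) \<le> 2 ^ Q"
begin

definition separated :: "table \<Rightarrow> sword \<Rightarrow> sword \<Rightarrow> bool" where
  "separated T u v \<longleftrightarrow> (\<exists>e\<in>set (suffixes T). (u @ e \<in> K) \<noteq> (v @ e \<in> K))"

lemma separated_sym: "separated T u v \<Longrightarrow> separated T v u"
  by (auto simp: separated_def)

lemma separated_neq: "separated T u v \<Longrightarrow> u \<noteq> v"
  by (auto simp: separated_def)

definition sound :: "table \<Rightarrow> bool" where
  "sound T \<longleftrightarrow> regs T \<le> kmax \<and> prefixes T \<noteq> [] \<and> prefixes T ! 0 = [] \<and>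
     set (prefixes T) \<subseteq> lists (symbols (regs T)) \<and>
     distinct (prefixes T) \<and> pairwise (separated T) (set (prefixes T)) \<and>
     [] \<in> set (suffixes T) \<and> length (suffixes T) \<le> length (prefixes T) \<and>
     (\<forall>(v, b)\<in>set (answers T). b = (v \<in> K)) \<and> distinct (map fst (answers T)) \<and>
     fst ` set (answers T) \<subseteq> insert [] (set (cells T))"

lemma
  assumes "sound T"
  shows regs_le: "regs T \<le> kmax"
    and prefixes_nonempty: "prefixes T \<noteq> []"
    and first_prefix: "prefixes T ! 0 = []"
    and prefixes_letters: "set (prefixes T) \<subseteq> lists (symbols (regs T))"
    and distinct_prefixes: "distinct (prefixes T)"
    and prefixes_separated: "pairwise (separated T) (set (prefixes T))"
    and Nil_suffix: "[] \<in> set (suffixes T)"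
    and length_suffixes_le: "length (suffixes T) \<le> length (prefixes T)"
    and answer_correct: "(v, b) \<in> set (answers T) \<Longrightarrow> b = (v \<in> K)"
    and distinct_answers: "distinct (map fst (answers T))"
    and answered_subset: "fst ` set (answers T) \<subseteq> insert [] (set (cells T))"
  using assms unfolding sound_def by auto

lemma length_prefixes_le:
  assumes "sound T"
  shows "length (prefixes T) \<le> N"
proof -
  have "pairwise (distinguishable K) (set (prefixes T))"
    using prefixes_separated[OF assms]
    unfolding pairwise_def separated_def distinguishable_def by blast
  moreover have "set (prefixes T) \<subseteq> lists (symbols kmax)"
    using prefixes_letters[OF assms] lists_mono[of "symbols (regs T)" "symbols kmax"]
      Gam_mono[OF regs_le[OF assms]] by blast
  ultimately have "card (set (prefixes T)) \<le> N" by (rule card_distinguishable_le[rotated])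
  then show ?thesis using distinct_prefixes[OF assms] by (simp add: distinct_card)
qed

lemma symbol_exists:
  assumes "1 \<le> k" obtains x where "x \<in> symbols k"
  using that[of "(0, Fresh 1)"] n_pos assms by (auto simp: Gam_def)

lemma positive_iff:
  assumes "sound T" "missing_cell T = None" "v \<in> set (cells T)"
  shows "positive T v \<longleftrightarrow> v \<in> K"
proof -
  have "answered T v" using assms(2,3) by (auto simp: missing_cell_def find_None_iff)
  then show ?thesis using answer_correct[OF assms(1)] by (auto simp: answered_def positive_def)
qed

lemma positive_prefix_iff:
  assumes T: "sound T" "missing_cell T = None"
    and "1 \<le> regs T" "s \<in> set (prefixes T)" "e \<in> set (suffixes T)"
  shows "positive T (s @ e) \<longleftrightarrow> s @ e \<in> K"
proof -
  obtain x where "x \<in> symbols (regs T)" using symbol_exists[OF assms(3)] by blast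
  then have "s @ e \<in> set (cells T)" using assms(4,5) unfolding in_cells_iff by blast
  then show ?thesis by (rule positive_iff[OF T])
qed

lemma positive_extension_iff:
  assumes T: "sound T" "missing_cell T = None"
    and "s \<in> set (prefixes T)" "x \<in> symbols (regs T)" "e \<in> set (suffixes T)"
  shows "positive T (s @ x # e) \<longleftrightarrow> s @ x # e \<in> K"
proof -
  have "s @ x # e \<in> set (cells T)" using assms(3-5) unfolding in_cells_iff by blast
  then show ?thesis by (rule positive_iff[OF T])
qed

lemma sound_add_answer:
  assumes "sound T" "b \<longleftrightarrow> v \<in> K" "v \<in> insert [] (set (cells T))" "\<not> answered T v"
  shows "sound (add_answer v b T)"
proof -
  have "cells (add_answer v b T) = cells T" by (simp add: cells_def)
  moreover have "separated (add_answer v b T) = separated T" by (simp add: separated_def fun_eq_iff)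
  ultimately show ?thesis using assms by (auto simp: sound_def answered_def)
qed

lemma sound_extend:
  assumes T: "sound T" and s: "s \<in> lists (symbols (regs T))"
    and T': "regs T' = regs T" "prefixes T' = prefixes T @ [s]" "answers T' = answers T"
      "set (suffixes T) \<subseteq> set (suffixes T')" "length (suffixes T') \<le> Suc (length (suffixes T))"
    and sep: "\<And>s'. s' \<in> set (prefixes T) \<Longrightarrow> separated T' s s'"
  shows "sound T'"
proof -
  have "pairwise (separated T') (set (prefixes T))"
    using prefixes_separated[OF T] T'(4) by (elim pairwise_mono) (auto simp: separated_def)
  then have "pairwise (separated T') (insert s (set (prefixes T)))"
    using sep separated_sym by (simp add: pairwise_insert)
  moreover have "s \<notin> set (prefixes T)" using sep separated_neq by blast
  moreover have "set (cells T) \<subseteq> set (cells T')" using T' by (intro cells_mono) auto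
  ultimately show ?thesis using T s T' by (auto simp: sound_def nth_append)
qed

lemma sound_set_regs:
  assumes T: "sound T" and k: "regs T \<le> k" "k \<le> kmax"
  shows "sound (set_regs k T)"
proof -
  have "separated (set_regs k T) = separated T" by (simp add: separated_def fun_eq_iff)
  moreover have "set (cells T) \<subseteq> set (cells (set_regs k T))" using k(1) by (intro cells_mono) auto
  then have "fst ` set (answers T) \<subseteq> insert [] (set (cells (set_regs k T)))"
    using answered_subset[OF T] by blast
  moreover have "lists (symbols (regs T)) \<subseteq> lists (symbols k)"
    using Gam_mono[OF k(1)] by (intro lists_mono) auto
  then have "set (prefixes T) \<subseteq> lists (symbols k)"
    using prefixes_letters[OF T] by (rule subset_trans[rotated])
  ultimately show ?thesis using T k(2) unfolding sound_def table_update_sel by metis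
qed

lemma sound_add_unclosed:
  assumes T: "sound T" "missing_cell T = None" and u: "unclosed_extension T = Some u"
  shows "sound (add_prefix u T)"
proof -
  obtain s x where s: "s \<in> set (prefixes T)" "x \<in> symbols (regs T)" "u = s @ [x]"
    and new: "row T u \<notin> row T ` set (prefixes T)"
    using unclosed_extension_SomeD[OF u] by blast
  have k: "1 \<le> regs T" using s(2) by (auto simp: Gam_def)
  show ?thesis
  proof (rule sound_extend[OF T(1)])
    show "u \<in> lists (symbols (regs T))" using s prefixes_letters[OF T(1)] by auto
    fix s' assume s': "s' \<in> set (prefixes T)"
    then have "row T u \<noteq> row T s'" using new by blast
    then obtain e where e: "e \<in> set (suffixes T)" "positive T (u @ e) \<noteq> positive T (s' @ e)"
      unfolding row_def by auto
    then have "(u @ e \<in> K) \<noteq> (s' @ e \<in> K)"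
      using positive_extension_iff[OF T s(1,2) e(1)] positive_prefix_iff[OF T k s' e(1)] s(3)
      by simp
    then show "separated (add_prefix u T) u s'" using e(1) by (auto simp: separated_def)
  qed simp_all
qed

definition search_inv :: "table \<Rightarrow> sword \<Rightarrow> nat \<Rightarrow> nat \<Rightarrow> bool" where
  "search_inv T u lo hi \<longleftrightarrow> 1 \<le> regs T \<and> closed_table T \<and> lo < hi \<and> hi \<le> length u \<and>
     u \<in> lists (symbols (regs T)) \<and>
     (redirect T u lo \<in> K) \<noteq> accepts T u \<and> (redirect T u hi \<in> K) = accepts T u"

lemma search_inv_start:
  assumes T: "sound T" "closed_table T"
    and v: "v \<in> lists (symbols (regs T))" "v \<noteq> []" "(v \<in> K) \<noteq> accepts T v"
  shows "search_inv T v 0 (length v)"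
proof -
  have ne: "prefixes T \<noteq> []" by (rule prefixes_nonempty[OF T(1)])
  have "hd v \<in> symbols (regs T)" using v(1,2) by (simp add: in_lists_conv_set)
  then have k: "1 \<le> regs T" by (auto simp: Gam_def)
  have "access T [] = []" using first_prefix[OF T(1)] ne by (simp add: access_nth)
  moreover have "access T v \<in> K \<longleftrightarrow> accepts T v"
    using positive_prefix_iff[OF T(1) _ k access_in[OF ne] Nil_suffix[OF T(1)], of v] T(2)
    by (simp add: accepts_def closed_table_def)
  ultimately show ?thesis using v T(2) k by (simp add: search_inv_def redirect_def)
qed

lemma search_inv_halve:
  assumes "search_inv T u lo hi" "lo < m" "m < hi"
  shows "(redirect T u m \<in> K) = accepts T u \<Longrightarrow> search_inv T u lo m"
    "(redirect T u m \<in> K) \<noteq> accepts T u \<Longrightarrow> search_inv T u m hi"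
  using assms by (auto simp: search_inv_def)

text \<open>
  At the end of the search, replacing \<open>lo\<close> letters of \<open>u\<close> by their access word and replacing one
  letter more make a difference for membership in \<open>K\<close>. Hence the suffix of \<open>u\<close> from there on tells
  the extended access word from the prefix that the hypothesis identifies with it.
\<close>

lemma search_inv_end:
  assumes T: "sound T" and search: "search_inv T u lo hi" and "hi \<le> Suc lo"
  obtains s x s' where "access T (take lo u) = s" "drop lo u = x # drop (Suc lo) u"
    "s \<in> set (prefixes T)" "s' \<in> set (prefixes T)" "x \<in> symbols (regs T)"
    "row T s' = row T (s @ [x])" "(s @ x # drop (Suc lo) u \<in> K) \<noteq> (s' @ drop (Suc lo) u \<in> K)"
proof -
  have hi: "hi = Suc lo" and lo: "lo < length u" and closed: "closed_table T"
    and u: "u \<in> lists (symbols (regs T))"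
    using search \<open>hi \<le> Suc lo\<close> by (auto simp: search_inv_def)
  note ne = prefixes_nonempty[OF T]
  define x where "x = u ! lo"
  define i where "i = reached T (take lo u)"
  define j where "j = successor T i x"
  have drop: "drop lo u = x # drop (Suc lo) u" using lo by (simp add: x_def Cons_nth_drop_Suc)
  have x: "x \<in> symbols (regs T)" using u lo by (auto simp: x_def)
  have "reached T (take (Suc lo) u) = j"
    using lo by (simp add: take_Suc_conv_app_nth reached_snoc j_def i_def x_def)
  then have access: "access T (take lo u) = prefixes T ! i"
    "access T (take (Suc lo) u) = prefixes T ! j"
    using ne by (simp_all add: access_nth i_def)
  have i: "i < length (prefixes T)" and j: "j < length (prefixes T)"
    using ne by (simp_all add: i_def j_def reached_less successor_less)
  have "row T (prefixes T ! j) = row T (prefixes T ! i @ [x])"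
    unfolding j_def by (rule row_successor[OF closed i x])
  moreover have "(prefixes T ! i @ x # drop (Suc lo) u \<in> K) \<noteq>
      (prefixes T ! j @ drop (Suc lo) u \<in> K)"
    using search by (simp add: search_inv_def redirect_def hi access drop)
  ultimately show thesis using that access(1) drop x nth_mem[OF i] nth_mem[OF j] by blast
qed

lemma sound_split_state:
  assumes T: "sound T" and search: "search_inv T u lo hi" and hi: "hi \<le> Suc lo"
  shows "sound (split_state u lo T)"
proof -
  define e where "e = drop (Suc lo) u"
  obtain s x s' where access: "access T (take lo u) = s" and drop: "drop lo u = x # e"
    and s: "s \<in> set (prefixes T)" and s': "s' \<in> set (prefixes T)" and x: "x \<in> symbols (regs T)"
    and row: "row T s' = row T (s @ [x])" and diff: "(s @ x # e \<in> K) \<noteq> (s' @ e \<in> K)"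
    using search_inv_end[OF T search hi] unfolding e_def by metis
  have answered: "missing_cell T = None" and k: "1 \<le> regs T"
    using search by (auto simp: search_inv_def closed_table_def)
  have same: "s' @ e' \<in> K \<longleftrightarrow> s @ x # e' \<in> K" if "e' \<in> set (suffixes T)" for e'
    using row_eqD[OF row that] positive_prefix_iff[OF T answered k s' that]
      positive_extension_iff[OF T answered s x that] by simp
  have split: "split_state u lo T = add_suffix e (add_prefix (s @ [x]) T)"
    by (simp add: split_state_def access drop e_def[symmetric])
  show ?thesis
    unfolding split
  proof (rule sound_extend[OF T])
    show "s @ [x] \<in> lists (symbols (regs T))" using prefixes_letters[OF T] s x by auto
    fix t assume t: "t \<in> set (prefixes T)"
    show "separated (add_suffix e (add_prefix (s @ [x]) T)) (s @ [x]) t"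
    proof (cases "t = s'")
      case False
      then have "separated T s' t"
        using prefixes_separated[OF T] t s' unfolding pairwise_def by metis
      then obtain e' where "e' \<in> set (suffixes T)" "(s' @ e' \<in> K) \<noteq> (t @ e' \<in> K)"
        unfolding separated_def by blast
      moreover from this have "((s @ [x]) @ e' \<in> K) \<noteq> (t @ e' \<in> K)" using same by simp
      ultimately show ?thesis unfolding separated_def by (intro bexI[of _ e']) simp_all
    qed (use diff in \<open>simp add: separated_def\<close>)
  qed auto
qed

text \<open>
  Every counterexample either leads to a further access word, or to more registers, or it is the
  empty word. In the budget of membership queries, each access word pays for the closing step or for
  the binary search that produced it.
\<close>

definition progress :: "table \<Rightarrow> nat" where
  "progress T = length (prefixes T) + regs T + of_bool (positive T [])"

definition budget :: "table \<Rightarrow> nat" where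
  "budget T = length (answers T) + length (prefixes T) * (Q + 2)"

definition settled :: "table \<Rightarrow> nat \<Rightarrow> nat \<Rightarrow> bool" where
  "settled T mq ce \<longleftrightarrow> sound T \<and> (regs T = 0 \<longrightarrow> mq = 0) \<and> ce < progress T \<and> mq + (Q + 2) \<le> budget T"

text \<open>\<open>mq\<close> and \<open>ce\<close> count the membership queries and the counterexamples.\<close>

fun invariant :: "learner_state \<Rightarrow> nat \<Rightarrow> nat \<Rightarrow> bool" where
  "invariant (T, Exploring) mq ce \<longleftrightarrow> settled T mq ce"
| "invariant (T, Searching u lo hi) mq ce \<longleftrightarrow> sound T \<and> search_inv T u lo hi \<and> ce \<le> progress T \<and>
     (\<exists>q. hi - lo \<le> 2 ^ q \<and> mq + q + 1 \<le> budget T)"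
| "invariant (T, Finished) mq ce \<longleftrightarrow> settled T mq ce \<and> hyp_lang T = K"

lemma invariant_init: "invariant init_state 0 0"
  by (simp add: init_state_def settled_def progress_def budget_def sound_def pairwise_def)

lemma invariant_sound: "invariant (T, p) mq ce \<Longrightarrow> sound T"
  by (cases p) (auto simp: settled_def)

lemma invariant_start_search:
  assumes T: "sound T" "closed_table T" and cost: "ce \<le> progress T" "mq + Q + 1 \<le> budget T"
    and v: "v \<in> lists (symbols (regs T))" "v \<noteq> []" "(v \<in> K) \<noteq> accepts T v" "length v \<le> 2 ^ Q"
  shows "invariant (T, Searching v 0 (length v)) mq ce"
  using search_inv_start[OF T v(1-3)] T(1) cost v(4) by auto

lemma invariant_abnormal_word:
  assumes T: "settled T mq ce" "closed_table T" and v: "abnormal_word T = Some v"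
  shows "invariant (T, Searching v 0 (length v)) (Suc mq) ce"
proof (rule invariant_start_search)
  note v = abnormal_word_SomeD[OF v]
  show "sound T" using T(1) by (simp add: settled_def)
  show "v \<noteq> []" "(v \<in> K) \<noteq> accepts T v" using v(3,4) K_normal_form by auto
  have "length v \<le> N * Suc (4 ^ kmax)"
    using v(2) length_prefixes_le[OF \<open>sound T\<close>] regs_le[OF \<open>sound T\<close>]
    by (elim order_trans) (intro mult_mono, auto simp: power_increasing)
  also note Q
  finally show "length v \<le> 2 ^ Q" .
  show "v \<in> lists (symbols (regs T))" by (rule v(1))
qed (use T in \<open>simp_all add: settled_def\<close>)

lemma invariant_explore:
  assumes T: "settled T mq ce" and u: "query (T, Exploring) = Some u" and b: "b \<longleftrightarrow> u \<in> K"
  shows "invariant (explore T b) (Suc mq) ce"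
proof -
  have sound: "sound T" using T by (simp add: settled_def)
  have k: "regs T \<noteq> 0" using no_query_without_registers u by force
  show ?thesis
  proof (cases "missing_cell T")
    case (Some v)
    then have v: "v = u" "v \<in> set (cells T)" "\<not> answered T v"
      using u missing_cell_SomeD by (auto simp: query_def)
    then have "sound (add_answer v b T)" using sound_add_answer[OF sound] b by simp
    moreover have "progress T \<le> progress (add_answer v b T)"
      by (simp add: progress_def positive_add_answer)
    ultimately show ?thesis
      using T k Some by (simp add: explore_def settled_def budget_def)
  next
    case answered: None
    show ?thesis
    proof (cases "unclosed_extension T")
      case (Some s)
      with sound_add_unclosed[OF sound answered] T k answered show ?thesis
        by (simp add: explore_def settled_def progress_def budget_def)
    next
      case None
      then obtain v where "abnormal_word T = Some v"
        using u answered by (auto simp: query_def split: if_splits)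
      then show ?thesis
        using invariant_abnormal_word[OF T] answered None
        by (simp add: explore_def closed_table_def)
    qed
  qed
qed

lemma invariant_search:
  assumes inv: "invariant (T, Searching u lo hi) mq ce"
    and b: "lo + 2 \<le> hi \<Longrightarrow> b \<longleftrightarrow> redirect T u ((lo + hi) div 2) \<in> K"
  shows "invariant (search T u lo hi b) (Suc mq) ce"
proof -
  obtain q where sound: "sound T" and search: "search_inv T u lo hi" and ce: "ce \<le> progress T"
    and q: "hi - lo \<le> 2 ^ q" "mq + q + 1 \<le> budget T"
    using inv by auto
  show ?thesis
  proof (cases "hi \<le> Suc lo")
    case True
    have "1 \<le> regs T" using search by (simp add: search_inv_def)
    with sound_split_state[OF sound search True] ce q(2) True show ?thesis
      by (simp add: search_def settled_def progress_def budget_def split_state_def)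
  next
    case False
    define m where "m = (lo + hi) div 2"
    have m: "lo < m" "m < hi" using False by (auto simp: m_def)
    obtain r where r: "q = Suc r" using q(1) False by (cases q) auto
    then have "m - lo \<le> 2 ^ r" "hi - m \<le> 2 ^ r" using q(1) by (auto simp: m_def)
    moreover have "Suc mq + r + 1 \<le> budget T" using q(2) r by simp
    ultimately show ?thesis
      using search_inv_halve[OF search m] False b sound ce
      by (auto simp: search_def m_def[symmetric])
  qed
qed

lemma invariant_process_truth:
  assumes inv: "invariant \<sigma> mq ce" and u: "query \<sigma> = Some u" and b: "b \<longleftrightarrow> u \<in> K"
  shows "invariant (process_truth \<sigma> b) (Suc mq) ce"
proof -
  obtain T p where \<sigma>: "\<sigma> = (T, p)" by (cases \<sigma>)
  show ?thesis
  proof (cases p)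
    case Exploring
    then show ?thesis
      using invariant_explore[of T mq ce u b] inv u b by (simp add: \<sigma> process_truth_def)
  next
    case (Searching v lo hi)
    then have "lo + 2 \<le> hi \<Longrightarrow> b \<longleftrightarrow> redirect T v ((lo + hi) div 2) \<in> K"
      using u b by (auto simp: \<sigma> query_def)
    then show ?thesis
      using invariant_search[of T v lo hi mq ce b] inv Searching by (simp add: \<sigma> process_truth_def)
  qed (use u in \<open>simp add: \<sigma> query_def\<close>)
qed

lemma sound_add_Nil:
  assumes T: "sound T" and Nil: "([] \<in> K) \<noteq> ([] \<in> hyp_lang T)"
  shows "\<not> positive T []" "sound (add_answer [] True T)"
proof -
  have "[] \<in> hyp_lang T \<longleftrightarrow> positive T []"
    using prefixes_nonempty[OF T] first_prefix[OF T]
    by (simp add: hyp_lang_def accepts_def access_nth)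
  then have "[] \<in> K" and not_positive: "\<not> positive T []"
    using Nil answer_correct[OF T] by (auto simp: positive_def)
  moreover from this have "\<not> answered T []"
    using answer_correct[OF T] by (fastforce simp: answered_def positive_def)
  ultimately show "sound (add_answer [] True T)" using sound_add_answer[OF T, of True "[]"] by simp
  show "\<not> positive T []" by (rule not_positive)
qed

lemma invariant_process_counterexample:
  assumes T: "settled T mq ce" "closed_table T"
    and v: "(v \<in> K) \<noteq> (v \<in> hyp_lang T)" "length v \<le> 2 ^ Q"
  shows "invariant (process_counterexample T v) mq (Suc ce)"
proof -
  have sound: "sound T" using T by (simp add: settled_def)
  consider (Nil) "v = []" | (more) "v \<noteq> []" "regs T < max_reg v"
    | (search) "v \<noteq> []" "max_reg v \<le> regs T" by linarith
  then show ?thesis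
  proof cases
    case Nil
    then show ?thesis
      using sound_add_Nil[OF sound] v(1) T
      by (simp add: process_counterexample_def settled_def progress_def budget_def
          positive_add_answer)
  next
    case more
    have "\<not> max_reg v \<le> regs T" using more by simp
    then have "v \<notin> hyp_lang T" by (auto simp: hyp_lang_def max_reg_le_iff Gam_def)
    then have "v \<in> lists (symbols kmax)" using v(1) K_letters by blast
    then have "max_reg v \<le> kmax" by (auto simp: max_reg_le_iff Gam_def)
    then have "sound (set_regs (max_reg v) T)" using more by (intro sound_set_regs sound) simp_all
    then show ?thesis
      using T more by (simp add: process_counterexample_def settled_def progress_def budget_def)
  next
    case search
    have "v \<in> lists (symbols kmax) \<or> v \<in> lists (symbols (regs T))"
      using v(1) K_letters by (auto simp: hyp_lang_def)
    then have letters: "v \<in> lists (symbols (regs T))"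
      using search(2) by (auto simp: max_reg_le_iff Gam_def)
    then have "(v \<in> K) \<noteq> accepts T v" using v(1) by (simp add: hyp_lang_def)
    then show ?thesis
      using invariant_start_search[OF sound T(2), of "Suc ce" mq v] T(1) letters search v(2)
      by (simp add: process_counterexample_def settled_def)
  qed
qed

lemma invariant_costs:
  assumes "invariant (T, p) mq ce"
  shows "ce \<le> progress T" "mq \<le> budget T" "regs T = 0 \<Longrightarrow> mq = 0"
  using assms by (cases p; auto simp: settled_def search_inv_def)+

lemma progress_le: "sound T \<Longrightarrow> progress T \<le> N + kmax + 1"
  using length_prefixes_le regs_le by (fastforce simp: progress_def of_bool_def)

lemma budget_le:
  assumes "sound T"
  shows "budget T \<le> 1 + N * (2 * n * kmax * (N * 2)) + N * (Q + 2)"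
proof -
  note S = length_prefixes_le[OF assms]
  have "length (answers T) = card (fst ` set (answers T))"
    using distinct_answers[OF assms] by (metis distinct_card length_map list.set_map)
  also have "\<dots> \<le> card (insert [] (set (cells T)))"
    using answered_subset[OF assms] by (intro card_mono) auto
  also have "\<dots> \<le> Suc (length (cells T))"
    using card_length[of "cells T"] by (simp add: card_insert_if)
  also have "length (cells T) \<le> N * (2 * n * kmax * (N * 2))"
    unfolding length_cells using S regs_le[OF assms] length_suffixes_le[OF assms]
    by (intro mult_mono) auto
  finally show ?thesis
    unfolding budget_def using S by (intro add_mono mult_right_mono) auto
qed

end

section \<open>Renaming letters\<close>

abbreviation relabel :: "('a \<Rightarrow> 'b) \<Rightarrow> ('a \<times> 'c) list \<Rightarrow> ('b \<times> 'c) list" where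
  "relabel g \<equiv> map (apfst g)"

lemma binding_relabel: "binding (relabel g u) r = binding u r"
  by (induction u rule: rev_induct) simp_all

lemma denotation_relabel: "denotation (relabel g u) = relabel g (denotation u)"
  by (induction u rule: rev_induct) (simp_all add: denoted_value_def binding_relabel)

lemma obligations_relabel: "obligations (relabel g u) = obligations u"
  by (induction u rule: rev_induct) simp_all

lemma normal_form_relabel: "normal_form (relabel g u) \<longleftrightarrow> normal_form u"
proof -
  have "normal_prefix (relabel g u) \<longleftrightarrow> normal_prefix u"
    by (induction u rule: rev_induct)
      (simp_all add: normal_step_def binding_relabel obligations_relabel)
  then show ?thesis by (simp add: normal_form_def obligations_relabel)
qed

lemma map_prod_in_lists:
  "u \<in> lists (A \<times> X) \<Longrightarrow> g ` A \<subseteq> B \<Longrightarrow> h ` X \<subseteq> Y \<Longrightarrow> map (map_prod g h) u \<in> lists (B \<times> Y)"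
  by (induction u) (auto simp: image_subset_iff)

lemma relabel_in_lists: "u \<in> lists (A \<times> X) \<Longrightarrow> g ` A \<subseteq> B \<Longrightarrow> relabel g u \<in> lists (B \<times> X)"
  unfolding apfst_def by (rule map_prod_in_lists) auto

lemma relabel_inverse:
  "u \<in> lists (A \<times> X) \<Longrightarrow> (\<And>a. a \<in> A \<Longrightarrow> f (g a) = a) \<Longrightarrow> relabel f (relabel g u) = u"
  by (induction u) auto

lemma lists_Times_UNIV: "u \<in> lists (A \<times> X) \<Longrightarrow> u \<in> lists (A \<times> UNIV)"
  by (induction u) auto

section \<open>Learning session automata\<close>

lemma data_lang_iff_snf:
  "w \<in> data_lang \<Sigma> D A \<longleftrightarrow> w \<in> lists (\<Sigma> \<times> D) \<and> snf w \<in> snf ` data_lang \<Sigma> D A"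
proof
  assume "w \<in> lists (\<Sigma> \<times> D) \<and> snf w \<in> snf ` data_lang \<Sigma> D A"
  then obtain w' where w: "w \<in> lists (\<Sigma> \<times> D)" "w' \<in> data_lang \<Sigma> D A" "snf w = snf w'" by blast
  then have "pattern w = pattern w'" by (metis denotation_snf)
  then show "w \<in> data_lang \<Sigma> D A" using w(1,2) by (simp add: data_lang_iff)
qed (auto simp: data_lang_iff)

lemma snf_data_lang_normal:
  assumes "infinite D" "session_automaton \<Sigma> A" "\<And>z. z \<in> sym_lang A \<Longrightarrow> normal_form z"
  shows "snf ` data_lang \<Sigma> D A = sym_lang A"
proof (intro set_eqI)
  show "u \<in> snf ` data_lang \<Sigma> D A \<longleftrightarrow> u \<in> sym_lang A" for u
    unfolding snf_data_lang_iff[OF assms(1,2)]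
    using assms(3) normal_form_imp_well_formed normal_form_unique by blast
qed

lemma snf_letters:
  assumes "w \<in> lists (\<Sigma> \<times> D)"
  shows "snf w \<in> lists (\<Sigma> \<times> UNIV)"
proof -
  have "map fst (snf w) = map fst w" by (metis denotation_snf map_fst_denotation map_fst_pattern)
  then have "fst ` set (snf w) = fst ` set w" by (metis list.set_map)
  moreover have "fst ` set w \<subseteq> \<Sigma>" using assms by auto
  ultimately have "fst x \<in> \<Sigma>" if "x \<in> set (snf w)" for x using that by (metis imageI subsetD)
  then show ?thesis by (auto simp: mem_Times_iff)
qed

definition cex_count :: "('a, 'd) answer list \<Rightarrow> nat" where
  "cex_count h = length (filter (\<lambda>x. \<exists>w. x = Counterexample w) h)"

lemma count_Nil [simp]: "member_queries [] = 0" "equiv_queries [] = 0" "cex_count [] = 0"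
  by (simp_all add: member_queries_def equiv_queries_def cex_count_def)

lemma count_snoc [simp]:
  "member_queries (h @ [Truth b]) = Suc (member_queries h)"
  "member_queries (h @ [Yes]) = member_queries h"
  "member_queries (h @ [Counterexample w]) = member_queries h"
  "equiv_queries (h @ [Truth b]) = equiv_queries h"
  "equiv_queries (h @ [Yes]) = Suc (equiv_queries h)"
  "equiv_queries (h @ [Counterexample w]) = Suc (equiv_queries h)"
  "cex_count (h @ [Truth b]) = cex_count h"
  "cex_count (h @ [Yes]) = cex_count h"
  "cex_count (h @ [Counterexample w]) = Suc (cex_count h)"
  by (simp_all add: member_queries_def equiv_queries_def cex_count_def)

lemma length_eq_queries: "length h = member_queries h + equiv_queries h"
proof (induction h)
  case (Cons x h) then show ?case by (cases x) (simp_all add: member_queries_def equiv_queries_def)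
qed simp

lemma length_le_max_counterexample:
  assumes "Counterexample w \<in> set h"
  shows "length w \<le> max_counterexample h"
proof -
  have "{length w | w. Counterexample w \<in> set h} \<subseteq>
      (\<lambda>x. case x of Counterexample w \<Rightarrow> length w | _ \<Rightarrow> 0) ` set h" by force
  then have "finite {length w | w. Counterexample w \<in> set h}" by (rule finite_subset) simp
  then show ?thesis
    unfolding max_counterexample_def using assms by (intro Max_ge) auto
qed

context alphabet
begin

abbreviation nat_words :: "sword set" where
  "nat_words \<equiv> lists ({..<n} \<times> UNIV)"

definition within_alphabet :: "learner_state \<Rightarrow> bool" where
  "within_alphabet \<sigma> \<longleftrightarrow> prefixes (fst \<sigma>) \<noteq> [] \<and>
     set (prefixes (fst \<sigma>)) \<subseteq> nat_words \<and> set (suffixes (fst \<sigma>)) \<subseteq> nat_words \<and>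
     (\<forall>u lo hi. snd \<sigma> = Searching u lo hi \<longrightarrow> u \<in> nat_words)"

lemma take_drop_nat_words: "u \<in> nat_words \<Longrightarrow> take i u \<in> nat_words \<and> drop i u \<in> nat_words"
  by (metis append_in_lists_conv append_take_drop_id)

lemma within_alphabet_access: "within_alphabet (T, p) \<Longrightarrow> access T u \<in> nat_words"
  using access_in[of T u] by (auto simp: within_alphabet_def)

lemma within_alphabet_missing_cell:
  assumes "within_alphabet (T, p)" "missing_cell T = Some u"
  shows "u \<in> nat_words"
proof -
  obtain s x e where "s \<in> set (prefixes T)" "x \<in> symbols (regs T)" "e \<in> set (suffixes T)"
    "u = s @ e \<or> u = s @ x # e"
    using missing_cell_SomeD[OF assms(2)] unfolding in_cells_iff by blast
  moreover from this have "s \<in> nat_words" "e \<in> nat_words" "x \<in> {..<n} \<times> UNIV"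
    using assms(1) by (auto simp: within_alphabet_def simp del: in_lists_conv_set)
  ultimately show ?thesis by auto
qed

lemma within_alphabet_unclosed_extension:
  assumes "within_alphabet (T, p)" "unclosed_extension T = Some u"
  shows "u \<in> nat_words"
proof -
  obtain s x where "s \<in> set (prefixes T)" "x \<in> symbols (regs T)" "u = s @ [x]"
    using unclosed_extension_SomeD[OF assms(2)] by metis
  moreover from this have "s \<in> nat_words" "x \<in> {..<n} \<times> UNIV"
    using assms(1) by (auto simp: within_alphabet_def simp del: in_lists_conv_set)
  ultimately show ?thesis by auto
qed

lemma within_alphabet_query:
  assumes "within_alphabet \<sigma>" "query \<sigma> = Some u"
  shows "u \<in> nat_words"
proof -
  obtain T p where \<sigma>: "\<sigma> = (T, p)" by (cases \<sigma>)
  show ?thesis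
  proof (cases p)
    case Exploring
    then show ?thesis
      using assms within_alphabet_missing_cell[of T p]
      by (auto simp: \<sigma> query_def split: option.splits if_splits)
  next
    case (Searching v lo hi)
    then have "v \<in> nat_words" using assms(1) by (simp add: \<sigma> within_alphabet_def)
    then have "redirect T v m \<in> nat_words" for m
      using take_drop_nat_words within_alphabet_access[OF assms(1)[unfolded \<sigma>]]
      unfolding redirect_def append_in_lists_conv by blast
    then show ?thesis using assms(2) Searching by (auto simp: \<sigma> query_def split: if_splits)
  qed (use assms(2) in \<open>simp add: \<sigma> query_def\<close>)
qed

lemma within_alphabet_explore:
  assumes "within_alphabet (T, p)"
  shows "within_alphabet (explore T b)"
proof -
  have "v \<in> nat_words" if "abnormal_word T = Some v" for v
    by (rule lists_Times_UNIV[OF abnormal_word_SomeD(1)[OF that]])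
  then show ?thesis
    using assms within_alphabet_unclosed_extension[OF assms]
    by (simp add: explore_def within_alphabet_def split: option.split)
qed

lemma within_alphabet_search:
  assumes "within_alphabet (T, Searching u lo hi)"
  shows "within_alphabet (search T u lo hi b)"
proof -
  have "u \<in> nat_words" using assms by (simp add: within_alphabet_def)
  then have "drop i u \<in> nat_words" "take j (drop i u) \<in> nat_words" for i j
    using take_drop_nat_words by blast+
  then show ?thesis
    using assms within_alphabet_access[OF assms]
    by (simp add: search_def split_state_def within_alphabet_def del: in_lists_conv_set)
qed

lemma within_alphabet_respond:
  assumes "within_alphabet \<sigma>"
  shows "within_alphabet (respond \<sigma> r)"
proof -
  obtain T p where \<sigma>: "\<sigma> = (T, p)" by (cases \<sigma>)
  show ?thesis
  proof (cases r)
    case (Truth b)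
    then show ?thesis
      using assms within_alphabet_explore within_alphabet_search
      by (cases p) (simp_all add: \<sigma> respond_def process_truth_def)
  next
    case Yes
    then show ?thesis using assms by (simp add: respond_def within_alphabet_def)
  next
    case (Counterexample w)
    then show ?thesis
      using assms normalize_letters[of w]
      by (simp add: \<sigma> respond_def process_counterexample_def within_alphabet_def
          del: in_lists_conv_set)
  qed
qed

lemma process_truth_Finished_iff: "snd (process_truth \<sigma> b) = Finished \<longleftrightarrow> snd \<sigma> = Finished"
  by (auto simp: process_truth_def explore_def search_def split: phase.split option.split)

lemma process_counterexample_not_Finished: "snd (process_counterexample T v) \<noteq> Finished"
  by (simp add: process_counterexample_def)

end

locale session_learner =
  fixes \<Sigma> :: "'a set" and D :: "'d set" and \<alpha> :: "'a \<Rightarrow> nat" and \<nu> :: "nat \<Rightarrow> 'd"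
  assumes fin: "finite \<Sigma>" and nonempty: "\<Sigma> \<noteq> {}" and inf: "infinite D"
    and \<alpha>: "bij_betw \<alpha> \<Sigma> {..<card \<Sigma>}" and \<nu>: "inj \<nu>" "range \<nu> \<subseteq> D"
begin

sublocale alphabet "card \<Sigma>" .

abbreviation n :: nat where "n \<equiv> card \<Sigma>"

definition \<beta> :: "nat \<Rightarrow> 'a" where "\<beta> = inv_into \<Sigma> \<alpha>"

lemma \<alpha>_\<beta>: "i \<in> {..<n} \<Longrightarrow> \<alpha> (\<beta> i) = i"
  and \<beta>_\<alpha>: "a \<in> \<Sigma> \<Longrightarrow> \<beta> (\<alpha> a) = a"
  and \<beta>_in: "\<beta> ` {..<n} \<subseteq> \<Sigma>"
  and \<alpha>_in: "\<alpha> ` \<Sigma> \<subseteq> {..<n}"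
  using \<alpha> bij_betw_inv_into_right[OF \<alpha>] bij_betw_inv_into_left[OF \<alpha>] bij_betw_inv_into[OF \<alpha>]
  unfolding \<beta>_def by (auto simp: bij_betw_def)

lemma relabel_\<alpha>_\<beta>: "u \<in> lists ({..<n} \<times> X) \<Longrightarrow> relabel \<alpha> (relabel \<beta> u) = u"
  by (erule relabel_inverse) (rule \<alpha>_\<beta>)

lemma relabel_\<beta>_\<alpha>: "u \<in> lists (\<Sigma> \<times> X) \<Longrightarrow> relabel \<beta> (relabel \<alpha> u) = u"
  by (erule relabel_inverse) (rule \<beta>_\<alpha>)

lemma inj_on_relabel_\<alpha>: "inj_on (relabel \<alpha>) (lists (\<Sigma> \<times> UNIV))"
  using relabel_\<beta>_\<alpha> by (rule inj_on_inverseI)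

lemma n_pos: "0 < n"
  using fin nonempty by (simp add: card_gt_0_iff)

fun abstract :: "('a, 'd) answer \<Rightarrow> (nat, nat) answer" where
  "abstract (Truth b) = Truth b"
| "abstract Yes = Yes"
| "abstract (Counterexample w) = Counterexample (relabel \<alpha> (pattern w))"

definition state_after :: "('a, 'd) answer list \<Rightarrow> learner_state" where
  "state_after h = fold (\<lambda>r \<sigma>. respond \<sigma> r) (map abstract h) init_state"

definition hyp :: "table \<Rightarrow> (nat, 'a) session_automaton" where
  "hyp T = dfa_of {..<length (prefixes T)} (\<Sigma> \<times> Gam (regs T)) (regs T)
     (\<lambda>i x. successor T i (apfst \<alpha> x)) 0 (set (hyp_finals T))"

definition query_word :: "sword \<Rightarrow> ('a \<times> nat) list" where
  "query_word u = relabel \<beta> (denotation u)"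

definition act :: "learner_state \<Rightarrow> ('a, nat) action" where
  "act \<sigma> = (case query \<sigma> of
     Some u \<Rightarrow> Member (query_word u)
   | None \<Rightarrow> if snd \<sigma> = Finished then Output (hyp (fst \<sigma>)) else Equiv (hyp (fst \<sigma>)))"

definition learner :: "('a, 'd) learner" where
  "learner h = map_action \<nu> (act (state_after h))"

lemma state_after_Nil [simp]: "state_after [] = init_state"
  by (simp add: state_after_def)

lemma state_after_snoc [simp]: "state_after (h @ [r]) = respond (state_after h) (abstract r)"
  by (simp add: state_after_def)

lemma within_alphabet_state_after: "within_alphabet (state_after h)"
proof (induction h rule: rev_induct)
  case Nil show ?case by (simp add: init_state_def within_alphabet_def)
qed (simp add: within_alphabet_respond)

lemma prefixes_state_after: "prefixes (fst (state_after h)) \<noteq> []"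
  using within_alphabet_state_after by (simp add: within_alphabet_def)

lemma set_hyp_finals:
  "set (hyp_finals T) = {i. i < length (prefixes T) \<and> positive T (prefixes T ! i)}"
  by (auto simp: hyp_finals_def nth_default_nth)

lemma complete_dfa_hyp: "prefixes T \<noteq> [] \<Longrightarrow> complete_dfa \<Sigma> (regs T) (hyp T)"
  unfolding hyp_def using fin
  by (intro complete_dfa_dfa_of) (auto simp: successor_less set_hyp_finals)

lemma session_automaton_hyp: "prefixes T \<noteq> [] \<Longrightarrow> session_automaton \<Sigma> (hyp T)"
  using complete_dfa_hyp by (simp add: complete_dfa_def)

lemma sym_lang_hyp:
  assumes "prefixes T \<noteq> []"
  shows "sym_lang (hyp T) = {u \<in> lists (\<Sigma> \<times> Gam (regs T)). relabel \<alpha> u \<in> hyp_lang T}"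
proof -
  let ?\<delta> = "\<lambda>i x. successor T i (apfst \<alpha> x)"
  have "foldl ?\<delta> i u = fold (\<lambda>x i. successor T i x) (relabel \<alpha> u) i" for i u
    by (induction u arbitrary: i) simp_all
  then have reached: "foldl ?\<delta> 0 u = reached T (relabel \<alpha> u)" for u
    by (simp add: reached_def)
  have "sym_lang (hyp T) = {u \<in> lists (\<Sigma> \<times> Gam (regs T)). foldl ?\<delta> 0 u \<in> set (hyp_finals T)}"
    unfolding hyp_def using assms by (intro sym_lang_dfa_of) (auto simp: successor_less)
  also have "\<dots> = {u \<in> lists (\<Sigma> \<times> Gam (regs T)). accepts T (relabel \<alpha> u)}"
    using assms by (simp add: reached set_hyp_finals accepts_def access_nth reached_less)
  also have "\<dots> = {u \<in> lists (\<Sigma> \<times> Gam (regs T)). relabel \<alpha> u \<in> hyp_lang T}"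
    using relabel_in_lists[OF _ \<alpha>_in] by (auto simp: hyp_lang_def simp del: in_lists_conv_set)
  finally show ?thesis .
qed

lemma hyp_lang_eq_image:
  assumes "prefixes T \<noteq> []"
  shows "hyp_lang T = relabel \<alpha> ` sym_lang (hyp T)"
proof (intro set_eqI iffI)
  fix u assume u: "u \<in> hyp_lang T"
  then have letters: "u \<in> lists (symbols (regs T))" by (simp add: hyp_lang_def)
  have "relabel \<beta> u \<in> sym_lang (hyp T)"
    using u relabel_in_lists[OF letters \<beta>_in] relabel_\<alpha>_\<beta>[OF letters]
    unfolding sym_lang_hyp[OF assms] by simp
  then show "u \<in> relabel \<alpha> ` sym_lang (hyp T)" using relabel_\<alpha>_\<beta>[OF letters] by (metis imageI)
qed (auto simp: sym_lang_hyp[OF assms])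

lemma set_hyp_transitions:
  "set (hyp_transitions T) =
    {(i, x, successor T i x) | i x. i < length (prefixes T) \<and> x \<in> symbols (regs T)}"
  by (force simp: hyp_transitions_def set_letters)

lemma transitions_hyp:
  "transitions (hyp T) = set (map (\<lambda>(i, x, j). (i, apfst \<beta> x, j)) (hyp_transitions T))"
proof -
  have "transitions (hyp T) = {(i, x, successor T i (apfst \<alpha> x)) | i x.
      i < length (prefixes T) \<and> x \<in> \<Sigma> \<times> Gam (regs T)}"
    by (simp add: hyp_def dfa_of_def)
  also have "\<dots> = {(i, apfst \<beta> x, successor T i x) | i x.
      i < length (prefixes T) \<and> x \<in> symbols (regs T)}" (is "?L = ?R")
  proof (intro set_eqI iffI)
    fix t assume "t \<in> ?L"
    then obtain i a \<pi> where t: "t = (i, (a, \<pi>), successor T i (\<alpha> a, \<pi>))"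
      "i < length (prefixes T)" "a \<in> \<Sigma>" "\<pi> \<in> Gam (regs T)" by auto
    then show "t \<in> ?R" using \<beta>_\<alpha> \<alpha>_in by (intro CollectI exI[of _ i] exI[of _ "(\<alpha> a, \<pi>)"]) auto
  next
    fix t assume "t \<in> ?R"
    then obtain i a \<pi> where t: "t = (i, (\<beta> a, \<pi>), successor T i (a, \<pi>))"
      "i < length (prefixes T)" "a < n" "\<pi> \<in> Gam (regs T)" by auto
    then show "t \<in> ?L" using \<alpha>_\<beta> \<beta>_in by (intro CollectI exI[of _ i] exI[of _ "(\<beta> a, \<pi>)"]) auto
  qed
  also have "\<dots> = set (map (\<lambda>(i, x, j). (i, apfst \<beta> x, j)) (hyp_transitions T))"
    unfolding set_map set_hyp_transitions by force
  finally show ?thesis .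
qed

lemma enc_list_enc_nat: "enc_list enc_nat xs = sexp_of xs"
  unfolding sexp_of_list_def by (rule enc_list_cong) (simp add: sexp_of_nat_def)

lemma enc_hyp_transitions:
  "enc_list (enc_transition \<alpha>) (map (\<lambda>(i, x, j). (i, apfst \<beta> x, j)) (hyp_transitions T)) =
    sexp_of (map transition_code (hyp_transitions T))"
  unfolding sexp_of_list_def enc_list_map
proof (rule enc_list_cong)
  fix t assume "t \<in> set (hyp_transitions T)"
  then obtain i a \<pi> j where "t = (i, (a, \<pi>), j)" "a < n" unfolding set_hyp_transitions by auto
  then show "enc_transition \<alpha> (case t of (i, x, j) \<Rightarrow> (i, apfst \<beta> x, j)) =
      sexp_of (transition_code t)"
    using \<alpha>_\<beta>
    by (simp add: enc_transition_def transition_code_def sexp_of_nat_def sexp_of_reg_op_def)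
qed

lemma codes_hyp: "codes_automaton \<alpha> (hyp_code T) (hyp T)"
proof -
  have "set [0..<length (prefixes T)] = states (hyp T)" "set (hyp_finals T) = finals (hyp T)"
    by (auto simp: hyp_def dfa_of_def)
  from codes_automaton.intros[OF this transitions_hyp[symmetric], of \<alpha>] show ?thesis
    by (simp add: hyp_code_def enc_hyp_transitions enc_list_enc_nat)
      (simp add: hyp_def dfa_of_def sexp_of_nat_def)
qed

lemma enc_word_eq: "enc_word \<alpha> w = sexp_of (relabel \<alpha> w)"
  unfolding enc_word_def sexp_of_list_def enc_list_map
  by (rule enc_list_cong) (auto simp: sexp_of_nat_def)

lemma denotation_in_lists: "u \<in> lists (A \<times> X) \<Longrightarrow> denotation u \<in> lists (A \<times> UNIV)"
  by (induction u rule: rev_induct) auto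

abbreviation data_query :: "sword \<Rightarrow> ('a \<times> 'd) list" where
  "data_query u \<equiv> map (map_prod id \<nu>) (query_word u)"

lemma data_query_in_lists:
  assumes "u \<in> nat_words"
  shows "data_query u \<in> lists (\<Sigma> \<times> D)"
proof -
  have "query_word u \<in> lists (\<Sigma> \<times> UNIV)"
    unfolding query_word_def by (rule relabel_in_lists[OF denotation_in_lists[OF assms] \<beta>_in])
  then show ?thesis by (rule map_prod_in_lists) (use \<nu>(2) in simp_all)
qed

lemma codes_act:
  assumes "within_alphabet \<sigma>"
  shows "codes_action \<alpha> (action_code \<sigma>) (act \<sigma>)"
proof (cases "query \<sigma>")
  case (Some u)
  have "relabel \<alpha> (query_word u) = denotation u"
    unfolding query_word_def
    by (rule relabel_\<alpha>_\<beta>[OF denotation_in_lists[OF within_alphabet_query[OF assms Some]]])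
  then show ?thesis
    using Some codes_action.intros(1)[of \<alpha> "query_word u"]
    by (simp add: action_code_def act_def enc_word_eq)
next
  case None
  then show ?thesis
    using codes_action.intros(2,3)[OF codes_hyp, of "fst \<sigma>"]
    by (simp add: action_code_def act_def)
qed

lemma algorithm_learner: "algorithm \<Sigma> D learner"
proof -
  obtain F where F: "computable F"
    "\<And>h. F (sexp_of h) = action_code (fold (\<lambda>r \<sigma>. respond \<sigma> r) h init_state)"
    using effective_learner unfolding effective_def by auto
  have "enc_answer \<alpha> r = sexp_of (abstract r)" for r :: "('a, 'd) answer"
    by (cases r) (simp_all add: enc_word_eq sexp_of_bool_def)
  then have "enc_list (enc_answer \<alpha>) h = sexp_of (map abstract h)" for h :: "('a, 'd) answer list"
    unfolding sexp_of_list_def enc_list_map by (intro enc_list_cong)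
  then have "codes_action \<alpha> (F (enc_list (enc_answer \<alpha>) h)) (act (state_after h))" for h
    using codes_act[OF within_alphabet_state_after] by (simp add: F(2) state_after_def)
  moreover have "inj_on \<alpha> \<Sigma>" using \<alpha> by (simp add: bij_betw_def)
  ultimately show ?thesis
    unfolding algorithm_def learner_def using \<nu> F(1) by blast
qed

lemma admissible_learner: "admissible \<Sigma> D (learner h)"
proof (cases "query (state_after h)")
  case (Some u)
  then show ?thesis
    using data_query_in_lists[OF within_alphabet_query[OF within_alphabet_state_after Some]]
    by (simp add: learner_def act_def)
next
  case None
  then show ?thesis
    using session_automaton_hyp[OF prefixes_state_after, of h] by (simp add: learner_def act_def)
qed

lemma learner_eq_MemberD:
  assumes "learner h = Member w"
  obtains u where "query (state_after h) = Some u" "w = data_query u" "u \<in> nat_words"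
    "snd (state_after h) \<noteq> Finished"
proof -
  obtain u where u: "query (state_after h) = Some u" "w = data_query u"
    using assms by (auto simp: learner_def act_def split: option.splits if_splits)
  moreover have "snd (state_after h) \<noteq> Finished"
    using u(1) by (auto simp: query_def split: prod.splits)
  ultimately show thesis
    using that within_alphabet_query[OF within_alphabet_state_after u(1)] by blast
qed

lemma learner_eq_EquivD:
  assumes "learner h = Equiv H"
  obtains T where "state_after h = (T, Exploring)" "H = hyp T" "closed_table T"
    "prefixes T \<noteq> []" "\<And>u. u \<in> hyp_lang T \<Longrightarrow> normal_form u"
proof -
  obtain T p where \<sigma>: "state_after h = (T, p)" by (cases "state_after h")
  have "query (T, p) = None" "p \<noteq> Finished" "H = hyp T"
    using assms by (auto simp: learner_def act_def \<sigma> split: option.splits if_splits)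
  moreover note query_NoneD[OF this(1,2)]
  moreover have "prefixes T \<noteq> []" using prefixes_state_after[of h] by (simp add: \<sigma>)
  ultimately show thesis using that \<sigma> hyp_lang_normal_form by blast
qed

lemma learner_eq_OutputD:
  assumes "learner h = Output H"
  obtains T where "state_after h = (T, Finished)" "H = hyp T" "prefixes T \<noteq> []"
proof -
  obtain T p where \<sigma>: "state_after h = (T, p)" by (cases "state_after h")
  have "p = Finished" "H = hyp T"
    using assms by (auto simp: learner_def act_def \<sigma> split: option.splits if_splits)
  then show thesis using that \<sigma> prefixes_state_after[of h] by simp
qed

lemma normalize_pattern:
  assumes "w \<in> lists (\<Sigma> \<times> D)"
  shows "normalize (relabel \<alpha> (pattern w)) = relabel \<alpha> (snf w)"
  using normalize_denotation[of "relabel \<alpha> (snf w)"] relabel_in_lists[OF snf_letters[OF assms] \<alpha>_in]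
  by (simp add: normal_form_relabel normal_form_snf denotation_relabel denotation_snf)

lemma snf_hyp:
  assumes "prefixes T \<noteq> []" "\<And>u. u \<in> hyp_lang T \<Longrightarrow> normal_form u"
  shows "snf ` data_lang \<Sigma> D (hyp T) = sym_lang (hyp T)"
proof (rule snf_data_lang_normal[OF inf session_automaton_hyp[OF assms(1)]])
  show "normal_form z" if "z \<in> sym_lang (hyp T)" for z
    using that assms(2) normal_form_relabel by (auto simp: sym_lang_hyp[OF assms(1)])
qed

lemma relabel_snf_in_hyp_lang_iff:
  assumes "prefixes T \<noteq> []" "\<And>u. u \<in> hyp_lang T \<Longrightarrow> normal_form u" "w \<in> lists (\<Sigma> \<times> D)"
  shows "relabel \<alpha> (snf w) \<in> hyp_lang T \<longleftrightarrow> w \<in> data_lang \<Sigma> D (hyp T)"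
proof -
  have "sym_lang (hyp T) \<subseteq> lists (\<Sigma> \<times> UNIV)"
    using lists_Times_UNIV unfolding sym_lang_hyp[OF assms(1)] by blast
  then have "relabel \<alpha> (snf w) \<in> hyp_lang T \<longleftrightarrow> snf w \<in> sym_lang (hyp T)"
    unfolding hyp_lang_eq_image[OF assms(1)]
    by (intro inj_on_image_mem_iff[OF inj_on_relabel_\<alpha>] snf_letters[OF assms(3)])
  also have "\<dots> \<longleftrightarrow> w \<in> data_lang \<Sigma> D (hyp T)"
    using data_lang_iff_snf[of w \<Sigma> D "hyp T"] assms(3) snf_hyp[OF assms(1,2)] by simp
  finally show ?thesis .
qed

end

locale session_target = session_learner \<Sigma> D \<alpha> \<nu>
  for \<Sigma> :: "'a set" and D :: "'d set" and \<alpha> :: "'a \<Rightarrow> nat" and \<nu> :: "nat \<Rightarrow> 'd" +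
  fixes A :: "('s, 'a) session_automaton"
  assumes A: "session_automaton \<Sigma> A"
begin

abbreviation L where "L \<equiv> data_lang \<Sigma> D A"
abbreviation k where "k \<equiv> snf_registers \<Sigma> L"
abbreviation N where "N \<equiv> canonical_size \<Sigma> L"
abbreviation K where "K \<equiv> relabel \<alpha> ` (snf ` L)"

lemma snf_L_letters: "snf ` L \<subseteq> lists (\<Sigma> \<times> Gam k)"
  by (rule snf_registers_subset[OF inf A])

lemma snf_L_letters_UNIV: "snf ` L \<subseteq> lists (\<Sigma> \<times> UNIV)"
  using snf_L_letters lists_Times_UNIV by blast

lemma minimal_dfa:
  obtains B :: "(nat, 'a) session_automaton"
    where "complete_dfa \<Sigma> k B" "sym_lang B = snf ` L" "card (states B) = N"
proof -
  obtain B :: "(nat, 'a) session_automaton" where "complete_dfa \<Sigma> k B" "sym_lang B = snf ` L"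
    using snf_data_lang_regular[OF fin inf A snf_L_letters] by blast
  then have "\<exists>m. \<exists>B :: (nat, 'a) session_automaton.
      complete_dfa \<Sigma> k B \<and> sym_lang B = snf ` L \<and> card (states B) = m"
    by blast
  from LeastI_ex[OF this] show thesis
    by (elim exE conjE) (rule that, simp_all add: canonical_size_def min_dfa_size_def)
qed

lemma N_le:
  fixes B :: "(nat, 'a) session_automaton"
  assumes "complete_dfa \<Sigma> k B" "sym_lang B = snf ` L"
  shows "N \<le> card (states B)"
  unfolding canonical_size_def min_dfa_size_def by (rule Least_le) (use assms in blast)

lemma N_pos: "0 < N"
  by (rule minimal_dfa) (metis card_gt_0_iff complete_dfa_def empty_iff session_automaton_def)

lemma k_le_N: "k \<le> N"
  by (rule minimal_dfa) (metis snf_registers_le_states[OF snf_L_letters])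

lemma relabel_in_K_iff: "u \<in> lists (\<Sigma> \<times> UNIV) \<Longrightarrow> relabel \<alpha> u \<in> K \<longleftrightarrow> u \<in> snf ` L"
  by (rule inj_on_image_mem_iff[OF inj_on_relabel_\<alpha> _ snf_L_letters_UNIV])

lemma in_K_iff:
  assumes "v \<in> nat_words"
  shows "v \<in> K \<longleftrightarrow> relabel \<beta> v \<in> snf ` L"
  using relabel_in_K_iff[OF relabel_in_lists[OF assms \<beta>_in]] relabel_\<alpha>_\<beta>[OF assms] by simp

lemma K_letters: "K \<subseteq> lists (symbols k)"
  using relabel_in_lists[OF _ \<alpha>_in] snf_L_letters by blast

lemma distinguishable_relabel_\<beta>:
  assumes "distinguishable K u v" "u \<in> lists (symbols k)" "v \<in> lists (symbols k)"
  shows "distinguishable (snf ` L) (relabel \<beta> u) (relabel \<beta> v)"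
proof -
  obtain z where z: "(u @ z \<in> K) \<noteq> (v @ z \<in> K)" using assms(1) by (auto simp: distinguishable_def)
  then have "u @ z \<in> lists (symbols k) \<or> v @ z \<in> lists (symbols k)" using K_letters by blast
  then have "z \<in> lists (symbols k)" unfolding append_in_lists_conv by blast
  then have "u @ z \<in> nat_words" "v @ z \<in> nat_words"
    using assms(2,3) by (auto intro!: lists_Times_UNIV[of _ _ "Gam k"])
  from this[THEN in_K_iff] z show ?thesis
    unfolding distinguishable_def by (intro exI[of _ "relabel \<beta> z"]) simp
qed

lemma card_distinguishable_le_N:
  assumes W: "W \<subseteq> lists (symbols k)" and dist: "pairwise (distinguishable K) W"
  shows "card W \<le> N"
proof -
  obtain B :: "(nat, 'a) session_automaton"
    where B: "complete_dfa \<Sigma> k B" "sym_lang B = snf ` L" "card (states B) = N"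
    by (rule minimal_dfa)
  have "inj_on (relabel \<beta>) W"
    using W relabel_\<alpha>_\<beta> by (intro inj_on_inverseI[of _ "relabel \<alpha>"]) blast
  then have "card W = card (relabel \<beta> ` W)" by (simp add: card_image)
  also have "\<dots> \<le> card (states B)"
  proof (rule card_distinguishable_le_states[OF B(1)])
    show "relabel \<beta> ` W \<subseteq> lists (\<Sigma> \<times> Gam k)" using W relabel_in_lists[OF _ \<beta>_in] by blast
    show "pairwise (distinguishable (sym_lang B)) (relabel \<beta> ` W)"
      unfolding B(2) pairwise_def
    proof (intro ballI impI)
      fix u' v' assume "u' \<in> relabel \<beta> ` W" "v' \<in> relabel \<beta> ` W" "u' \<noteq> v'"
      then obtain u v where uv: "u \<in> W" "v \<in> W" "u \<noteq> v" "u' = relabel \<beta> u" "v' = relabel \<beta> v"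
        by blast
      then have "distinguishable K u v" using dist by (simp add: pairwise_def)
      then show "distinguishable (snf ` L) u' v'"
        using distinguishable_relabel_\<beta> W uv(1,2) unfolding uv(4,5) by blast
    qed
  qed
  finally show ?thesis using B(3) by simp
qed

lemma snf_data_query:
  assumes "u \<in> nat_words" "normal_form u"
  shows "snf (data_query u) = relabel \<beta> u"
proof -
  have nf: "normal_form (relabel \<beta> u)" using assms(2) by (simp add: normal_form_relabel)
  have "pattern (data_query u) = pattern (denotation (relabel \<beta> u))"
    unfolding query_word_def pattern_map_prod[OF \<nu>(1)] denotation_relabel by simp
  also have "\<dots> = denotation (relabel \<beta> u)"
    by (rule pattern_denotation[OF normal_form_imp_well_formed[OF nf]])
  finally show ?thesis using nf by (metis eq_snf_iff)
qed

lemma data_query_in_L_iff: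
  assumes "u \<in> nat_words" "normal_form u"
  shows "data_query u \<in> L \<longleftrightarrow> u \<in> K"
  using data_lang_iff_snf[of "data_query u" \<Sigma> D A]
    data_query_in_lists[OF assms(1)] snf_data_query[OF assms] in_K_iff[OF assms(1)] by simp

lemma hyp_lang_eq_K_iff:
  assumes "prefixes T \<noteq> []"
  shows "hyp_lang T = K \<longleftrightarrow> sym_lang (hyp T) = snf ` L"
proof -
  have "sym_lang (hyp T) \<subseteq> lists (\<Sigma> \<times> UNIV)"
    using lists_Times_UNIV unfolding sym_lang_hyp[OF assms] by blast
  then show ?thesis
    unfolding hyp_lang_eq_image[OF assms]
    by (rule inj_on_image_eq_iff[OF inj_on_relabel_\<alpha> _ snf_L_letters_UNIV])
qed

lemma normalized_counterexample:
  assumes T: "prefixes T \<noteq> []" "\<And>u. u \<in> hyp_lang T \<Longrightarrow> normal_form u"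
    and w: "w \<in> (data_lang \<Sigma> D (hyp T) - L) \<union> (L - data_lang \<Sigma> D (hyp T))"
  defines "v \<equiv> normalize (relabel \<alpha> (pattern w))"
  shows "(v \<in> K) \<noteq> (v \<in> hyp_lang T)" "length v = length w"
proof -
  have letters: "w \<in> lists (\<Sigma> \<times> D)" using w by (auto simp: data_lang_iff)
  have v: "v = relabel \<alpha> (snf w)" by (simp add: v_def normalize_pattern[OF letters])
  then show "length v = length w"
    using denotation_eq_pattern_length[OF denotation_snf[of w]] by simp
  have "v \<in> K \<longleftrightarrow> w \<in> L"
    unfolding v relabel_in_K_iff[OF snf_letters[OF letters]]
    using data_lang_iff_snf letters by blast
  moreover have "v \<in> hyp_lang T \<longleftrightarrow> w \<in> data_lang \<Sigma> D (hyp T)"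
    unfolding v by (rule relabel_snf_in_hyp_lang_iff[OF T letters])
  ultimately show "(v \<in> K) \<noteq> (v \<in> hyp_lang T)" using w by blast
qed

lemma hyp_correct:
  assumes "prefixes T \<noteq> []" "hyp_lang T = K"
  shows "sym_lang (hyp T) = snf ` L" "data_lang \<Sigma> D (hyp T) = L"
proof -
  have normal: "normal_form u" if "u \<in> hyp_lang T" for u
    using that normal_form_snf normal_form_relabel unfolding assms(2) by blast
  show "sym_lang (hyp T) = snf ` L" using hyp_lang_eq_K_iff[OF assms(1)] assms(2) by simp
  then have "snf ` data_lang \<Sigma> D (hyp T) = snf ` L" using snf_hyp[OF assms(1) normal] by simp
  then show "data_lang \<Sigma> D (hyp T) = L"
    using data_lang_iff_snf[of _ \<Sigma> D "hyp T"] data_lang_iff_snf[of _ \<Sigma> D A] by blast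
qed

lemma canonical_hyp:
  assumes T: "prefixes T \<noteq> []" "hyp_lang T = K" and le: "regs T \<le> k" "length (prefixes T) \<le> N"
  shows "canonical \<Sigma> L (hyp T)"
proof -
  note lang = hyp_correct(1)[OF T]
  have "snf ` L \<subseteq> lists (\<Sigma> \<times> Gam (regs T))"
    unfolding lang[symmetric] sym_lang_hyp[OF T(1)] by blast
  then have "k \<le> regs T" unfolding snf_registers_def by (rule Least_le)
  then have dfa: "complete_dfa \<Sigma> k (hyp T)" using complete_dfa_hyp[OF T(1)] le(1) by simp
  have "card (states (hyp T)) = length (prefixes T)" by (simp add: hyp_def dfa_of_def)
  then have "card (states (hyp T)) = N" using N_le[OF dfa lang] le(2) by simp
  then show ?thesis using dfa lang by (simp add: canonical_def)
qed

end

locale bounded_session_target = session_target \<Sigma> D \<alpha> \<nu> A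
  for \<Sigma> :: "'a set" and D :: "'d set" and \<alpha> :: "'a \<Rightarrow> nat" and \<nu> :: "nat \<Rightarrow> 'd"
    and A :: "('s, 'a) session_automaton" +
  fixes Q :: nat
  assumes Q: "N * Suc (4 ^ k) \<le> 2 ^ Q"
begin

sublocale learning_target "card \<Sigma>" k N Q K
proof
  show "normal_form u" if "u \<in> K" for u
    using that normal_form_snf by (auto simp: normal_form_relabel)
qed (use n_pos K_letters card_distinguishable_le_N Q in blast)+

lemma invariant_member:
  assumes inv: "invariant (state_after h) mq ce" and w: "learner h = Member w"
  shows "invariant (state_after (h @ [Truth (w \<in> L)])) (Suc mq) ce"
proof -
  obtain u where u: "query (state_after h) = Some u" "w = data_query u" "u \<in> nat_words"
    using learner_eq_MemberD[OF w] by blast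
  have "w \<in> L \<and> normal_form u \<longleftrightarrow> u \<in> K"
    using data_query_in_L_iff[OF u(3)] K_normal_form u(2) by blast
  then show ?thesis using invariant_process_truth[OF inv u(1)] by (simp add: respond_def u(1))
qed

lemma invariant_yes:
  assumes inv: "invariant (state_after h) mq ce" and H: "learner h = Equiv H" "data_lang \<Sigma> D H = L"
  shows "invariant (state_after (h @ [Yes])) mq ce"
proof -
  obtain T where T: "state_after h = (T, Exploring)" "H = hyp T"
    "prefixes T \<noteq> []" "\<And>u. u \<in> hyp_lang T \<Longrightarrow> normal_form u"
    using learner_eq_EquivD[OF H(1)] by metis
  have "hyp_lang T = K"
    using hyp_lang_eq_K_iff[OF T(3)] snf_hyp[OF T(3,4)] H(2) T(2) by simp
  then show ?thesis using inv T(1) by (simp add: respond_def)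
qed

lemma invariant_counterexample:
  assumes inv: "invariant (state_after h) mq ce" and H: "learner h = Equiv H"
    and w: "w \<in> (data_lang \<Sigma> D H - L) \<union> (L - data_lang \<Sigma> D H)" "length w \<le> 2 ^ Q"
  shows "invariant (state_after (h @ [Counterexample w])) mq (Suc ce)"
proof -
  obtain T where T: "state_after h = (T, Exploring)" "H = hyp T" "closed_table T"
    "prefixes T \<noteq> []" "\<And>u. u \<in> hyp_lang T \<Longrightarrow> normal_form u"
    using learner_eq_EquivD[OF H] by metis
  note v = normalized_counterexample[OF T(4,5) w(1)[unfolded T(2)]]
  show ?thesis
    using invariant_process_counterexample[OF _ T(3) v(1)] inv v(2) w(2) T(1)
    by (simp add: respond_def)
qed

lemma dialogue_invariant:
  assumes "dialogue \<Sigma> D L learner h" "\<And>w. Counterexample w \<in> set h \<Longrightarrow> length w \<le> 2 ^ Q"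
  shows "invariant (state_after h) (member_queries h) (cex_count h)"
  using assms
proof (induction rule: dialogue.induct)
  case start
  show ?case using invariant_init by simp
next
  case (member h w)
  then show ?case using invariant_member by simp
next
  case (equiv_yes h H)
  then show ?case using invariant_yes by simp
next
  case (equiv_no h H w)
  then show ?case using invariant_counterexample by simp
qed

end

context session_target
begin

lemma equiv_queries_eq:
  assumes "dialogue \<Sigma> D L learner h"
  shows "equiv_queries h = cex_count h + of_bool (snd (state_after h) = Finished)"
  using assms
proof (induction rule: dialogue.induct)
  case start
  show ?case by (simp add: init_state_def)
next
  case (member h w)
  then have "snd (state_after h) \<noteq> Finished" by (metis learner_eq_MemberD)
  then show ?case using member.IH by (simp add: respond_def process_truth_Finished_iff)
next
  case (equiv_yes h H)
  then have "snd (state_after h) \<noteq> Finished" by (metis learner_eq_EquivD phase.distinct(3) snd_conv)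
  then show ?case using equiv_yes.IH by (simp add: respond_def)
next
  case (equiv_no h H w)
  then have "snd (state_after h) \<noteq> Finished" by (metis learner_eq_EquivD phase.distinct(3) snd_conv)
  then show ?case using equiv_no.IH process_counterexample_not_Finished by (simp add: respond_def)
qed

lemma bounded_session_targetI:
  assumes "N + 2 * k + 1 \<le> Q"
  shows "bounded_session_target \<Sigma> D \<alpha> \<nu> A Q"
proof
  have "Suc (4 ^ k) \<le> 2 * (2 ^ 2) ^ k" using one_le_power[of "4 :: nat" k] by simp
  also have "\<dots> = 2 ^ (2 * k + 1)" by (simp add: power_mult)
  finally have "N * Suc (4 ^ k) \<le> 2 ^ N * 2 ^ (2 * k + 1)"
    by (intro mult_mono) (simp_all add: less_imp_le)
  also have "\<dots> = 2 ^ (N + 2 * k + 1)" by (simp only: power_add mult.assoc)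
  also have "\<dots> \<le> 2 ^ Q" using assms by (intro power_increasing) simp_all
  finally show "N * Suc (4 ^ k) \<le> 2 ^ Q" .
qed

lemma dialogue_bounds:
  assumes h: "dialogue \<Sigma> D L learner h" and q: "\<And>w. Counterexample w \<in> set h \<Longrightarrow> length w \<le> 2 ^ q"
  shows "member_queries h \<le> 1 + 4 * n * k * N ^ 2 + N * (q + N + 2 * k + 3)"
    "k = 0 \<Longrightarrow> member_queries h = 0" "cex_count h \<le> N + k + 1" "equiv_queries h \<le> N + k + 2"
proof -
  define Q where "Q = q + (N + 2 * k + 1)"
  interpret bounded_session_target \<Sigma> D \<alpha> \<nu> A Q
    by (rule bounded_session_targetI) (simp add: Q_def)
  obtain T p where \<sigma>: "state_after h = (T, p)" by (cases "state_after h")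
  have "(2 :: nat) ^ q \<le> 2 ^ Q" by (intro power_increasing) (simp_all add: Q_def)
  then have "length w \<le> 2 ^ Q" if "Counterexample w \<in> set h" for w
    using q[OF that] by (rule order_trans[rotated])
  then have inv: "invariant (T, p) (member_queries h) (cex_count h)"
    using dialogue_invariant[OF h] by (simp add: \<sigma>)
  note sound = invariant_sound[OF inv] and costs = invariant_costs[OF inv]
  show "k = 0 \<Longrightarrow> member_queries h = 0" using costs(3) regs_le[OF sound] by simp
  show "cex_count h \<le> N + k + 1" using costs(1) progress_le[OF sound] by (rule order_trans)
  then show "equiv_queries h \<le> N + k + 2" using equiv_queries_eq[OF h] by (simp add: of_bool_def)
  have "member_queries h \<le> 1 + N * (2 * n * k * (N * 2)) + N * (Q + 2)"
    using costs(2) budget_le[OF sound] by (rule order_trans)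
  then show "member_queries h \<le> 1 + 4 * n * k * N ^ 2 + N * (q + N + 2 * k + 3)"
    by (simp add: Q_def algebra_simps power2_eq_square)
qed

lemma length_le_power_max_counterexample:
  "Counterexample w \<in> set h \<Longrightarrow> length w \<le> 2 ^ max_counterexample h"
  using length_le_max_counterexample[of w h] less_exp[of "max_counterexample h"] by linarith

lemma output_correct:
  assumes h: "dialogue \<Sigma> D L learner h" and H: "learner h = Output H"
  shows "data_lang \<Sigma> D H = L" "canonical \<Sigma> L H"
proof -
  define Q where "Q = max_counterexample h + (N + 2 * k + 1)"
  interpret bounded_session_target \<Sigma> D \<alpha> \<nu> A Q
    by (rule bounded_session_targetI) (simp add: Q_def)
  have "(2 :: nat) ^ max_counterexample h \<le> 2 ^ Q"
    by (intro power_increasing) (simp_all add: Q_def)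
  then have "length w \<le> 2 ^ Q" if "Counterexample w \<in> set h" for w
    using length_le_power_max_counterexample[OF that] by (rule order_trans[rotated])
  then have inv: "invariant (state_after h) (member_queries h) (cex_count h)"
    by (rule dialogue_invariant[OF h])
  obtain T where T: "state_after h = (T, Finished)" "H = hyp T" "prefixes T \<noteq> []"
    using learner_eq_OutputD[OF H] by metis
  have sound: "sound T" and lang: "hyp_lang T = K" using inv by (simp_all add: T(1) settled_def)
  show "data_lang \<Sigma> D H = L" unfolding T(2) by (rule hyp_correct(2)[OF T(3) lang])
  show "canonical \<Sigma> L H"
    unfolding T(2)
    by (rule canonical_hyp[OF T(3) lang regs_le[OF sound] length_prefixes_le[OF sound]])
qed

lemma finite_counterexamples:
  assumes f: "\<And>m. dialogue \<Sigma> D L learner (map f [0..<m])"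
  shows "finite {i. \<exists>w. f i = Counterexample w}" (is "finite ?I")
proof -
  have "card G \<le> N + k + 1" if G: "G \<subseteq> ?I" "finite G" for G
  proof -
    obtain m where m: "G \<subseteq> {..<m}" using finite_nat_set_iff_bounded[of G] G(2) by blast
    have "card G \<le> card ({..<m} \<inter> ?I)" using m G(1) by (intro card_mono) auto
    also have "\<dots> = cex_count (map f [0..<m])"
      by (simp add: cex_count_def filter_map o_def distinct_length_filter Int_commute
          lessThan_atLeast0)
    also have "\<dots> \<le> N + k + 1"
      by (rule dialogue_bounds(3)[OF f length_le_power_max_counterexample])
    finally show ?thesis .
  qed
  then show ?thesis using finite_if_finite_subsets_card_bdd by blast
qed

lemma no_infinite_dialogue:
  "\<nexists>f :: nat \<Rightarrow> ('a, 'd) answer. \<forall>m. dialogue \<Sigma> D L learner (map f [0..<m])"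
proof
  assume "\<exists>f :: nat \<Rightarrow> ('a, 'd) answer. \<forall>m. dialogue \<Sigma> D L learner (map f [0..<m])"
  then obtain f :: "nat \<Rightarrow> ('a, 'd) answer" where f: "\<And>m. dialogue \<Sigma> D L learner (map f [0..<m])"
    by blast
  let ?size = "\<lambda>r :: ('a, 'd) answer. case r of Counterexample w \<Rightarrow> length w | _ \<Rightarrow> 0"
  define q where "q = (\<Sum>i | \<exists>w. f i = Counterexample w. ?size (f i))"
  have q: "length w \<le> 2 ^ q" if "Counterexample w \<in> set (map f [0..<m])" for w m
  proof -
    from that obtain i where i: "f i = Counterexample w" by force
    then have "?size (f i) \<le> q"
      unfolding q_def using finite_counterexamples[OF f] by (intro member_le_sum) auto
    also have "q \<le> 2 ^ q" by (simp add: less_imp_le)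
    finally show ?thesis using i by simp
  qed
  define b where "b = 1 + 4 * n * k * N ^ 2 + N * (q + N + 2 * k + 3) + (N + k + 2)"
  have "length (map f [0..<Suc b]) \<le> b"
    unfolding length_eq_queries b_def by (intro add_mono dialogue_bounds(1,4)[OF f q])
  then show False by simp
qed

end

lemma power_of_two_above:
  assumes "1 \<le> M"
  obtains q where "M \<le> 2 ^ q" "real q \<le> log 2 (real M) + 1"
proof
  let ?q = "nat \<lceil>log 2 (real M)\<rceil>"
  have M: "1 \<le> real M" using assms by simp
  then have log: "0 \<le> log 2 (real M)" by simp
  then show "real ?q \<le> log 2 (real M) + 1" by linarith
  have "real M = 2 powr log 2 (real M)" using M by simp
  also have "\<dots> \<le> 2 powr real ?q" using log by (intro powr_mono) linarith+
  also have "\<dots> = real (2 ^ ?q)" by (simp add: powr_realpow)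
  finally show "M \<le> 2 ^ ?q" by (simp only: of_nat_le_iff)
qed

lemma query_bound_absorbs_lower_terms:
  fixes k n N l q :: real
  assumes "1 \<le> k" "1 \<le> n" "1 \<le> N" "0 \<le> l" "q \<le> l + 1"
  shows "1 + 4 * n * k * N ^ 2 + N * (q + N + 2 * k + 3) \<le> 12 * (k * n * N ^ 2 + N * l)"
proof -
  let ?P = "k * n * N ^ 2"
  have kn: "k \<le> k * n" "1 \<le> k * n"
    using mult_left_mono[of 1 n k] mult_mono[of 1 k 1 n] assms(1,2) by simp_all
  have N: "N \<le> N ^ 2" using assms(3) by (simp add: power2_eq_square mult_le_cancel_left1)
  have "N ^ 2 \<le> ?P" using kn(2) by (simp add: mult_le_cancel_right1)
  moreover have "k * N \<le> ?P" using kn(1) N assms(1,3) by (intro mult_mono) simp_all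
  moreover have "N * q \<le> N * l + N"
    using mult_left_mono[OF assms(5), of N] assms(3) by (simp add: algebra_simps)
  moreover have "0 \<le> N * l" using assms(3,4) by simp
  ultimately have "1 + 4 * ?P + N * q + N ^ 2 + 2 * (k * N) + 3 * N \<le> 12 * ?P + 12 * (N * l)"
    using N assms(3) by linarith
  then show ?thesis by (simp add: algebra_simps power2_eq_square)
qed

context session_target
begin

lemma equiv_queries_bound:
  assumes "dialogue \<Sigma> D L learner h"
  shows "real (equiv_queries h) \<le> 12 * real N"
proof -
  have "real (equiv_queries h) \<le> real (N + k + 2)"
    unfolding of_nat_le_iff
    by (rule dialogue_bounds(4)[OF assms length_le_power_max_counterexample])
  then show ?thesis using N_pos k_le_N by simp
qed

lemma member_queries_bound:
  assumes h: "dialogue \<Sigma> D L learner h"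
  shows "real (member_queries h) \<le> 12 * (real k * real n * real N ^ 2
      + real N * log 2 (real (max 1 (max_counterexample h))))"
proof (cases "k = 0")
  case True
  then show ?thesis using dialogue_bounds(2)[OF h length_le_power_max_counterexample] by simp
next
  case False
  let ?M = "max 1 (max_counterexample h)"
  obtain q where q: "?M \<le> 2 ^ q" "real q \<le> log 2 (real ?M) + 1"
    using power_of_two_above[of ?M] by auto
  have "length w \<le> 2 ^ q" if "Counterexample w \<in> set h" for w
    using length_le_max_counterexample[OF that] q(1) by simp
  then have "real (member_queries h) \<le> real (1 + 4 * n * k * N ^ 2 + N * (q + N + 2 * k + 3))"
    unfolding of_nat_le_iff by (rule dialogue_bounds(1)[OF h])
  also have "\<dots> = 1 + 4 * real n * real k * real N ^ 2 + real N * (real q + real N + 2 * real k + 3)"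
    by simp
  also have "\<dots> \<le> 12 * (real k * real n * real N ^ 2 + real N * log 2 (real ?M))"
    using False n_pos N_pos q(2) by (intro query_bound_absorbs_lower_terms) simp_all
  finally show ?thesis .
qed

end

theorem theorem5p2:
  shows "\<exists>C :: real. \<forall>(\<Sigma> :: 'a set) (D :: 'd set).
    finite \<Sigma> \<and> \<Sigma> \<noteq> {} \<and> infinite D \<longrightarrow>
    (\<exists>\<Lambda> :: ('a, 'd) learner. algorithm \<Sigma> D \<Lambda> \<and>
      (\<forall>A :: ('s, 'a) session_automaton. session_automaton \<Sigma> A \<longrightarrow>
        (let L = data_lang \<Sigma> D A;
             k = snf_registers \<Sigma> L;
             N = canonical_size \<Sigma> L
         in
           (\<forall>h. dialogue \<Sigma> D L \<Lambda> h \<longrightarrow> admissible \<Sigma> D (\<Lambda> h)) \<and>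
           (\<nexists>f :: nat \<Rightarrow> ('a, 'd) answer. \<forall>n. dialogue \<Sigma> D L \<Lambda> (map f [0..<n])) \<and>
           (\<forall>h H. dialogue \<Sigma> D L \<Lambda> h \<and> \<Lambda> h = Output H \<longrightarrow>
              data_lang \<Sigma> D H = L \<and> canonical \<Sigma> L H \<and>
              (let M = max_counterexample h
               in real (member_queries h)
                    \<le> C * (real k * real (card \<Sigma>) * real N ^ 2
                            + real N * log 2 (real (max 1 M)))) \<and>
              real (equiv_queries h) \<le> C * real N))))"
proof (intro exI[of _ 12] allI impI, goal_cases)
  case (1 \<Sigma> D)
  obtain \<alpha> where "bij_betw \<alpha> \<Sigma> {..<card \<Sigma>}"
    using ex_bij_betw_finite_nat[of \<Sigma>] 1 by (auto simp: lessThan_atLeast0)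
  moreover obtain \<nu> :: "nat \<Rightarrow> 'd" where "inj \<nu>" "range \<nu> \<subseteq> D"
    using infinite_countable_subset[of D] 1 by blast
  ultimately interpret session_learner \<Sigma> D \<alpha> \<nu> using 1 by unfold_locales auto
  note target = session_target.intro[OF session_learner_axioms session_target_axioms.intro]
  note terminates = session_target.no_infinite_dialogue[OF target]
    and correct = session_target.output_correct(1)[OF target]
      session_target.output_correct(2)[OF target]
    and bounds = session_target.member_queries_bound[OF target]
      session_target.equiv_queries_bound[OF target]
  show ?case
    unfolding Let_def
    using algorithm_learner admissible_learner terminates correct bounds
    by (intro exI[of _ learner] conjI allI impI) blast+
qed

end
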